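(* Let $\varphi$ and $\psi$ be propositional strictly positive formulas. Then $\varphi \vdash_{\mathrm{RC}_1} \psi$ if and only if for every arithmetical realization $\cdot^*$ we have $\mathrm{HA} \vdash \varphi^{*\mathrm{HA}} \rightarrow \psi^{*\mathrm{HA}}$.
   Context: Propositional strictly positive (p.s.p.) formulas are built by $\varphi ::= \top \mid p \mid (\varphi\wedge\varphi) \mid \Diamond\varphi$, with $p$ ranging over propositional variables. The Reflection Calculus $\mathrm{RC}_1$ derives sequents $\varphi\vdash\psi$ between p.s.p. formulas by the axioms and rules: $\varphi\vdash\varphi$ and $\varphi\vdash\top$; $\varphi\wedge\psi\vdash\varphi$ and $\varphi\wedge\psi\vdash\psi$; if $\varphi\vdash\psi$ and $\varphi\vdash\chi$ then $\varphi\vdash\psi\wedge\chi$; if $\varphi\vdash\psi$ and $\psi\vdash\chi$ then $\varphi\vdash\chi$; if $\varphi\vdash\psi$ then $\Diamond\varphi\vdash\Diamond\psi$; $\Diamond\Diamond\varphi\vdash\Diamond\varphi$. An arithmetical realization $\cdot^*$ maps each propositional variable to a sentence of the language of arithmetic. For a c.e. theory $T$ (with a fixed standard axiomatization and its formalized provability predicate $\Box_T$, and $\Diamond_T\chi := \neg\Box_T\neg\chi$), the translation $\cdot^{*T}$ is defined by $p^{*T}:=p^*$, $\top^{*T}$ a true trivial sentence such as $0=0$, $(\varphi\wedge\psi)^{*T}:=\varphi^{*T}\wedge\psi^{*T}$, and $(\Diamond\varphi)^{*T} := \Diamond_T\varphi^{*T}$. HA is Heyting Arithmetic. *)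

theory Defs
  imports Main
begin

section \<open>Strictly positive formulas and the Reflection Calculus\<close>

datatype sp = Top | PVar nat | And sp sp | Dia sp

inductive RC1 :: "sp \<Rightarrow> sp \<Rightarrow> bool"  (infix "\<turnstile>\<^sub>R\<^sub>C" 50) where
  rc_refl: "\<phi> \<turnstile>\<^sub>R\<^sub>C \<phi>"
| rc_top: "\<phi> \<turnstile>\<^sub>R\<^sub>C Top"
| rc_conj1: "And \<phi> \<psi> \<turnstile>\<^sub>R\<^sub>C \<phi>"
| rc_conj2: "And \<phi> \<psi> \<turnstile>\<^sub>R\<^sub>C \<psi>"
| rc_conjI: "\<phi> \<turnstile>\<^sub>R\<^sub>C \<psi> \<Longrightarrow> \<phi> \<turnstile>\<^sub>R\<^sub>C \<chi> \<Longrightarrow> \<phi> \<turnstile>\<^sub>R\<^sub>C And \<psi> \<chi>"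
| rc_cut: "\<phi> \<turnstile>\<^sub>R\<^sub>C \<psi> \<Longrightarrow> \<psi> \<turnstile>\<^sub>R\<^sub>C \<chi> \<Longrightarrow> \<phi> \<turnstile>\<^sub>R\<^sub>C \<chi>"
| rc_nec: "\<phi> \<turnstile>\<^sub>R\<^sub>C \<psi> \<Longrightarrow> Dia \<phi> \<turnstile>\<^sub>R\<^sub>C Dia \<psi>"
| rc_trans: "Dia (Dia \<phi>) \<turnstile>\<^sub>R\<^sub>C Dia \<phi>"


section \<open>The language of arithmetic\<close>

text \<open>First-order syntax over \<open>0, S, +, \<times>, =\<close> with de Bruijn indices:
  \<^term>\<open>Var 0\<close> is bound by the innermost quantifier.\<close>

datatype tm = Var nat | Zero | Succ tm | Add tm tm | Mul tm tm

datatype fm = Eq tm tm | Bot | Conj fm fm | Disj fm fm | Imp fm fm | Forall fm | Exists fm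

abbreviation Neg :: "fm \<Rightarrow> fm" where
  "Neg A \<equiv> Imp A Bot"

text \<open>\<open>lift c\<close> increments all variables \<open>\<ge> c\<close>; \<open>sub d s\<close> replaces variable \<open>d\<close> by \<open>s\<close>
  and decrements all variables \<open>> d\<close>, so that \<open>sub 0 t A\<close> instantiates the
  outermost quantifier of \<open>Forall A\<close> or \<open>Exists A\<close> with \<open>t\<close>.\<close>

primrec lift_tm :: "nat \<Rightarrow> tm \<Rightarrow> tm" where
  "lift_tm c (Var i) = (if i < c then Var i else Var (Suc i))"
| "lift_tm c Zero = Zero"
| "lift_tm c (Succ t) = Succ (lift_tm c t)"
| "lift_tm c (Add s t) = Add (lift_tm c s) (lift_tm c t)"
| "lift_tm c (Mul s t) = Mul (lift_tm c s) (lift_tm c t)"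

primrec lift :: "nat \<Rightarrow> fm \<Rightarrow> fm" where
  "lift c (Eq s t) = Eq (lift_tm c s) (lift_tm c t)"
| "lift c Bot = Bot"
| "lift c (Conj A B) = Conj (lift c A) (lift c B)"
| "lift c (Disj A B) = Disj (lift c A) (lift c B)"
| "lift c (Imp A B) = Imp (lift c A) (lift c B)"
| "lift c (Forall A) = Forall (lift (Suc c) A)"
| "lift c (Exists A) = Exists (lift (Suc c) A)"

primrec sub_tm :: "nat \<Rightarrow> tm \<Rightarrow> tm \<Rightarrow> tm" where
  "sub_tm d u (Var i) = (if i < d then Var i else if i = d then u else Var (i - 1))"
| "sub_tm d u Zero = Zero"
| "sub_tm d u (Succ t) = Succ (sub_tm d u t)"
| "sub_tm d u (Add s t) = Add (sub_tm d u s) (sub_tm d u t)"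
| "sub_tm d u (Mul s t) = Mul (sub_tm d u s) (sub_tm d u t)"

primrec sub :: "nat \<Rightarrow> tm \<Rightarrow> fm \<Rightarrow> fm" where
  "sub d u (Eq s t) = Eq (sub_tm d u s) (sub_tm d u t)"
| "sub d u Bot = Bot"
| "sub d u (Conj A B) = Conj (sub d u A) (sub d u B)"
| "sub d u (Disj A B) = Disj (sub d u A) (sub d u B)"
| "sub d u (Imp A B) = Imp (sub d u A) (sub d u B)"
| "sub d u (Forall A) = Forall (sub (Suc d) (lift_tm 0 u) A)"
| "sub d u (Exists A) = Exists (sub (Suc d) (lift_tm 0 u) A)"

primrec vars_below_tm :: "nat \<Rightarrow> tm \<Rightarrow> bool" where
  "vars_below_tm n (Var i) \<longleftrightarrow> i < n"
| "vars_below_tm n Zero \<longleftrightarrow> True"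
| "vars_below_tm n (Succ t) \<longleftrightarrow> vars_below_tm n t"
| "vars_below_tm n (Add s t) \<longleftrightarrow> vars_below_tm n s \<and> vars_below_tm n t"
| "vars_below_tm n (Mul s t) \<longleftrightarrow> vars_below_tm n s \<and> vars_below_tm n t"

primrec vars_below :: "nat \<Rightarrow> fm \<Rightarrow> bool" where
  "vars_below n (Eq s t) \<longleftrightarrow> vars_below_tm n s \<and> vars_below_tm n t"
| "vars_below n Bot \<longleftrightarrow> True"
| "vars_below n (Conj A B) \<longleftrightarrow> vars_below n A \<and> vars_below n B"
| "vars_below n (Disj A B) \<longleftrightarrow> vars_below n A \<and> vars_below n B"
| "vars_below n (Imp A B) \<longleftrightarrow> vars_below n A \<and> vars_below n B"
| "vars_below n (Forall A) \<longleftrightarrow> vars_below (Suc n) A"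
| "vars_below n (Exists A) \<longleftrightarrow> vars_below (Suc n) A"

definition sentence :: "fm \<Rightarrow> bool" where
  "sentence A \<longleftrightarrow> vars_below 0 A"


section \<open>Heyting Arithmetic\<close>

text \<open>A Hilbert-style calculus for intuitionistic predicate logic with equality, plus the
  arithmetical axioms. In \<open>ha_ind\<close>, \<open>sub 0 (Succ (Var 0)) (lift 1 A)\<close> is \<open>A(Sx)\<close>
  as a formula in the same variables as \<open>A(x)\<close>.\<close>

inductive HA :: "fm \<Rightarrow> bool"  ("HA \<turnstile> _" [50] 50) where
  ha_K: "HA \<turnstile> Imp A (Imp B A)"
| ha_S: "HA \<turnstile> Imp (Imp A (Imp B C)) (Imp (Imp A B) (Imp A C))"
| ha_conj1: "HA \<turnstile> Imp (Conj A B) A"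
| ha_conj2: "HA \<turnstile> Imp (Conj A B) B"
| ha_conjI: "HA \<turnstile> Imp A (Imp B (Conj A B))"
| ha_disj1: "HA \<turnstile> Imp A (Disj A B)"
| ha_disj2: "HA \<turnstile> Imp B (Disj A B)"
| ha_disjE: "HA \<turnstile> Imp (Imp A C) (Imp (Imp B C) (Imp (Disj A B) C))"
| ha_bot: "HA \<turnstile> Imp Bot A"
| ha_all: "HA \<turnstile> Imp (Forall A) (sub 0 t A)"
| ha_ex: "HA \<turnstile> Imp (sub 0 t A) (Exists A)"
| ha_eq_refl: "HA \<turnstile> Eq t t"
| ha_eq_subst: "HA \<turnstile> Imp (Eq s t) (Imp (sub 0 s A) (sub 0 t A))"
| ha_succ_nz: "HA \<turnstile> Neg (Eq (Succ t) Zero)"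
| ha_succ_inj: "HA \<turnstile> Imp (Eq (Succ s) (Succ t)) (Eq s t)"
| ha_add0: "HA \<turnstile> Eq (Add s Zero) s"
| ha_addS: "HA \<turnstile> Eq (Add s (Succ t)) (Succ (Add s t))"
| ha_mul0: "HA \<turnstile> Eq (Mul s Zero) Zero"
| ha_mulS: "HA \<turnstile> Eq (Mul s (Succ t)) (Add (Mul s t) s)"
| ha_ind: "HA \<turnstile> Imp (sub 0 Zero A)
             (Imp (Forall (Imp A (sub 0 (Succ (Var 0)) (lift 1 A)))) (Forall A))"
| ha_mp: "HA \<turnstile> Imp A B \<Longrightarrow> HA \<turnstile> A \<Longrightarrow> HA \<turnstile> B"
| ha_allI: "HA \<turnstile> Imp (lift 0 A) B \<Longrightarrow> HA \<turnstile> Imp A (Forall B)"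
| ha_exE: "HA \<turnstile> Imp A (lift 0 B) \<Longrightarrow> HA \<turnstile> Imp (Exists A) B"


section \<open>Goedel numbering\<close>

text \<open>Shoenfield's pairing function; it is injective, and it is a term of the language.\<close>

definition pair :: "nat \<Rightarrow> nat \<Rightarrow> nat" where
  "pair m n = Suc ((m + n) * (m + n) + m)"

primrec code_tm :: "tm \<Rightarrow> nat" where
  "code_tm (Var i) = pair 0 i"
| "code_tm Zero = pair 1 0"
| "code_tm (Succ t) = pair 2 (code_tm t)"
| "code_tm (Add s t) = pair 3 (pair (code_tm s) (code_tm t))"
| "code_tm (Mul s t) = pair 4 (pair (code_tm s) (code_tm t))"

primrec code :: "fm \<Rightarrow> nat" where
  "code (Eq s t) = pair 5 (pair (code_tm s) (code_tm t))"
| "code Bot = pair 6 0"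
| "code (Conj A B) = pair 7 (pair (code A) (code B))"
| "code (Disj A B) = pair 8 (pair (code A) (code B))"
| "code (Imp A B) = pair 9 (pair (code A) (code B))"
| "code (Forall A) = pair 10 (code A)"
| "code (Exists A) = pair 11 (code A)"

primrec num :: "nat \<Rightarrow> tm" where
  "num 0 = Zero"
| "num (Suc n) = Succ (num n)"


section \<open>Arithmetization of the calculus\<close>

text \<open>Object-level terms for the pairing function and the syntactic constructors.\<close>

definition qpair :: "tm \<Rightarrow> tm \<Rightarrow> tm" where
  "qpair s t = Succ (Add (Mul (Add s t) (Add s t)) s)"

abbreviation q1 :: "nat \<Rightarrow> tm \<Rightarrow> tm" where
  "q1 k x \<equiv> qpair (num k) x"

abbreviation q2 :: "nat \<Rightarrow> tm \<Rightarrow> tm \<Rightarrow> tm" where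
  "q2 k x y \<equiv> qpair (num k) (qpair x y)"

abbreviation "qVar \<equiv> q1 0"
abbreviation "qZero \<equiv> q1 1 Zero"
abbreviation "qSucc \<equiv> q1 2"
abbreviation "qAdd \<equiv> q2 3"
abbreviation "qMul \<equiv> q2 4"
abbreviation "qEq \<equiv> q2 5"
abbreviation "qBot \<equiv> q1 6 Zero"
abbreviation "qConj \<equiv> q2 7"
abbreviation "qDisj \<equiv> q2 8"
abbreviation "qImp \<equiv> q2 9"
abbreviation "qForall \<equiv> q1 10"
abbreviation "qExists \<equiv> q1 11"

text \<open>A derivation is a finite sequence of coded judgements of five kinds:
  \<open>x\<close> codes a term; \<open>x\<close> codes a formula; lifting \<open>x\<close> at cutoff \<open>c\<close> yields \<open>y\<close>;
  substituting \<open>s\<close> for variable \<open>d\<close> in \<open>x\<close> yields \<open>y\<close>; \<open>x\<close> is provable.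
  (Lifting and substitution treat terms and formulas together, as the codes are disjoint.)\<close>

abbreviation "jTm x \<equiv> qpair (num 0) x"
abbreviation "jFm x \<equiv> qpair (num 1) x"
abbreviation "jLift c x y \<equiv> qpair (num 2) (qpair c (qpair x y))"
abbreviation "jSub d s x y \<equiv> qpair (num 3) (qpair d (qpair s (qpair x y)))"
abbreviation "jPrv x \<equiv> qpair (num 4) x"

text \<open>A rule \<open>ps \<leadsto> c\<close> has premises \<open>ps\<close> and conclusion \<open>c\<close>;
  \<^term>\<open>Var 0\<close>, \dots, \<^term>\<open>Var 5\<close> are its schematic variables, ranging over numbers.\<close>

type_synonym rule = "tm list \<times> tm"

abbreviation mk_rule :: "tm list \<Rightarrow> tm \<Rightarrow> rule"  (infix "\<leadsto>" 55) where
  "ps \<leadsto> c \<equiv> (ps, c)"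

abbreviation "X0 \<equiv> Var 0"
abbreviation "X1 \<equiv> Var 1"
abbreviation "X2 \<equiv> Var 2"
abbreviation "X3 \<equiv> Var 3"
abbreviation "X4 \<equiv> Var 4"
abbreviation "X5 \<equiv> Var 5"

definition syntax_rules :: "rule list" where
  "syntax_rules =
    [ [] \<leadsto> jTm (qVar X0),
      [] \<leadsto> jTm qZero,
      [jTm X0] \<leadsto> jTm (qSucc X0),
      [jTm X0, jTm X1] \<leadsto> jTm (qAdd X0 X1),
      [jTm X0, jTm X1] \<leadsto> jTm (qMul X0 X1),
      [jTm X0, jTm X1] \<leadsto> jFm (qEq X0 X1),
      [] \<leadsto> jFm qBot,
      [jFm X0, jFm X1] \<leadsto> jFm (qConj X0 X1),
      [jFm X0, jFm X1] \<leadsto> jFm (qDisj X0 X1),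
      [jFm X0, jFm X1] \<leadsto> jFm (qImp X0 X1),
      [jFm X0] \<leadsto> jFm (qForall X0),
      [jFm X0] \<leadsto> jFm (qExists X0) ]"

text \<open>The conditions \<open>i < c\<close>, \<open>i \<ge> c\<close> on variables are expressed by writing
  the larger number as a sum.\<close>

definition lift_rules :: "rule list" where
  "lift_rules =
    [ [] \<leadsto> jLift (Succ (Add X0 X1)) (qVar X0) (qVar X0),
      [] \<leadsto> jLift X0 (qVar (Add X0 X1)) (qVar (Succ (Add X0 X1))),
      [] \<leadsto> jLift X0 qZero qZero,
      [] \<leadsto> jLift X0 qBot qBot,
      [jLift X0 X1 X2] \<leadsto> jLift X0 (qSucc X1) (qSucc X2) ]
    @ map (\<lambda>k. [jLift X0 X1 X2, jLift X0 X3 X4] \<leadsto> jLift X0 (q2 k X1 X3) (q2 k X2 X4))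
        [3, 4, 5, 7, 8, 9]
    @ map (\<lambda>k. [jLift (Succ X0) X1 X2] \<leadsto> jLift X0 (q1 k X1) (q1 k X2))
        [10, 11]"

definition sub_rules :: "rule list" where
  "sub_rules =
    [ [] \<leadsto> jSub (Succ (Add X0 X1)) X2 (qVar X0) (qVar X0),
      [] \<leadsto> jSub X0 X2 (qVar X0) X2,
      [] \<leadsto> jSub X0 X2 (qVar (Succ (Add X0 X1))) (qVar (Add X0 X1)),
      [] \<leadsto> jSub X0 X1 qZero qZero,
      [] \<leadsto> jSub X0 X1 qBot qBot,
      [jSub X0 X1 X2 X3] \<leadsto> jSub X0 X1 (qSucc X2) (qSucc X3) ]
    @ map (\<lambda>k. [jSub X0 X1 X2 X3, jSub X0 X1 X4 X5]
                 \<leadsto> jSub X0 X1 (q2 k X2 X4) (q2 k X3 X5))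
        [3, 4, 5, 7, 8, 9]
    @ map (\<lambda>k. [jLift Zero X1 X4, jSub (Succ X0) X4 X2 X3]
                 \<leadsto> jSub X0 X1 (q1 k X2) (q1 k X3))
        [10, 11]"

text \<open>The rules of \<^const>\<open>HA\<close>, in the same order.\<close>

definition HA_rules :: "rule list" where
  "HA_rules =
    [ [jFm X0, jFm X1] \<leadsto> jPrv (qImp X0 (qImp X1 X0)),
      [jFm X0, jFm X1, jFm X2] \<leadsto>
        jPrv (qImp (qImp X0 (qImp X1 X2)) (qImp (qImp X0 X1) (qImp X0 X2))),
      [jFm X0, jFm X1] \<leadsto> jPrv (qImp (qConj X0 X1) X0),
      [jFm X0, jFm X1] \<leadsto> jPrv (qImp (qConj X0 X1) X1),
      [jFm X0, jFm X1] \<leadsto> jPrv (qImp X0 (qImp X1 (qConj X0 X1))),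
      [jFm X0, jFm X1] \<leadsto> jPrv (qImp X0 (qDisj X0 X1)),
      [jFm X0, jFm X1] \<leadsto> jPrv (qImp X1 (qDisj X0 X1)),
      [jFm X0, jFm X1, jFm X2] \<leadsto>
        jPrv (qImp (qImp X0 X2) (qImp (qImp X1 X2) (qImp (qDisj X0 X1) X2))),
      [jFm X0] \<leadsto> jPrv (qImp qBot X0),
      [jFm X0, jTm X1, jSub Zero X1 X0 X2] \<leadsto> jPrv (qImp (qForall X0) X2),
      [jFm X0, jTm X1, jSub Zero X1 X0 X2] \<leadsto> jPrv (qImp X2 (qExists X0)),
      [jTm X0] \<leadsto> jPrv (qEq X0 X0),
      [jTm X0, jTm X1, jFm X2, jSub Zero X0 X2 X3, jSub Zero X1 X2 X4] \<leadsto>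
        jPrv (qImp (qEq X0 X1) (qImp X3 X4)),
      [jTm X0] \<leadsto> jPrv (qImp (qEq (qSucc X0) qZero) qBot),
      [jTm X0, jTm X1] \<leadsto> jPrv (qImp (qEq (qSucc X0) (qSucc X1)) (qEq X0 X1)),
      [jTm X0] \<leadsto> jPrv (qEq (qAdd X0 qZero) X0),
      [jTm X0, jTm X1] \<leadsto> jPrv (qEq (qAdd X0 (qSucc X1)) (qSucc (qAdd X0 X1))),
      [jTm X0] \<leadsto> jPrv (qEq (qMul X0 qZero) qZero),
      [jTm X0, jTm X1] \<leadsto> jPrv (qEq (qMul X0 (qSucc X1)) (qAdd (qMul X0 X1) X0)),
      [jFm X0, jSub Zero qZero X0 X1, jLift (num 1) X0 X2,
       jSub Zero (qSucc (qVar Zero)) X2 X3] \<leadsto>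
        jPrv (qImp X1 (qImp (qForall (qImp X0 X3)) (qForall X0))),
      [jPrv (qImp X0 X1), jPrv X0] \<leadsto> jPrv X1,
      [jFm X0, jLift Zero X0 X1, jPrv (qImp X1 X2)] \<leadsto> jPrv (qImp X0 (qForall X2)),
      [jFm X1, jLift Zero X1 X2, jPrv (qImp X0 X2)] \<leadsto> jPrv (qImp (qExists X0) X1) ]"

definition rules :: "rule list" where
  "rules = syntax_rules @ lift_rules @ sub_rules @ HA_rules"

definition lifts :: "nat \<Rightarrow> tm \<Rightarrow> tm" where
  "lifts k t = (lift_tm 0 ^^ k) t"

definition le_fm :: "tm \<Rightarrow> tm \<Rightarrow> fm" where
  "le_fm s t = Exists (Eq (Add (lifts 1 s) (Var 0)) (lifts 1 t))"

text \<open>Goedel's beta function: \<open>y\<close> is the remainder of \<open>a\<close> modulo \<open>1 + (i + 1) b\<close>.\<close>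

definition beta_fm :: "tm \<Rightarrow> tm \<Rightarrow> tm \<Rightarrow> tm \<Rightarrow> fm" where
  "beta_fm a b i y =
    Conj (le_fm y (Mul (Succ i) b))
      (Exists (Eq (lifts 1 a) (Add (Mul (Var 0) (Succ (Mul (Succ (lifts 1 i)) (lifts 1 b)))) (lifts 1 y))))"

definition conjs :: "fm list \<Rightarrow> fm" where
  "conjs As = foldr Conj As (Eq Zero Zero)"

definition disjs :: "fm list \<Rightarrow> fm" where
  "disjs As = foldr Disj As Bot"

text \<open>Entry \<open>i\<close> of the sequence coded by \<open>a, b\<close> is the conclusion of an instance of the rule whose
  premises all occur among the entries before \<open>i\<close>. The six quantifiers bind the schematic
  variables of the rule.\<close>

definition by_rule :: "tm \<Rightarrow> tm \<Rightarrow> tm \<Rightarrow> rule \<Rightarrow> fm" where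
  "by_rule a b i r = (case r of (ps, c) \<Rightarrow>
    (Exists ^^ 6) (Conj (beta_fm (lifts 6 a) (lifts 6 b) (lifts 6 i) c)
      (conjs (map (\<lambda>p. Exists (Conj (le_fm (Succ (Var 0)) (lifts 7 i))
                                 (beta_fm (lifts 7 a) (lifts 7 b) (Var 0) (lifts 1 p)))) ps))))"

text \<open>\<open>Prov t\<close>: there are \<open>a\<close> (\<^term>\<open>Var 2\<close>), \<open>b\<close> (\<^term>\<open>Var 1\<close>) and \<open>n\<close> (\<^term>\<open>Var 0\<close>) such that
  entry \<open>n\<close> of the sequence coded by \<open>a, b\<close> is the judgement that \<open>t\<close> is provable, and every
  entry \<open>i \<le> n\<close> follows by a rule from earlier entries.\<close>

definition Prov :: "tm \<Rightarrow> fm" where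
  "Prov t = Exists (Exists (Exists (Conj
     (beta_fm (Var 2) (Var 1) (Var 0) (jPrv (lifts 3 t)))
     (Forall (Imp (le_fm (Var 0) (Var 1))
       (disjs (map (by_rule (Var 3) (Var 2) (Var 0)) rules)))))))"

definition BoxHA :: "fm \<Rightarrow> fm" where
  "BoxHA A = Prov (num (code A))"

definition DiaHA :: "fm \<Rightarrow> fm" where
  "DiaHA A = Neg (BoxHA (Neg A))"


section \<open>Arithmetical realizations\<close>

definition realization :: "(nat \<Rightarrow> fm) \<Rightarrow> bool" where
  "realization r \<longleftrightarrow> (\<forall>p. sentence (r p))"

primrec interp :: "(nat \<Rightarrow> fm) \<Rightarrow> sp \<Rightarrow> fm" where
  "interp r Top = Eq Zero Zero"
| "interp r (PVar p) = r p"
| "interp r (And \<phi> \<psi>) = Conj (interp r \<phi>) (interp r \<psi>)"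
| "interp r (Dia \<phi>) = DiaHA (interp r \<phi>)"

end

(*
HA proves an implication between negative formulas (no disjunction, no existential quantifier) as soon
as it holds in all classical models of PA, because HA is stable on such formulas and a Henkin
construction applies.  Sigma formulas and their negations are equivalent, up to double negation, to
negative formulas, so every fact about provability that is needed may be established inside an
arbitrary model M of PA.

In M, the beta function gives concatenation of (possibly nonstandard) derivations, hence closure of
provability under the rules of HA; with numerals for the elements of M one gets provable Sigma
completeness.  The derivability conditions follow, and with them soundness of RC1.

For completeness, a sequent that is not derivable fails in the tree of iterated diamond subformulas
of its left-hand side.  Its Solovay sentences S p come from a variant of Solovay's construction that
only moves to immediate successors.  With X p the provability of the negation of S p, the root is
entered iff X holds there, and v # p is entered iff p is entered and X (v # p) is verified before
X (u # p) for all siblings u of v; S p says that p is entered and X (v # p) fails for all children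
v.  Transitivity of provability takes care of the other descendants.
*)

theory Submission
  imports Defs "HOL-Library.Countable_Set"
begin

section \<open>Parallel substitution\<close>

text \<open>The obstacle is that a Sigma formula need not follow in HA from its negative
  translation: that would amount to Markov's principle. Strictly positive formulas escape it because
  every diamond is a negated Sigma sentence, and completeness needs only one realization, which can
  be chosen with negative values. Moving only to immediate successors makes "p is entered" a finite
  conjunction of Sigma comparisons along the path to p. Neither the computation of a Solovay
  function nor its limit has to be arithmetized, and one formula that receives its own code as a
  parameter yields all Solovay sentences at once. Nodes are paths rather than formulas because a
  subformula may be reached in several ways, whereas the entered nodes must form a single branch.
  There is no additional node below the root, as in the usual construction: the root itself waits
  for a refutation of its own sentence, and reflection in the standard model shows that none
  exists.\<close>

primrec psub_tm :: "(nat => tm) => tm => tm" where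
  "psub_tm \<sigma> (Var i) = \<sigma> i"
| "psub_tm \<sigma> Zero = Zero"
| "psub_tm \<sigma> (Succ t) = Succ (psub_tm \<sigma> t)"
| "psub_tm \<sigma> (Add s t) = Add (psub_tm \<sigma> s) (psub_tm \<sigma> t)"
| "psub_tm \<sigma> (Mul s t) = Mul (psub_tm \<sigma> s) (psub_tm \<sigma> t)"

definition up :: "(nat => tm) => nat => tm" where
  "up \<sigma> = case_nat (Var 0) (\<lambda>i. lift_tm 0 (\<sigma> i))"

text \<open>\<open>lift\<close> and \<open>sub\<close> are both instances (\<open>lift_psub\<close>,
  \<open>sub_psub\<close>), so each commutation law between them follows from
  \<open>psub_comp\<close> by comparing two substitutions variable by variable.\<close>

primrec psub :: "(nat => tm) => fm => fm" where
  "psub \<sigma> (Eq s t) = Eq (psub_tm \<sigma> s) (psub_tm \<sigma> t)"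
| "psub \<sigma> Bot = Bot"
| "psub \<sigma> (Conj A B) = Conj (psub \<sigma> A) (psub \<sigma> B)"
| "psub \<sigma> (Disj A B) = Disj (psub \<sigma> A) (psub \<sigma> B)"
| "psub \<sigma> (Imp A B) = Imp (psub \<sigma> A) (psub \<sigma> B)"
| "psub \<sigma> (Forall A) = Forall (psub (up \<sigma>) A)"
| "psub \<sigma> (Exists A) = Exists (psub (up \<sigma>) A)"

lemma up_0 [simp]: "up \<sigma> 0 = Var 0" and up_Suc [simp]: "up \<sigma> (Suc i) = lift_tm 0 (\<sigma> i)"
  by (simp_all add: up_def)

lemma lift_tm_psub: "lift_tm c t = psub_tm (\<lambda>i. if i < c then Var i else Var (Suc i)) t"
  by (induction t) auto

lemma sub_tm_psub:
  "sub_tm d u t = psub_tm (\<lambda>i. if i < d then Var i else if i = d then u else Var (i - 1)) t"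
  by (induction t) auto

lemma up_lift: "up (\<lambda>i. if i < c then Var i else Var (Suc i))
    = (\<lambda>i. if i < Suc c then Var i else Var (Suc i))"
  by (rule ext) (auto simp: up_def split: nat.split)

lemma up_sub: "up (\<lambda>i. if i < d then Var i else if i = d then u else Var (i - 1))
    = (\<lambda>i. if i < Suc d then Var i else if i = Suc d then lift_tm 0 u else Var (i - 1))"
  by (rule ext) (auto simp: up_def split: nat.split)

lemma lift_psub: "lift c A = psub (\<lambda>i. if i < c then Var i else Var (Suc i)) A"
  by (induction A arbitrary: c) (simp_all add: lift_tm_psub up_lift)

lemma sub_psub:
  "sub d u A = psub (\<lambda>i. if i < d then Var i else if i = d then u else Var (i - 1)) A"
  by (induction A arbitrary: d u) (simp_all add: sub_tm_psub up_sub)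

lemma psub_tm_comp: "psub_tm \<sigma> (psub_tm \<tau> t) = psub_tm (\<lambda>i. psub_tm \<sigma> (\<tau> i)) t"
  by (induction t) auto

lemma psub_tm_up_lift: "psub_tm (up \<sigma>) (lift_tm 0 t) = lift_tm 0 (psub_tm \<sigma> t)"
  by (induction t) auto

lemma up_comp: "up (\<lambda>i. psub_tm \<sigma> (\<tau> i)) = (\<lambda>i. psub_tm (up \<sigma>) (up \<tau> i))"
  by (rule ext) (auto simp: up_def psub_tm_up_lift[unfolded up_def] split: nat.split)

lemma psub_comp: "psub \<sigma> (psub \<tau> A) = psub (\<lambda>i. psub_tm \<sigma> (\<tau> i)) A"
  by (induction A arbitrary: \<sigma> \<tau>) (simp_all add: psub_tm_comp up_comp)

lemma psub_tm_Var [simp]: "psub_tm Var t = t"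
  by (induction t) auto

lemma up_Var [simp]: "up Var = Var"
  by (rule ext) (auto simp: up_def split: nat.split)

lemma psub_Var [simp]: "psub Var A = A"
  by (induction A) simp_all

lemma psub_id: "(!!i. \<sigma> i = Var i) ==> psub \<sigma> A = A"
proof -
  assume "!!i. \<sigma> i = Var i"
  then have "\<sigma> = Var" by (rule ext)
  then show ?thesis by simp
qed

lemma psub_eqI: "(!!i. \<sigma> i = \<tau> i) ==> psub \<sigma> A = psub \<tau> A"
  by (rule arg_cong[of \<sigma> \<tau> "\<lambda>s. psub s A"]) (rule ext)

lemma psub_tm_below: "vars_below_tm n t ==> (!!i. i < n ==> \<sigma> i = \<tau> i) ==> psub_tm \<sigma> t = psub_tm \<tau> t"
  by (induction t) auto

lemma psub_below: "vars_below n A ==> (!!i. i < n ==> \<sigma> i = \<tau> i) ==> psub \<sigma> A = psub \<tau> A"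
proof (induction A arbitrary: n \<sigma> \<tau>)
  case (Forall A)
  have *: "up \<sigma> i = up \<tau> i" if "i < Suc n" for i
    using that Forall.prems(2)[of "i - 1"] by (cases i) simp_all
  show ?case using Forall.IH[of "Suc n", OF _ *] Forall.prems(1) by simp
next
  case (Exists A)
  have *: "up \<sigma> i = up \<tau> i" if "i < Suc n" for i
    using that Exists.prems(2)[of "i - 1"] by (cases i) simp_all
  show ?case using Exists.IH[of "Suc n", OF _ *] Exists.prems(1) by simp
next
  case (Eq s t)
  then show ?case using psub_tm_below[of n s \<sigma> \<tau>] psub_tm_below[of n t \<sigma> \<tau>] by simp
next
  case Bot
  then show ?case by simp
qed (simp; metis)+

lemma vars_below_psub_tm:
  "vars_below_tm n t ==> (!!i. i < n ==> vars_below_tm k (\<sigma> i)) ==> vars_below_tm k (psub_tm \<sigma> t)"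
  by (induction t) auto

lemma vars_below_lift_tm: "vars_below_tm k t ==> vars_below_tm (Suc k) (lift_tm c t)"
  by (induction t) auto

lemma vars_below_psub:
  "vars_below n A ==> (!!i. i < n ==> vars_below_tm k (\<sigma> i)) ==> vars_below k (psub \<sigma> A)"
proof (induction A arbitrary: n k \<sigma>)
  case (Forall A)
  then show ?case
    using Forall.IH[of "Suc n" "Suc k" "up \<sigma>"] by (auto simp: up_def vars_below_lift_tm split: nat.split)
next
  case (Exists A)
  then show ?case
    using Exists.IH[of "Suc n" "Suc k" "up \<sigma>"] by (auto simp: up_def vars_below_lift_tm split: nat.split)
qed (auto simp: vars_below_psub_tm)

lemma vars_below_tm_mono: "vars_below_tm n t ==> n \<le> k ==> vars_below_tm k t"
  by (induction t) auto

lemma vars_below_mono: "vars_below n A ==> n \<le> k ==> vars_below k A"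
  by (induction A arbitrary: n k) (auto intro: vars_below_tm_mono)

lemma vars_below_tm_ex: "\<exists>n. vars_below_tm n t"
proof (induction t)
  case (Add s t)
  then obtain m n where "vars_below_tm m s" "vars_below_tm n t" by auto
  then show ?case by (auto intro!: exI[of _ "max m n"] elim: vars_below_tm_mono)
next
  case (Mul s t)
  then obtain m n where "vars_below_tm m s" "vars_below_tm n t" by auto
  then show ?case by (auto intro!: exI[of _ "max m n"] elim: vars_below_tm_mono)
qed auto

lemma vars_below_max: "(\<exists>n. vars_below n A) ==> (\<exists>n. vars_below n B) ==> \<exists>n. vars_below n A \<and> vars_below n B"
  by (metis max.cobounded1 max.cobounded2 vars_below_mono)

lemma vars_below_ex: "\<exists>n. vars_below n A"
proof (induction A)
  case (Eq s t)
  obtain m n where "vars_below_tm m s" "vars_below_tm n t" using vars_below_tm_ex by metis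
  then show ?case by (auto intro!: exI[of _ "max m n"] elim: vars_below_tm_mono)
next
  case (Forall A) then show ?case using vars_below_mono[of _ A] by (metis le_SucI order_refl vars_below.simps(6))
next
  case (Exists A) then show ?case using vars_below_mono[of _ A] by (metis le_SucI order_refl vars_below.simps(7))
qed (use vars_below_max in auto)

lemma sub_tm_lift_tm [simp]: "sub_tm c u (lift_tm c t) = t"
  by (induction t) auto

lemma sub_lift [simp]: "sub c u (lift c A) = A"
  by (induction A arbitrary: c u) auto

lemma lift_lift_tm: "lift_tm (Suc c) (lift_tm 0 t) = lift_tm 0 (lift_tm c t)"
  by (induction t) auto

lemma sub_tm_Suc_lift_tm: "sub_tm (Suc c) (lift_tm 0 u) (lift_tm 0 t) = lift_tm 0 (sub_tm c u t)"
  by (induction t) auto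

lemma sub_Var_lift_1 [simp]: "sub 0 (Var 0) (lift (Suc 0) A) = A"
  by (auto simp: lift_psub sub_psub psub_comp intro!: psub_id)

lemma psub_up_lift: "psub (up \<sigma>) (lift 0 A) = lift 0 (psub \<sigma> A)"
  by (simp add: lift_psub psub_comp lift_tm_psub)

lemma psub_sub: "psub \<sigma> (sub 0 t A) = sub 0 (psub_tm \<sigma> t) (psub (up \<sigma>) A)"
  unfolding sub_psub psub_comp
  by (rule psub_eqI) (auto simp: up_def sub_tm_psub[of 0, simplified, symmetric] split: nat.split)

lemma psub_up_up_lift: "psub (up (up \<sigma>)) (lift (Suc 0) A) = lift (Suc 0) (psub (up \<sigma>) A)"
  unfolding lift_psub psub_comp
  by (rule psub_eqI) (auto simp: up_def lift_tm_psub psub_tm_comp split: nat.split)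

text \<open>The axiom schemes are closed under substitution; the quantifier rules use the induction
  hypothesis for \<open>up \<sigma>\<close>, which \<open>psub_up_lift\<close> turns back into a
  lifted premise. This gives \<open>nd_lift\<close> and the renaming of fresh variables in
  \<open>nd_fresh\<close>.\<close>

lemma HA_psub: "HA \<turnstile> A ==> HA \<turnstile> psub \<sigma> A"
proof (induction arbitrary: \<sigma> rule: HA.induct)
  case (ha_eq_subst s t A)
  then show ?case by (simp add: psub_sub HA.ha_eq_subst)
next
  case (ha_mp A B)
  then show ?case by (metis HA.ha_mp psub.simps(5))
next
  case (ha_allI A B)
  from ha_allI.IH[of "up \<sigma>"] show ?case by (simp add: psub_up_lift HA.ha_allI)
next
  case (ha_exE A B)
  from ha_exE.IH[of "up \<sigma>"] show ?case by (simp add: psub_up_lift HA.ha_exE)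
qed (simp_all add: psub_sub psub_up_up_lift HA.intros HA.ha_ind[simplified])


section \<open>Natural deduction\<close>

text \<open>Contexts may be infinite, as the Henkin theory will be. Context and conclusion share
  their free variables, so the quantifier rules lift the context.\<close>

definition nd :: "fm set => fm => bool"  (infix "|-" 45) where
  "\<Gamma> |- A \<longleftrightarrow> (\<exists>\<Delta>. set \<Delta> \<subseteq> \<Gamma> \<and> HA \<turnstile> Imp (conjs \<Delta>) A)"

lemma HA_refl: "HA \<turnstile> Imp A A"
  by (meson ha_K ha_S ha_mp)

lemma HA_weak: "HA \<turnstile> B ==> HA \<turnstile> Imp A B"
  by (meson ha_K ha_mp)

lemma HA_trans: "HA \<turnstile> Imp A B ==> HA \<turnstile> Imp B C ==> HA \<turnstile> Imp A C"
  by (meson ha_S ha_mp HA_weak)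

lemma HA_mp2: "HA \<turnstile> Imp A (Imp B C) ==> HA \<turnstile> Imp A B ==> HA \<turnstile> Imp A C"
  by (meson ha_S ha_mp)

lemma HA_conj: "HA \<turnstile> Imp A B ==> HA \<turnstile> Imp A C ==> HA \<turnstile> Imp A (Conj B C)"
  by (meson HA_mp2 HA_trans ha_conjI)

lemma HA_curry: "HA \<turnstile> Imp (Conj A B) C ==> HA \<turnstile> Imp B (Imp A C)"
  by (meson HA_mp2 HA_trans HA_weak ha_K ha_S ha_conjI ha_mp)

lemma HA_uncurry: "HA \<turnstile> Imp A (Imp B C) ==> HA \<turnstile> Imp (Conj A B) C"
  by (meson HA_mp2 HA_trans ha_conj1 ha_conj2)

lemma HA_flip: "HA \<turnstile> Imp A (Imp B C) ==> HA \<turnstile> Imp B (Imp A C)"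
  by (meson HA_uncurry HA_curry)

lemma conjs_Cons [simp]: "conjs (A # \<Delta>) = Conj A (conjs \<Delta>)" and conjs_Nil [simp]: "conjs [] = Eq Zero Zero"
  by (simp_all add: conjs_def)

lemma disjs_Cons [simp]: "disjs (A # \<Delta>) = Disj A (disjs \<Delta>)" and disjs_Nil [simp]: "disjs [] = Bot"
  by (simp_all add: disjs_def)

lemma conjs_mem: "A \<in> set \<Delta> ==> HA \<turnstile> Imp (conjs \<Delta>) A"
  by (induction \<Delta>) (auto intro: ha_conj1 HA_trans[OF ha_conj2])

lemma conjsI: "(!!B. B \<in> set \<Delta> ==> HA \<turnstile> Imp A B) ==> HA \<turnstile> Imp A (conjs \<Delta>)"
  by (induction \<Delta>) (auto intro: HA_conj HA_weak ha_eq_refl)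

lemma conjs_subset: "set \<Delta> \<subseteq> set \<Delta>' ==> HA \<turnstile> Imp (conjs \<Delta>') (conjs \<Delta>)"
  by (rule conjsI, rule conjs_mem) auto

lemma lift_conjs: "lift c (conjs \<Delta>) = conjs (map (lift c) \<Delta>)"
  by (induction \<Delta>) auto

lemma nd_HA: "HA \<turnstile> A ==> \<Gamma> |- A"
  unfolding nd_def by (rule exI[of _ "[]"]) (simp add: HA_weak)

lemma HA_nd: "{} |- A ==> HA \<turnstile> A"
  unfolding nd_def using ha_mp ha_eq_refl by force

lemma nd_assm: "A \<in> \<Gamma> ==> \<Gamma> |- A"
  unfolding nd_def by (rule exI[of _ "[A]"]) (simp add: ha_conj1)

lemma nd_mono: "\<Gamma> |- A ==> \<Gamma> \<subseteq> \<Gamma>' ==> \<Gamma>' |- A"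
  unfolding nd_def by blast

lemma nd_finite: "\<Gamma> |- A ==> \<exists>\<Delta>\<subseteq>\<Gamma>. finite \<Delta> \<and> \<Delta> |- A"
  unfolding nd_def by (metis List.finite_set order_refl)

lemma nd_mp: assumes "\<Gamma> |- Imp A B" "\<Gamma> |- A" shows "\<Gamma> |- B"
proof -
  obtain \<Delta>1 \<Delta>2 where *: "set \<Delta>1 \<subseteq> \<Gamma>" "HA \<turnstile> Imp (conjs \<Delta>1) (Imp A B)" "set \<Delta>2 \<subseteq> \<Gamma>" "HA \<turnstile> Imp (conjs \<Delta>2) A"
    using assms unfolding nd_def by blast
  have "HA \<turnstile> Imp (conjs (\<Delta>1 @ \<Delta>2)) (conjs \<Delta>1)" "HA \<turnstile> Imp (conjs (\<Delta>1 @ \<Delta>2)) (conjs \<Delta>2)"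
    by (rule conjs_subset; simp)+
  with * have "HA \<turnstile> Imp (conjs (\<Delta>1 @ \<Delta>2)) B" by (meson HA_mp2 HA_trans)
  with * show ?thesis unfolding nd_def by (intro exI[of _ "\<Delta>1 @ \<Delta>2"]) simp
qed

lemma nd_impI: assumes "insert A \<Gamma> |- B" shows "\<Gamma> |- Imp A B"
proof -
  obtain \<Delta> where *: "set \<Delta> \<subseteq> insert A \<Gamma>" "HA \<turnstile> Imp (conjs \<Delta>) B"
    using assms unfolding nd_def by blast
  let ?D = "filter (\<lambda>x. x \<noteq> A) \<Delta>"
  have "HA \<turnstile> Imp (conjs (A # ?D)) (conjs \<Delta>)" by (rule conjs_subset) auto
  with * have "HA \<turnstile> Imp (conjs ?D) (Imp A B)" by (metis HA_curry HA_trans conjs_Cons)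
  with * show ?thesis unfolding nd_def by (intro exI[of _ ?D]) auto
qed

lemma nd_cut: "\<Gamma> |- A ==> insert A \<Gamma> |- B ==> \<Gamma> |- B"
  by (meson nd_impI nd_mp)

lemma nd_HA_mp: "HA \<turnstile> Imp A B ==> \<Gamma> |- A ==> \<Gamma> |- B"
  by (meson nd_HA nd_mp)

lemma nd_conjI: "\<Gamma> |- A ==> \<Gamma> |- B ==> \<Gamma> |- Conj A B"
  by (meson ha_conjI nd_HA nd_mp)

lemma nd_conj1: "\<Gamma> |- Conj A B ==> \<Gamma> |- A"
  by (meson ha_conj1 nd_HA nd_mp)

lemma nd_conj2: "\<Gamma> |- Conj A B ==> \<Gamma> |- B"
  by (meson ha_conj2 nd_HA nd_mp)

lemma nd_disj1: "\<Gamma> |- A ==> \<Gamma> |- Disj A B"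
  by (meson ha_disj1 nd_HA nd_mp)

lemma nd_disj2: "\<Gamma> |- B ==> \<Gamma> |- Disj A B"
  by (meson ha_disj2 nd_HA nd_mp)

lemma nd_disjE: "\<Gamma> |- Disj A B ==> insert A \<Gamma> |- C ==> insert B \<Gamma> |- C ==> \<Gamma> |- C"
  by (meson ha_disjE nd_HA nd_mp nd_impI)

lemma nd_botE: "\<Gamma> |- Bot ==> \<Gamma> |- A"
  by (meson ha_bot nd_HA nd_mp)

lemma nd_allI: assumes "lift 0 ` \<Gamma> |- A" shows "\<Gamma> |- Forall A"
proof -
  obtain \<Delta> where *: "set \<Delta> \<subseteq> lift 0 ` \<Gamma>" "HA \<turnstile> Imp (conjs \<Delta>) A"
    using assms unfolding nd_def by blast
  from *(1) obtain \<Delta>' where D: "set \<Delta>' \<subseteq> \<Gamma>" "\<Delta> = map (lift 0) \<Delta>'"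
  proof (induction \<Delta> arbitrary: thesis)
    case (Cons a \<Delta>)
    then obtain \<Delta>' where "set \<Delta>' \<subseteq> \<Gamma>" "\<Delta> = map (lift 0) \<Delta>'" by auto
    moreover obtain b where "b \<in> \<Gamma>" "a = lift 0 b" using Cons by auto
    ultimately show ?case by (intro Cons(2)[of "b # \<Delta>'"]) auto
  qed simp
  from *(2) have "HA \<turnstile> Imp (conjs \<Delta>') (Forall A)" by (simp add: D lift_conjs[symmetric] ha_allI)
  with D show ?thesis unfolding nd_def by blast
qed

lemma nd_allE: "\<Gamma> |- Forall A ==> \<Gamma> |- sub 0 t A"
  by (meson ha_all nd_HA nd_mp)

lemma nd_exI: "\<Gamma> |- sub 0 t A ==> \<Gamma> |- Exists A"
  by (meson ha_ex nd_HA nd_mp)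

lemma nd_exE: assumes "\<Gamma> |- Exists A" "insert A (lift 0 ` \<Gamma>) |- lift 0 B" shows "\<Gamma> |- B"
proof -
  have "lift 0 ` \<Gamma> |- Imp A (lift 0 B)" using assms nd_impI by blast
  then have "\<Gamma> |- Forall (Imp A (lift 0 B))" by (rule nd_allI)
  moreover have "HA \<turnstile> Imp (Forall (Imp A (lift 0 B))) (Imp (Exists A) B)"
  proof -
    have "HA \<turnstile> Imp (Forall (lift (Suc 0) (Imp A (lift 0 B)))) (Imp A (lift 0 B))"
      using ha_all[of "lift (Suc 0) (Imp A (lift 0 B))" "Var 0"] by simp
    then have "HA \<turnstile> Imp A (Imp (lift 0 (Forall (Imp A (lift 0 B)))) (lift 0 B))"
      using HA_flip by simp
    then have "HA \<turnstile> Imp A (lift 0 (Imp (Forall (Imp A (lift 0 B))) B))" by simp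
    then have "HA \<turnstile> Imp (Exists A) (Imp (Forall (Imp A (lift 0 B))) B)" by (rule ha_exE)
    then show ?thesis by (rule HA_flip)
  qed
  ultimately show ?thesis using assms(1) nd_HA nd_mp by blast
qed

lemma nd_refl: "\<Gamma> |- Eq t t"
  by (simp add: ha_eq_refl nd_HA)

lemma nd_subst: "\<Gamma> |- Eq s t ==> \<Gamma> |- sub 0 s A ==> \<Gamma> |- sub 0 t A"
  by (meson ha_eq_subst nd_HA nd_mp)

lemma nd_sym: "\<Gamma> |- Eq s t ==> \<Gamma> |- Eq t s"
  using nd_subst[of \<Gamma> s t "Eq (Var 0) (lift_tm 0 s)"] by (simp add: nd_refl)

lemma nd_trans: "\<Gamma> |- Eq s t ==> \<Gamma> |- Eq t u ==> \<Gamma> |- Eq s u"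
  using nd_subst[of \<Gamma> t u "Eq (lift_tm 0 s) (Var 0)"] by simp

lemma nd_Succ: "\<Gamma> |- Eq s t ==> \<Gamma> |- Eq (Succ s) (Succ t)"
  using nd_subst[of \<Gamma> s t "Eq (lift_tm 0 (Succ s)) (Succ (Var 0))"] by (simp add: nd_refl)

lemma nd_Add: assumes "\<Gamma> |- Eq s t" "\<Gamma> |- Eq s' t'" shows "\<Gamma> |- Eq (Add s s') (Add t t')"
proof (rule nd_trans)
  show "\<Gamma> |- Eq (Add s s') (Add t s')"
    using nd_subst[of \<Gamma> s t "Eq (lift_tm 0 (Add s s')) (Add (Var 0) (lift_tm 0 s'))"] assms by (simp add: nd_refl)
  show "\<Gamma> |- Eq (Add t s') (Add t t')"
    using nd_subst[of \<Gamma> s' t' "Eq (lift_tm 0 (Add t s')) (Add (lift_tm 0 t) (Var 0))"] assms by (simp add: nd_refl)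
qed

lemma nd_Mul: assumes "\<Gamma> |- Eq s t" "\<Gamma> |- Eq s' t'" shows "\<Gamma> |- Eq (Mul s s') (Mul t t')"
proof (rule nd_trans)
  show "\<Gamma> |- Eq (Mul s s') (Mul t s')"
    using nd_subst[of \<Gamma> s t "Eq (lift_tm 0 (Mul s s')) (Mul (Var 0) (lift_tm 0 s'))"] assms by (simp add: nd_refl)
  show "\<Gamma> |- Eq (Mul t s') (Mul t t')"
    using nd_subst[of \<Gamma> s' t' "Eq (lift_tm 0 (Mul t s')) (Mul (lift_tm 0 t) (Var 0))"] assms by (simp add: nd_refl)
qed

lemma nd_ind: assumes "\<Gamma> |- sub 0 Zero A" "insert A (lift 0 ` \<Gamma>) |- sub 0 (Succ (Var 0)) (lift 1 A)"
  shows "\<Gamma> |- sub 0 t A"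
proof -
  have "\<Gamma> |- Forall (Imp A (sub 0 (Succ (Var 0)) (lift 1 A)))" using assms nd_allI nd_impI by blast
  then have "\<Gamma> |- Forall A" using assms(1) ha_ind nd_HA nd_mp by blast
  then show ?thesis by (rule nd_allE)
qed

lemma HA_gen: "HA \<turnstile> A ==> HA \<turnstile> Forall A"
  using nd_allI[of "{}" A] by (simp add: HA_nd nd_HA)


section \<open>Decidability and bounded quantifiers in HA\<close>

lemma nd_0 [simp]: "insert A \<Gamma> |- A"
  by (simp add: nd_assm)

lemma nd_1: "insert B (insert A \<Gamma>) |- A"
  by (simp add: nd_assm)

lemma nd_weak: "\<Gamma> |- A ==> insert B \<Gamma> |- A"
  by (rule nd_mono) auto

lemma nd_lift: assumes "\<Gamma> |- A" shows "lift 0 ` \<Gamma> |- lift 0 A"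
proof -
  obtain \<Delta> where *: "set \<Delta> \<subseteq> \<Gamma>" "HA \<turnstile> Imp (conjs \<Delta>) A" using assms unfolding nd_def by blast
  have "HA \<turnstile> lift 0 (Imp (conjs \<Delta>) A)" unfolding lift_psub by (rule HA_psub[OF *(2)])
  then have "HA \<turnstile> Imp (conjs (map (lift 0) \<Delta>)) (lift 0 A)" by (simp add: lift_conjs)
  with *(1) show ?thesis unfolding nd_def by (intro exI[of _ "map (lift 0) \<Delta>"]) auto
qed

lemma sub_0_lift_1: "sub 0 (lift_tm 0 u) (lift (Suc 0) A) = lift 0 (sub 0 u A)"
  unfolding sub_psub lift_psub psub_comp by (rule psub_eqI) (auto simp: lift_tm_psub)

lemma sub_0_lift_1_Zero: "sub 0 Zero (lift (Suc 0) A) = lift 0 (sub 0 Zero A)"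
  using sub_0_lift_1[of Zero A] by simp

lemma nd_cases: assumes "\<Gamma> |- sub 0 Zero B" "lift 0 ` \<Gamma> |- sub 0 (Succ (Var 0)) (lift 1 B)"
  shows "\<Gamma> |- sub 0 t B"
  by (rule nd_ind) (use assms nd_weak in auto)

lemma nd_add0: "\<Gamma> |- Eq (Add s Zero) s" and nd_addS: "\<Gamma> |- Eq (Add s (Succ t)) (Succ (Add s t))"
  by (simp_all add: nd_HA ha_add0 ha_addS)

lemma nd_nz: "\<Gamma> |- Eq (Succ t) Zero ==> \<Gamma> |- A"
  by (meson ha_succ_nz nd_HA nd_mp nd_botE)

lemma nd_nz': "\<Gamma> |- Eq Zero (Succ t) ==> \<Gamma> |- A"
  by (meson nd_nz nd_sym)

lemma nd_inj: "\<Gamma> |- Eq (Succ s) (Succ t) ==> \<Gamma> |- Eq s t"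
  by (meson ha_succ_inj nd_HA nd_mp)

text \<open>Induction on the first term, with the second one universally quantified and split into
  zero and successor. Decidable atoms are the base of the stability of negative formulas.\<close>

lemma eq_dec: "\<Gamma> |- Disj (Eq s t) (Neg (Eq s t))"
proof -
  let ?D = "\<lambda>s t. Disj (Eq s t) (Neg (Eq s t))"
  have "\<Gamma> |- sub 0 s (Forall (?D X1 X0))"
  proof (rule nd_ind)
    have "lift 0 ` \<Gamma> |- sub 0 X0 (?D Zero X0)"
    proof (rule nd_cases)
      show "lift 0 ` \<Gamma> |- sub 0 Zero (?D Zero X0)" by (simp add: nd_disj1 nd_refl)
      show "lift 0 ` lift 0 ` \<Gamma> |- sub 0 (Succ X0) (lift 1 (?D Zero X0))"
        by simp (rule nd_disj2, rule nd_impI, rule nd_nz', rule nd_0)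
    qed
    then show "\<Gamma> |- sub 0 Zero (Forall (?D X1 X0))" by (simp add: nd_allI)
    let ?G = "insert (Forall (?D X2 X0)) (lift 0 ` lift 0 ` \<Gamma>)"
    let ?G' = "insert (Forall (?D X3 X0)) (lift 0 ` lift 0 ` lift 0 ` \<Gamma>)"
    have "?G |- sub 0 X0 (?D (Succ X2) X0)"
    proof (rule nd_cases)
      show "?G |- sub 0 Zero (?D (Succ X2) X0)"
        by simp (rule nd_disj2, rule nd_impI, rule nd_nz, rule nd_0)
      have "?G' |- ?D X2 X0"
        using nd_allE[OF nd_0, of "?D X3 X0" _ "X0"] by simp
      then have "?G' |- ?D (Succ X2) (Succ X0)"
        by (rule nd_disjE)
          (rule nd_disj1, rule nd_Succ, rule nd_0, rule nd_disj2, rule nd_impI, rule nd_mp[OF nd_1], rule nd_inj, rule nd_0)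
      then show "lift 0 ` ?G |- sub 0 (Succ X0) (lift 1 (?D (Succ X2) X0))"
        by (simp add: numeral_2_eq_2 numeral_3_eq_3)
    qed
    then show "insert (Forall (?D X1 X0)) (lift 0 ` \<Gamma>) |- sub 0 (Succ X0) (lift 1 (Forall (?D X1 X0)))"
      by (simp add: numeral_2_eq_2) (rule nd_allI, simp)
  qed
  then have "\<Gamma> |- Forall (?D (lift_tm 0 s) X0)" by simp
  from nd_allE[OF this, of t] show ?thesis by simp
qed

lemma le_fm_eq: "le_fm s t = Exists (Eq (Add (lift_tm 0 s) X0) (lift_tm 0 t))"
  by (simp add: le_fm_def lifts_def)

lemma lift_le_fm [simp]: "lift c (le_fm s t) = le_fm (lift_tm c s) (lift_tm c t)"
  by (simp add: le_fm_eq lift_lift_tm)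

lemma sub_le_fm [simp]: "sub c u (le_fm s t) = le_fm (sub_tm c u s) (sub_tm c u t)"
  by (simp add: le_fm_eq sub_tm_Suc_lift_tm)

lemma psub_le_fm [simp]: "psub \<sigma> (le_fm s t) = le_fm (psub_tm \<sigma> s) (psub_tm \<sigma> t)"
  by (simp add: le_fm_eq psub_tm_up_lift)

lemma vars_below_tm_lift_0 [simp]: "vars_below_tm (Suc n) (lift_tm 0 t) = vars_below_tm n t"
  by (induction t) auto

lemma vars_below_le_fm [simp]: "vars_below n (le_fm s t) \<longleftrightarrow> vars_below_tm n s \<and> vars_below_tm n t"
  by (simp add: le_fm_eq)

lemma nd_leI: "\<Gamma> |- Eq (Add s z) t ==> \<Gamma> |- le_fm s t"
  unfolding le_fm_eq by (rule nd_exI[of _ z]) simp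

lemma nd_leE: "\<Gamma> |- le_fm s t ==>
    insert (Eq (Add (lift_tm 0 s) X0) (lift_tm 0 t)) (lift 0 ` \<Gamma>) |- lift 0 B ==> \<Gamma> |- B"
  unfolding le_fm_eq by (rule nd_exE)

lemma nd_le_refl: "\<Gamma> |- le_fm t t"
  by (rule nd_leI[OF nd_add0])

lemma nd_le_SuccI: assumes "\<Gamma> |- le_fm s t" shows "\<Gamma> |- le_fm s (Succ t)"
  by (rule nd_leE[OF assms]) (simp, rule nd_leI, rule nd_trans[OF nd_addS nd_Succ[OF nd_0]])

lemma nd_le_0: assumes "\<Gamma> |- le_fm s Zero" shows "\<Gamma> |- Eq s Zero"
proof (rule nd_leE[OF assms])
  let ?B = "Imp (Eq (Add (lift_tm 0 (lift_tm 0 s)) X0) Zero) (Eq (lift_tm 0 (lift_tm 0 s)) Zero)"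
  have "\<Delta> |- sub 0 X0 ?B" for \<Delta>
  proof (rule nd_cases)
    show "\<Delta> |- sub 0 Zero ?B"
      by simp (rule nd_impI, rule nd_trans[OF nd_sym[OF nd_add0] nd_0])
    show "lift 0 ` \<Delta> |- sub 0 (Succ X0) (lift 1 ?B)"
      by (simp add: lift_lift_tm) (rule nd_impI, rule nd_nz[OF nd_trans[OF nd_sym[OF nd_addS] nd_0]])
  qed
  then have "\<Delta> |- Imp (Eq (Add (lift_tm 0 s) X0) Zero) (Eq (lift_tm 0 s) Zero)" for \<Delta> by simp
  then show "insert (Eq (Add (lift_tm 0 s) X0) (lift_tm 0 Zero)) (lift 0 ` \<Gamma>) |- lift 0 (Eq s Zero)"
    using nd_mp[OF _ nd_0] by simp
qed

text \<open>Case distinction on the witness of the inequality: zero gives equality, and from a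
  successor one \<open>Succ\<close> can be cancelled.\<close>

lemma nd_le_Succ: assumes "\<Gamma> |- le_fm s (Succ t)" shows "\<Gamma> |- Disj (le_fm s t) (Eq s (Succ t))"
proof (rule nd_leE[OF assms])
  let ?s = "lift_tm 0 (lift_tm 0 s)" and ?t = "lift_tm 0 (lift_tm 0 t)"
  let ?B = "Imp (Eq (Add ?s X0) (Succ ?t)) (Disj (le_fm ?s ?t) (Eq ?s (Succ ?t)))"
  have "\<Delta> |- sub 0 X0 ?B" for \<Delta>
  proof (rule nd_cases)
    show "\<Delta> |- sub 0 Zero ?B"
      by simp (rule nd_impI, rule nd_disj2, rule nd_trans[OF nd_sym[OF nd_add0] nd_0])
    show "lift 0 ` \<Delta> |- sub 0 (Succ X0) (lift 1 ?B)"
      by (simp add: lift_lift_tm) (rule nd_impI, rule nd_disj1, rule nd_leI, rule nd_inj[OF nd_trans[OF nd_sym[OF nd_addS] nd_0]])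
  qed
  then have "\<Delta> |- Imp (Eq (Add (lift_tm 0 s) X0) (Succ (lift_tm 0 t)))
      (Disj (le_fm (lift_tm 0 s) (lift_tm 0 t)) (Eq (lift_tm 0 s) (Succ (lift_tm 0 t))))" for \<Delta> by simp
  then show "insert (Eq (Add (lift_tm 0 s) X0) (lift_tm 0 (Succ t))) (lift 0 ` \<Gamma>)
      |- lift 0 (Disj (le_fm s t) (Eq s (Succ t)))"
    using nd_mp[OF _ nd_0] by simp
qed

lemma nd_neg_mono: "\<Gamma> |- Neg B ==> insert A \<Gamma> |- B ==> \<Gamma> |- Neg A"
  by (rule nd_impI) (meson nd_mp nd_weak)

lemma nd_le_subst: "\<Gamma> |- Eq s t ==> \<Gamma> |- le_fm t t ==> \<Gamma> |- le_fm s t"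
  using nd_subst[of \<Gamma> t s "le_fm X0 (lift_tm 0 t)"] nd_sym by simp

lemma le_dec: "\<Gamma> |- Disj (le_fm s t) (Neg (le_fm s t))"
proof -
  let ?D = "\<lambda>s t. Disj (le_fm s t) (Neg (le_fm s t))"
  have "\<Gamma> |- sub 0 t (?D (lift_tm 0 s) X0)"
  proof (rule nd_ind)
    have "\<Gamma> |- ?D s Zero"
    proof (rule nd_disjE[OF eq_dec[of _ s Zero]])
      show "insert (Eq s Zero) \<Gamma> |- ?D s Zero"
        by (rule nd_disj1, rule nd_le_subst[OF nd_0 nd_le_refl])
      show "insert (Neg (Eq s Zero)) \<Gamma> |- ?D s Zero"
        by (rule nd_disj2, rule nd_neg_mono[OF nd_0 nd_le_0], rule nd_0)
    qed
    then show "\<Gamma> |- sub 0 Zero (?D (lift_tm 0 s) X0)" by simp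
    let ?s = "lift_tm 0 s"
    have "insert (?D ?s X0) (lift 0 ` \<Gamma>) |- ?D ?s (Succ X0)" (is "?G |- _")
    proof (rule nd_disjE[OF nd_0])
      show "insert (le_fm ?s X0) ?G |- ?D ?s (Succ X0)"
        by (rule nd_disj1, rule nd_le_SuccI, rule nd_0)
      show "insert (Neg (le_fm ?s X0)) ?G |- ?D ?s (Succ X0)" (is "?G' |- _")
      proof (rule nd_disjE[OF eq_dec[of _ ?s "Succ X0"]])
        show "insert (Eq ?s (Succ X0)) ?G' |- ?D ?s (Succ X0)"
          by (rule nd_disj1, rule nd_le_subst[OF nd_0 nd_le_refl])
        show "insert (Neg (Eq ?s (Succ X0))) ?G' |- ?D ?s (Succ X0)"
        proof (rule nd_disj2, rule nd_impI, rule nd_disjE[OF nd_le_Succ[OF nd_0]])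
          show "insert (le_fm ?s X0) (insert (le_fm ?s (Succ X0)) (insert (Neg (Eq ?s (Succ X0))) ?G')) |- Bot"
            by (rule nd_mp[of _ "le_fm ?s X0"]) (simp_all add: nd_assm)
          show "insert (Eq ?s (Succ X0)) (insert (le_fm ?s (Succ X0)) (insert (Neg (Eq ?s (Succ X0))) ?G')) |- Bot"
            by (rule nd_mp[of _ "Eq ?s (Succ X0)"]) (simp_all add: nd_assm)
        qed
      qed
    qed
    then show "insert (?D ?s X0) (lift 0 ` \<Gamma>) |- sub 0 (Succ X0) (lift 1 (?D ?s X0))"
      by (simp add: lift_lift_tm)
  qed
  then show ?thesis by simp
qed

lemma nd_dec_stable: assumes "\<Gamma> |- Disj A (Neg A)" "\<Gamma> |- Neg (Neg A)" shows "\<Gamma> |- A"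
  by (rule nd_disjE[OF assms(1)], rule nd_0, rule nd_botE, rule nd_mp[OF nd_weak[OF assms(2)] nd_0])

lemma nd_allE_lift: "\<Gamma> |- Forall A ==> lift 0 ` \<Gamma> |- A"
  using nd_allE[of "lift 0 ` \<Gamma>" "lift (Suc 0) A" X0] nd_lift[of \<Gamma> "Forall A"] by simp

lemma nd_ball_0: assumes "\<Gamma> |- sub 0 Zero A" shows "\<Gamma> |- Forall (Imp (le_fm X0 Zero) A)"
proof (rule nd_allI, rule nd_impI)
  let ?G = "insert (le_fm X0 Zero) (lift 0 ` \<Gamma>)"
  have "?G |- Eq Zero X0" by (rule nd_sym, rule nd_le_0, rule nd_0)
  moreover have "?G |- sub 0 Zero (lift (Suc 0) A)"
    using nd_weak[OF nd_lift[OF assms]] by (simp add: sub_0_lift_1_Zero)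
  ultimately show "?G |- A" using nd_subst by fastforce
qed

lemma nd_ball_Succ: assumes "\<Gamma> |- Forall (Imp (le_fm X0 (lift_tm 0 t)) A)" "\<Gamma> |- sub 0 (Succ t) A"
  shows "\<Gamma> |- Forall (Imp (le_fm X0 (Succ (lift_tm 0 t))) A)"
proof (rule nd_allI, rule nd_impI, rule nd_disjE[OF nd_le_Succ[OF nd_0]])
  let ?G = "insert (le_fm X0 (Succ (lift_tm 0 t))) (lift 0 ` \<Gamma>)"
  show "insert (le_fm X0 (lift_tm 0 t)) ?G |- A"
    by (rule nd_mp[OF nd_weak[OF nd_weak[OF nd_allE_lift[OF assms(1)]]]]) simp
  let ?G' = "insert (Eq X0 (Succ (lift_tm 0 t))) ?G"
  have "?G' |- Eq (Succ (lift_tm 0 t)) X0" by (rule nd_sym[OF nd_0])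
  moreover have "?G' |- sub 0 (Succ (lift_tm 0 t)) (lift (Suc 0) A)"
    using nd_weak[OF nd_weak[OF nd_lift[OF assms(2)]]] sub_0_lift_1[of "Succ t" A] by simp
  ultimately show "?G' |- A" using nd_subst by fastforce
qed

text \<open>The bind of the double negation monad: towards a doubly negated goal, a doubly negated
  fact may be used as if it were proved.\<close>

lemma nd_nn_bind: assumes "\<Gamma> |- Neg (Neg A)" "insert A \<Gamma> |- Neg (Neg B)" shows "\<Gamma> |- Neg (Neg B)"
proof (rule nd_impI)
  have "insert (Neg B) \<Gamma> |- Neg A"
  proof (rule nd_impI)
    have "insert A (insert (Neg B) \<Gamma>) |- Neg (Neg B)" by (rule nd_mono[OF assms(2)]) auto
    then show "insert A (insert (Neg B) \<Gamma>) |- Bot" by (rule nd_mp) (rule nd_1)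
  qed
  with nd_weak[OF assms(1)] show "insert (Neg B) \<Gamma> |- Bot" by (rule nd_mp)
qed

lemma nd_nnI: "\<Gamma> |- A ==> \<Gamma> |- Neg (Neg A)"
  by (rule nd_impI, rule nd_mp[OF nd_0]) (rule nd_weak)

lemma nd_nn_mono: "\<Gamma> |- Neg (Neg A) ==> insert A \<Gamma> |- B ==> \<Gamma> |- Neg (Neg B)"
  by (rule nd_nn_bind) (auto intro: nd_nnI)

text \<open>Double negation shift, which HA proves for bounded quantifiers: induction on the bound
  combines the double negations one at a time with \<open>nd_nn_bind\<close>.\<close>

lemma nd_ball_nn:
  assumes "\<Gamma> |- Forall (Imp (le_fm X0 (lift_tm 0 t)) (Neg (Neg A)))"
  shows "\<Gamma> |- Neg (Neg (Forall (Imp (le_fm X0 (lift_tm 0 t)) A)))"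
proof -
  \<comment> \<open>The bound becomes the induction variable, at index 1 below the quantifier;
    \<open>A\<close> is lifted there to make room for it.\<close>
  let ?A = "lift (Suc 0) A"
  let ?L = "\<lambda>t. Forall (Imp (le_fm X0 (lift_tm 0 t)) (Neg (Neg ?A)))"
  let ?R = "\<lambda>t. Forall (Imp (le_fm X0 (lift_tm 0 t)) ?A)"
  let ?F = "Imp (?L X0) (Neg (Neg (?R X0)))"
  have "\<Gamma> |- sub 0 t ?F"
  proof (rule nd_ind)
    let ?G = "insert (Forall (Imp (le_fm X0 Zero) (Neg (Neg A)))) \<Gamma>"
    have "?G |- Imp (le_fm Zero Zero) (Neg (Neg (sub 0 Zero A)))"
      using nd_allE[OF nd_0[of "Forall (Imp (le_fm X0 Zero) (Neg (Neg A)))" \<Gamma>], of Zero] by simp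
    then have "?G |- Neg (Neg (sub 0 Zero A))" using nd_le_refl nd_mp by blast
    then have "?G |- Neg (Neg (Forall (Imp (le_fm X0 Zero) A)))"
      by (rule nd_nn_mono) (rule nd_ball_0, rule nd_0)
    then have "\<Gamma> |- Imp (Forall (Imp (le_fm X0 Zero) (Neg (Neg A)))) (Neg (Neg (Forall (Imp (le_fm X0 Zero) A))))"
      by (rule nd_impI)
    moreover have "sub (Suc 0) Zero (lift (Suc 0) A) = A" by simp
    ultimately show "\<Gamma> |- sub 0 Zero ?F" by simp
    let ?H = "insert (?L (Succ X0)) (insert ?F (lift 0 ` \<Gamma>))"
    have 1: "?H |- Neg (Neg (?R X0))"
    proof (rule nd_mp[OF nd_1], rule nd_allI, rule nd_impI)
      let ?H' = "insert (le_fm X0 X1) (lift 0 ` ?H)"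
      have "?H |- Forall (Imp (le_fm X0 (Succ X1)) (Neg (Neg ?A)))" by simp
      from nd_weak[OF nd_allE_lift[OF this]]
      have "?H' |- Imp (le_fm X0 (Succ X1)) (Neg (Neg ?A))" by simp
      moreover have "?H' |- le_fm X0 (Succ X1)" by (rule nd_le_SuccI, rule nd_0)
      ultimately have "?H' |- Neg (Neg ?A)" by (rule nd_mp)
      then show "insert (le_fm X0 (lift_tm 0 X0)) (lift 0 ` ?H) |- Neg (Neg ?A)" by simp
    qed
    have "?H |- sub 0 (Succ X0) (Imp (le_fm X0 (Succ X1)) (Neg (Neg ?A)))"
      by (rule nd_allE) (simp add: nd_assm)
    then have 2: "?H |- Neg (Neg (sub 0 (Succ X0) ?A))" using nd_mp[OF _ nd_le_refl] by simp
    have "?H |- Neg (Neg (?R (Succ X0)))"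
    proof (rule nd_nn_bind[OF 1], rule nd_nn_mono)
      show "insert (?R X0) ?H |- Neg (Neg (sub 0 (Succ X0) ?A))" by (rule nd_weak[OF 2])
      show "insert (sub 0 (Succ X0) ?A) (insert (?R X0) ?H) |- ?R (Succ X0)"
        using nd_ball_Succ[of _ X0 ?A, OF nd_1 nd_0] by simp
    qed
    then have "insert ?F (lift 0 ` \<Gamma>) |- Imp (?L (Succ X0)) (Neg (Neg (?R (Succ X0))))" by (rule nd_impI)
    moreover have "sub (Suc 0) (Succ X1) (lift (Suc (Suc 0)) (lift (Suc 0) A)) = lift (Suc 0) A"
      unfolding sub_psub lift_psub psub_comp by (rule psub_eqI) auto
    ultimately show "insert ?F (lift 0 ` \<Gamma>) |- sub 0 (Succ X0) (lift 1 ?F)" by simp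
  qed
  moreover have "sub (Suc 0) (lift_tm 0 t) (lift (Suc 0) A) = A" by simp
  ultimately have "\<Gamma> |- Imp (Forall (Imp (le_fm X0 (lift_tm 0 t)) (Neg (Neg A)))) (Neg (Neg (Forall (Imp (le_fm X0 (lift_tm 0 t)) A))))"
    by simp
  then show ?thesis using assms nd_mp by blast
qed


section \<open>The negative fragment\<close>

primrec neg :: "fm => bool" where
  "neg (Eq s t) = True"
| "neg Bot = True"
| "neg (Conj A B) = (neg A \<and> neg B)"
| "neg (Disj A B) = False"
| "neg (Imp A B) = (neg A \<and> neg B)"
| "neg (Forall A) = neg A"
| "neg (Exists A) = False"

text \<open>The Goedel-Gentzen translation; atoms need no double negation because equality is
  decidable.\<close>

primrec N :: "fm => fm" where
  "N (Eq s t) = Eq s t"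
| "N Bot = Bot"
| "N (Conj A B) = Conj (N A) (N B)"
| "N (Disj A B) = Neg (Conj (Neg (N A)) (Neg (N B)))"
| "N (Imp A B) = Imp (N A) (N B)"
| "N (Forall A) = Forall (N A)"
| "N (Exists A) = Neg (Forall (Neg (N A)))"

lemma neg_N [simp]: "neg (N A)"
  by (induction A) auto

lemma N_neg: "neg A ==> N A = A"
  by (induction A) auto

lemma neg_psub [simp]: "neg (psub \<sigma> A) = neg A"
  by (induction A arbitrary: \<sigma>) auto

lemma vars_below_N [simp]: "vars_below n (N A) = vars_below n A"
  by (induction A arbitrary: n) auto

text \<open>Atoms are stable by \<open>eq_dec\<close>, and each negative connective preserves
  stability. This lets the intuitionistic calculus act classically in the Henkin
  construction.\<close>

lemma nd_stable: "neg A ==> \<Gamma> |- Neg (Neg A) ==> \<Gamma> |- A"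
proof (induction A arbitrary: \<Gamma>)
  case (Eq s t) then show ?case using nd_dec_stable eq_dec by blast
next
  case Bot
  then show ?case by (rule_tac nd_mp[of _ "Neg Bot"]) (auto intro: nd_impI)
next
  case (Conj A B)
  have "\<Gamma> |- Neg (Neg A)" by (rule nd_nn_mono[OF Conj.prems(2)]) (rule nd_conj1[OF nd_0])
  moreover have "\<Gamma> |- Neg (Neg B)" by (rule nd_nn_mono[OF Conj.prems(2)]) (rule nd_conj2[OF nd_0])
  ultimately show ?case using Conj nd_conjI by simp
next
  case (Imp A B)
  have "insert A \<Gamma> |- Neg (Neg B)"
    by (rule nd_nn_mono[OF nd_weak[OF Imp.prems(2)]]) (rule nd_mp[OF nd_0 nd_1])
  then show ?case using Imp nd_impI by simp
next
  case (Forall A)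
  have "lift 0 ` \<Gamma> |- Neg (Neg (lift 0 (Forall A)))" using nd_lift[OF Forall.prems(2)] by simp
  moreover have "insert (lift 0 (Forall A)) (lift 0 ` \<Gamma>) |- A"
    using nd_allE[of "insert (lift 0 (Forall A)) (lift 0 ` \<Gamma>)" "lift (Suc 0) A" X0] by simp
  ultimately have "lift 0 ` \<Gamma> |- Neg (Neg A)" by (rule nd_nn_mono)
  then show ?case using Forall nd_allI by simp
qed simp_all

text \<open>Negation is absent, and implication serves only to guard a bounded quantifier. The bound
  is a variable, written \<open>Var (Suc j)\<close> to keep it apart from the quantified
  \<open>X0\<close>; \<open>prv_ball\<close> will do induction on its value.\<close>

inductive sigma :: "fm => bool" where
  sg_eq: "sigma (Eq s t)"
| sg_bot: "sigma Bot"
| sg_conj: "sigma A ==> sigma B ==> sigma (Conj A B)"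
| sg_disj: "sigma A ==> sigma B ==> sigma (Disj A B)"
| sg_ex: "sigma A ==> sigma (Exists A)"
| sg_ball: "sigma A ==> sigma (Forall (Imp (le_fm X0 (Var (Suc j))) A))"

lemma sigma_le [simp]: "sigma (le_fm s t)"
  unfolding le_fm_eq by (intro sigma.intros)

lemma nd_all_mono: "\<Gamma> |- Forall A ==> insert A (lift 0 ` \<Gamma>) |- B ==> \<Gamma> |- Forall B"
  by (rule nd_allI) (meson nd_allE_lift nd_cut)

text \<open>The translation doubly negates the existential quantifier in \<open>le_fm\<close>, and
  \<open>le_dec\<close> removes this again. Hence \<open>N\<close> does not change the range of a
  bounded quantifier.\<close>

lemma nd_le_N: "\<Gamma> |- N (le_fm s t) ==> \<Gamma> |- le_fm s t" and nd_N_le: "\<Gamma> |- le_fm s t ==> \<Gamma> |- N (le_fm s t)"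
proof -
  let ?E = "Eq (Add (lift_tm 0 s) X0) (lift_tm 0 t)"
  have N: "N (le_fm s t) = Neg (Forall (Neg ?E))" by (simp add: le_fm_eq)
  show "\<Gamma> |- le_fm s t" if "\<Gamma> |- N (le_fm s t)"
  proof (rule nd_dec_stable[OF le_dec], rule nd_neg_mono[OF that[unfolded N]], rule nd_allI, rule nd_impI, simp)
    show "insert ?E (insert (Neg (le_fm (lift_tm 0 s) (lift_tm 0 t))) (lift 0 ` \<Gamma>)) |- Bot"
      by (rule nd_mp[OF nd_1]) (rule nd_leI[OF nd_0])
  qed
  show "\<Gamma> |- N (le_fm s t)" if "\<Gamma> |- le_fm s t"
    unfolding N
  proof (rule nd_impI, rule nd_leE[OF nd_weak[OF that]], simp)
    let ?G = "insert ?E (insert (Forall (Neg (lift (Suc 0) ?E))) (lift 0 ` \<Gamma>))"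
    have "?G |- sub 0 X0 (Neg (lift (Suc 0) ?E))" by (rule nd_allE[OF nd_1])
    then have "?G |- Neg ?E" using sub_Var_lift_1[of "Neg ?E"] by simp
    then have "?G |- Bot" by (rule nd_mp) (rule nd_0)
    then show "insert ?E (insert (Forall (Neg (Eq (Add (lift_tm (Suc 0) (lift_tm 0 s)) X0) (lift_tm (Suc 0) (lift_tm 0 t)))))
        (lift 0 ` \<Gamma>)) |- Bot" by simp
  qed
qed

text \<open>\<open>N A\<close> lies between \<open>A\<close> and its double negation. Below a
  negation the three coincide, which is all that \<open>DiaHA\<close> requires. The bounded
  quantifier is the case that rests on \<open>nd_ball_nn\<close>.\<close>

lemma sigma_N: "sigma A ==> (\<forall>\<Gamma>. \<Gamma> |- A \<longrightarrow> \<Gamma> |- N A) \<and> (\<forall>\<Gamma>. \<Gamma> |- N A \<longrightarrow> \<Gamma> |- Neg (Neg A))"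
proof (induction rule: sigma.induct)
  case (sg_conj A B)
  show ?case
  proof (intro conjI allI impI)
    fix \<Gamma> assume "\<Gamma> |- Conj A B"
    then have "\<Gamma> |- N A" "\<Gamma> |- N B" using sg_conj nd_conj1 nd_conj2 by blast+
    then show "\<Gamma> |- N (Conj A B)" by (simp add: nd_conjI)
  next
    fix \<Gamma> assume "\<Gamma> |- N (Conj A B)"
    then have "\<Gamma> |- Conj (N A) (N B)" by simp
    then have AB: "\<Gamma> |- Neg (Neg A)" "\<Gamma> |- Neg (Neg B)" using sg_conj nd_conj1 nd_conj2 by blast+
    show "\<Gamma> |- Neg (Neg (Conj A B))"
      by (rule nd_nn_bind[OF AB(1)], rule nd_nn_mono[OF nd_weak[OF AB(2)]]) (rule nd_conjI[OF nd_1 nd_0])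
  qed
next
  case (sg_disj A B)
  show ?case
  proof (intro conjI allI impI)
    fix \<Gamma> assume *: "\<Gamma> |- Disj A B"
    let ?C = "Conj (Neg (N A)) (Neg (N B))"
    have "insert ?C \<Gamma> |- Bot"
    proof (rule nd_disjE[OF nd_weak[OF *]])
      show "insert A (insert ?C \<Gamma>) |- Bot" by (rule nd_mp[OF nd_conj1[OF nd_1]]) (use sg_disj in simp)
      show "insert B (insert ?C \<Gamma>) |- Bot" by (rule nd_mp[OF nd_conj2[OF nd_1]]) (use sg_disj in simp)
    qed
    then show "\<Gamma> |- N (Disj A B)" by (simp add: nd_impI)
  next
    fix \<Gamma> assume *: "\<Gamma> |- N (Disj A B)"
    then have *: "\<Gamma> |- Neg (Conj (Neg (N A)) (Neg (N B)))" by simp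
    show "\<Gamma> |- Neg (Neg (Disj A B))"
    proof (rule nd_neg_mono[OF *], rule nd_conjI; rule nd_impI)
      let ?D = "Neg (Disj A B)"
      have "insert (N A) (insert ?D \<Gamma>) |- Neg (Neg A)" using sg_disj by simp
      then show "insert (N A) (insert ?D \<Gamma>) |- Bot"
        by (rule nd_mp) (rule nd_neg_mono[OF nd_1], rule nd_disj1, rule nd_0)
      have "insert (N B) (insert ?D \<Gamma>) |- Neg (Neg B)" using sg_disj by simp
      then show "insert (N B) (insert ?D \<Gamma>) |- Bot"
        by (rule nd_mp) (rule nd_neg_mono[OF nd_1], rule nd_disj2, rule nd_0)
    qed
  qed
next
  case (sg_ex A)
  show ?case
  proof (intro conjI allI impI)
    fix \<Gamma> assume *: "\<Gamma> |- Exists A"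
    have "insert (Forall (Neg (N A))) \<Gamma> |- Bot"
    proof (rule nd_exE[OF nd_weak[OF *]])
      let ?G = "insert A (lift 0 ` insert (Forall (Neg (N A))) \<Gamma>)"
      have "?G |- sub 0 X0 (Neg (lift (Suc 0) (N A)))" by (rule nd_allE) (simp add: nd_1)
      then have "?G |- Neg (N A)" by simp
      then have "?G |- Bot" by (rule nd_mp) (use sg_ex in simp)
      then show "?G |- lift 0 Bot" by simp
    qed
    then show "\<Gamma> |- N (Exists A)" by (simp add: nd_impI)
  next
    fix \<Gamma> assume "\<Gamma> |- N (Exists A)"
    then have *: "\<Gamma> |- Neg (Forall (Neg (N A)))" by simp
    show "\<Gamma> |- Neg (Neg (Exists A))"
    proof (rule nd_neg_mono[OF *], rule nd_allI, rule nd_impI)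
      let ?G = "insert (N A) (lift 0 ` insert (Neg (Exists A)) \<Gamma>)"
      have "?G |- Neg (Neg A)" using sg_ex by simp
      moreover have "?G |- Neg A"
      proof (rule nd_neg_mono)
        show "?G |- Neg (Exists (lift (Suc 0) A))" by (simp add: nd_1)
        show "insert A ?G |- Exists (lift (Suc 0) A)" by (rule nd_exI[of _ X0]) simp
      qed
      ultimately show "?G |- Bot" by (rule nd_mp)
    qed
  qed
next
  case (sg_ball A j)
  show ?case
  proof (intro conjI allI impI)
    fix \<Gamma> assume *: "\<Gamma> |- Forall (Imp (le_fm X0 (Var (Suc j))) A)"
    show "\<Gamma> |- N (Forall (Imp (le_fm X0 (Var (Suc j))) A))"
      unfolding N.simps
    proof (rule nd_all_mono[OF *], rule nd_impI)
      show "insert (N (le_fm X0 (Var (Suc j)))) (insert (Imp (le_fm X0 (Var (Suc j))) A) (lift 0 ` \<Gamma>)) |- N A"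
        using sg_ball nd_mp[OF nd_1 nd_le_N[OF nd_0]] by blast
    qed
  next
    fix \<Gamma> assume "\<Gamma> |- N (Forall (Imp (le_fm X0 (Var (Suc j))) A))"
    then have *: "\<Gamma> |- Forall (Imp (N (le_fm X0 (Var (Suc j)))) (N A))" by simp
    have "\<Gamma> |- Forall (Imp (le_fm X0 (lift_tm 0 (Var j))) (Neg (Neg A)))"
    proof (rule nd_all_mono[OF *], rule nd_impI)
      show "insert (le_fm X0 (lift_tm 0 (Var j))) (insert (Imp (N (le_fm X0 (Var (Suc j)))) (N A)) (lift 0 ` \<Gamma>)) |- Neg (Neg A)"
        using sg_ball nd_mp[OF nd_1 nd_N_le[OF nd_0]] by simp
    qed
    from nd_ball_nn[OF this] show "\<Gamma> |- Neg (Neg (Forall (Imp (le_fm X0 (Var (Suc j))) A)))" by simp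
  qed
qed (auto intro: nd_nnI)


section \<open>Classical models\<close>

definition push :: "'a => (nat => 'a) => nat => 'a"  (infixr "##" 65) where
  "x ## e = case_nat x e"

lemma push_0 [simp]: "(x ## e) 0 = x" and push_Suc [simp]: "(x ## e) (Suc i) = e i"
  and push_1 [simp]: "(x ## e) 1 = e 0" and push_numeral [simp]: "(x ## e) (numeral k) = e (pred_numeral k)"
  by (simp_all add: push_def numeral_eq_Suc)

locale arith =
  fixes zero :: 'a and suc :: "'a => 'a" and add :: "'a => 'a => 'a" (infixl "\<oplus>" 65)
    and mul :: "'a => 'a => 'a" (infixl "\<otimes>" 70)
begin

primrec evt :: "(nat => 'a) => tm => 'a" where
  "evt e (Var i) = e i"
| "evt e Zero = zero"
| "evt e (Succ t) = suc (evt e t)"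
| "evt e (Add s t) = evt e s \<oplus> evt e t"
| "evt e (Mul s t) = evt e s \<otimes> evt e t"

primrec eval :: "(nat => 'a) => fm => bool" where
  "eval e (Eq s t) \<longleftrightarrow> evt e s = evt e t"
| "eval e Bot \<longleftrightarrow> False"
| "eval e (Conj A B) \<longleftrightarrow> eval e A \<and> eval e B"
| "eval e (Disj A B) \<longleftrightarrow> eval e A \<or> eval e B"
| "eval e (Imp A B) \<longleftrightarrow> (eval e A \<longrightarrow> eval e B)"
| "eval e (Forall A) \<longleftrightarrow> (\<forall>x. eval (x ## e) A)"
| "eval e (Exists A) \<longleftrightarrow> (\<exists>x. eval (x ## e) A)"

lemma evt_lift_tm [simp]: "evt (x ## e) (lift_tm 0 t) = evt e t"
  by (induction t) auto

lemma evt_psub_tm: "evt e (psub_tm \<sigma> t) = evt (\<lambda>i. evt e (\<sigma> i)) t"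
  by (induction t) auto

lemma push_up: "(\<lambda>i. evt (x ## e) (up \<sigma> i)) = x ## (\<lambda>i. evt e (\<sigma> i))"
  by (rule ext) (auto simp: push_def up_def evt_lift_tm[unfolded push_def] split: nat.split)

lemma eval_psub: "eval e (psub \<sigma> A) \<longleftrightarrow> eval (\<lambda>i. evt e (\<sigma> i)) A"
  by (induction A arbitrary: e \<sigma>) (simp_all add: evt_psub_tm push_up)

lemma eval_cong: "(!!i. e i = e' i) ==> eval e A = eval e' A"
  by (rule arg_cong[of e e' "\<lambda>e. eval e A"]) (rule ext)

lemma eval_sub [simp]: "eval e (sub 0 t A) \<longleftrightarrow> eval (evt e t ## e) A"
  unfolding sub_psub eval_psub
  by (rule eval_cong) (auto simp: push_def split: nat.split)

lemma eval_lift [simp]: "eval (x ## e) (lift 0 A) \<longleftrightarrow> eval e A"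
  unfolding lift_psub eval_psub by (rule eval_cong) auto

lemma eval_lift_1 [simp]: "eval (x ## y ## e) (lift (Suc 0) A) \<longleftrightarrow> eval (x ## e) A"
  unfolding lift_psub eval_psub by (rule eval_cong) (auto simp: push_def split: nat.split)

lemma eval_N [simp]: "eval e (N A) \<longleftrightarrow> eval e A"
  by (induction A arbitrary: e) auto

lemma evt_below: "vars_below_tm n t ==> (!!i. i < n ==> e i = e' i) ==> evt e t = evt e' t"
  by (induction t) auto

lemma eval_below: assumes "vars_below n A" "!!i. i < n ==> e i = e' i" shows "eval e A = eval e' A"
proof -
  let ?\<sigma> = "\<lambda>i. if i < n then Var i else Zero"
  have "psub ?\<sigma> A = A" using psub_below[OF assms(1), of ?\<sigma> Var] by simp
  then have *: "eval c A = eval (\<lambda>i. evt c (?\<sigma> i)) A" for c by (metis eval_psub)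
  have "(\<lambda>i. evt e (?\<sigma> i)) = (\<lambda>i. evt e' (?\<sigma> i))" using assms(2) by auto
  then show ?thesis unfolding *[of e] *[of e'] by (rule arg_cong)
qed

lemma eval_sentence: "sentence A ==> eval e A = eval e' A"
  unfolding sentence_def by (rule eval_below[of 0]) auto

lemma eval_conjs: "eval e (conjs As) \<longleftrightarrow> (\<forall>A\<in>set As. eval e A)"
  by (induction As) auto

lemma eval_disjs: "eval e (disjs As) \<longleftrightarrow> (\<exists>A\<in>set As. eval e A)"
  by (induction As) auto

end

text \<open>Induction is demanded only for formulas with parameters, so nonstandard models are
  included.\<close>

locale pa = arith +
  assumes suc_nz: "suc x \<noteq> zero"
    and suc_inj: "suc x = suc y ==> x = y"
    and add_zero: "x \<oplus> zero = x" and add_suc: "x \<oplus> suc y = suc (x \<oplus> y)"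
    and mul_zero: "x \<otimes> zero = zero" and mul_suc: "x \<otimes> suc y = x \<otimes> y \<oplus> x"
    and ind: "eval (zero ## e) A ==> (!!x. eval (x ## e) A ==> eval (suc x ## e) A) ==> eval (x ## e) A"
begin

lemma HA_sound: "HA \<turnstile> A ==> eval e A"
proof (induction arbitrary: e rule: HA.induct)
  case (ha_ind A)
  then show ?case using ind[of e A] by auto
next
  case (ha_allI A B)
  then show ?case by fastforce
next
  case (ha_exE A B)
  then show ?case by fastforce
qed (auto simp: suc_nz add_zero add_suc mul_zero mul_suc dest: suc_inj)

end

text \<open>A definition cannot quantify over all carrier types; \<open>nat\<close> suffices because
  the Henkin model is countably infinite.\<close>

definition valid :: "fm => bool" where
  "valid A \<longleftrightarrow> (\<forall>(zero::nat) suc add mul e. pa zero suc add mul \<longrightarrow> arith.eval zero suc add mul e A)"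


section \<open>Completeness for negative formulas\<close>

instance tm :: countable by countable_datatype
instance fm :: countable by countable_datatype

text \<open>The renaming \<open>\<rho>\<close> sends variable \<open>k\<close> to 0 and shifts the
  others. On the context, where \<open>k\<close> is fresh, it acts as \<open>lift 0\<close>, and it
  turns \<open>sub 0 (Var k) C\<close> back into \<open>C\<close>.\<close>

lemma nd_fresh:
  assumes "!!A. A \<in> \<Gamma> ==> vars_below k A" "vars_below (Suc k) C" "\<Gamma> |- sub 0 (Var k) C"
  shows "\<Gamma> |- Forall C"
proof -
  obtain \<Delta> where D: "set \<Delta> \<subseteq> \<Gamma>" "HA \<turnstile> Imp (conjs \<Delta>) (sub 0 (Var k) C)"
    using assms(3) unfolding nd_def by blast
  define \<rho> where "\<rho> i = (if i = k then Var 0 else Var (Suc i))" for i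
  have "psub \<rho> (conjs \<Delta>) = lift 0 (conjs \<Delta>)"
  proof -
    have "vars_below k (conjs \<Delta>)" using D(1) assms(1) by (induction \<Delta>) auto
    then show ?thesis unfolding lift_psub by (rule psub_below) (auto simp: \<rho>_def)
  qed
  moreover have "psub \<rho> (sub 0 (Var k) C) = C"
  proof -
    have "psub \<rho> (sub 0 (Var k) C) = psub Var C"
      unfolding sub_psub psub_comp by (rule psub_below[OF assms(2)]) (auto simp: \<rho>_def)
    then show ?thesis by simp
  qed
  ultimately have "HA \<turnstile> Imp (lift 0 (conjs \<Delta>)) C" using HA_psub[OF D(2), of \<rho>] by simp
  then have "HA \<turnstile> Imp (conjs \<Delta>) (Forall C)" by (rule ha_allI)
  with D(1) show ?thesis unfolding nd_def by blast
qed

text \<open>The context is kept finite so that some variable is fresh; it plays the role of a Henkin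
  constant, and the language need not be extended. Stability of \<open>C\<close> shows that the
  witness can be added consistently.\<close>

lemma henkin_step:
  assumes "finite \<Gamma>" "\<not> \<Gamma> |- Bot" "neg B"
  shows "\<exists>\<Gamma>'. \<Gamma> \<subseteq> \<Gamma>' \<and> finite \<Gamma>' \<and> \<not> \<Gamma>' |- Bot \<and>
    (B \<in> \<Gamma>' \<or> Neg B \<in> \<Gamma>' \<and> (\<forall>C. B = Forall C \<longrightarrow> (\<exists>t. Neg (sub 0 t C) \<in> \<Gamma>')))"
proof (cases "insert B \<Gamma> |- Bot")
  case False
  then show ?thesis using assms by (intro exI[of _ "insert B \<Gamma>"]) auto
next
  case True
  then have nB: "\<Gamma> |- Neg B" by (rule nd_impI)
  show ?thesis
  proof (cases "\<exists>C. B = Forall C")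
    case False
    have "\<not> insert (Neg B) \<Gamma> |- Bot" using nB assms nd_cut by blast
    with False show ?thesis using assms by (intro exI[of _ "insert (Neg B) \<Gamma>"]) auto
  next
    case True
    then obtain C where C: "B = Forall C" by blast
    have "\<exists>k. (\<forall>A\<in>\<Gamma>. vars_below k A) \<and> vars_below (Suc k) C"
      using assms(1)
    proof (induction \<Gamma>)
      case empty
      then show ?case using vars_below_ex[of "Forall C"] by auto
    next
      case (insert A \<Gamma>)
      then obtain k n where "\<forall>A\<in>\<Gamma>. vars_below k A" "vars_below (Suc k) C" "vars_below n A"
        using vars_below_ex by blast
      then show ?case by (intro exI[of _ "max k n"]) (auto intro: vars_below_mono[OF _ max.cobounded1] vars_below_mono[OF _ max.cobounded2] vars_below_mono[of "Suc k"])
    qed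
    then obtain k where k: "\<forall>A\<in>\<Gamma>. vars_below k A" "vars_below (Suc k) C" by blast
    let ?W = "Neg (sub 0 (Var k) C)"
    have "\<not> insert ?W (insert (Neg B) \<Gamma>) |- Bot"
    proof
      assume *: "insert ?W (insert (Neg B) \<Gamma>) |- Bot"
      have "insert ?W \<Gamma> |- Bot"
        by (rule nd_cut[OF nd_weak[OF nB]]) (use * in \<open>simp add: insert_commute\<close>)
      then have "\<Gamma> |- sub 0 (Var k) C"
        using assms(3) C nd_stable[OF _ nd_impI] by (simp add: sub_psub)
      then have "\<Gamma> |- B" unfolding C by (intro nd_fresh[of _ k]) (use k in auto)
      with nB assms(2) show False using nd_mp by blast
    qed
    then show ?thesis using C assms(1)
      by (intro exI[of _ "insert ?W (insert (Neg B) \<Gamma>)"]) auto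
  qed
qed

locale henkin =
  fixes H :: "fm set"
  assumes cons: "\<not> H |- Bot"
    and max: "neg B ==> H |- B \<or> H |- Neg B"
    and wit: "neg C ==> (!!t. H |- sub 0 t C) ==> H |- Forall C"
begin

lemma Imp_iff: "neg A ==> H |- Imp A B \<longleftrightarrow> (H |- A \<longrightarrow> H |- B)"
  by (meson max nd_botE nd_impI nd_mp nd_weak nd_0)

lemma Conj_iff: "H |- Conj A B \<longleftrightarrow> H |- A \<and> H |- B"
  by (meson nd_conjI nd_conj1 nd_conj2)

lemma Forall_iff: "neg C ==> H |- Forall C \<longleftrightarrow> (\<forall>t. H |- sub 0 t C)"
  using wit nd_allE by blast

text \<open>The term model: terms modulo provable equality. Numerals are pairwise different modulo
  \<open>H\<close>, so there are infinitely many classes, and a bijection moves the model to the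
  carrier \<open>nat\<close>.\<close>

lemma model: "\<exists>(zero::nat) suc add mul e. pa zero suc add mul \<and>
    (\<forall>A. neg A \<longrightarrow> (arith.eval zero suc add mul e A \<longleftrightarrow> H |- A))"
proof -
  define cls where "cls t = {u. H |- Eq t u}" for t
  have cls: "cls s = cls t \<longleftrightarrow> H |- Eq s t" for s t
    unfolding cls_def using nd_refl nd_sym nd_trans by blast
  have "infinite (range cls)"
  proof -
    have "m = n" if "cls (num m) = cls (num n)" for m n
      using that unfolding cls
    proof (induction m arbitrary: n)
      case 0
      show ?case
      proof (cases n)
        case (Suc k)
        then show ?thesis using 0 cons nd_nz'[of H "num k" Bot] by simp
      qed simp
    next
      case (Suc m)
      show ?case
      proof (cases n)
        case 0
        then show ?thesis using Suc.prems cons nd_nz[of H "num m" Bot] by simp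
      next
        case (Suc k)
        then show ?thesis using Suc.prems Suc.IH[of k] nd_inj[of H "num m" "num k"] by simp
      qed
    qed
    then have "inj (\<lambda>n. cls (num n))" by (auto intro: injI)
    then have "infinite (range (\<lambda>n. cls (num n)))" by (rule range_inj_infinite)
    then show ?thesis by (rule infinite_super[rotated]) auto
  qed
  then have bij: "bij_betw (to_nat_on (range cls)) (range cls) UNIV"
    by (rule to_nat_on_infinite[OF countableI_type[THEN countable_image]])
  define \<kappa> where "\<kappa> t = to_nat_on (range cls) (cls t)" for t
  have \<kappa>_eq: "\<kappa> s = \<kappa> t \<longleftrightarrow> H |- Eq s t" for s t
    unfolding \<kappa>_def cls[symmetric] using bij by (auto simp: bij_betw_def inj_on_def)
  have "surj \<kappa>" unfolding \<kappa>_def using bij by (force simp: bij_betw_def)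
  define \<iota> where "\<iota> = inv \<kappa>"
  have \<kappa>\<iota> [simp]: "\<kappa> (\<iota> x) = x" for x unfolding \<iota>_def by (rule surj_f_inv_f[OF \<open>surj \<kappa>\<close>])
  have \<iota>\<kappa>: "H |- Eq (\<iota> (\<kappa> t)) t" for t by (simp flip: \<kappa>_eq)
  define zero where "zero = \<kappa> Zero"
  define suc where "suc x = \<kappa> (Succ (\<iota> x))" for x
  define add where "add x y = \<kappa> (Add (\<iota> x) (\<iota> y))" for x y
  define mul where "mul x y = \<kappa> (Mul (\<iota> x) (\<iota> y))" for x y
  interpret arith zero suc add mul .
  have suc: "suc (\<kappa> t) = \<kappa> (Succ t)" and add: "add (\<kappa> s) (\<kappa> t) = \<kappa> (Add s t)" and mul: "mul (\<kappa> s) (\<kappa> t) = \<kappa> (Mul s t)" for s t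
    by (simp_all add: suc_def add_def mul_def \<kappa>_eq nd_Succ nd_Add nd_Mul \<iota>\<kappa>)
  have evt: "evt (\<lambda>i. \<kappa> (\<sigma> i)) t = \<kappa> (psub_tm \<sigma> t)" for \<sigma> t
    by (induction t) (simp_all add: suc add mul zero_def[symmetric])
  have sub_up: "sub 0 t (psub (up \<sigma>) B) = psub (t ## \<sigma>) B" for t \<sigma> B
    unfolding sub_psub psub_comp
    by (rule psub_eqI) (auto simp: push_def up_def sub_tm_psub[of 0, simplified, symmetric] split: nat.split)
  have push_\<kappa>: "(\<lambda>i. \<kappa> ((t ## \<sigma>) i)) = \<kappa> t ## (\<lambda>i. \<kappa> (\<sigma> i))" for t \<sigma>
    by (rule ext) (auto simp: push_def split: nat.split)
  \<comment> \<open>Truth lemma. \<open>\<kappa>\<close> numbers the classes, so a substitution by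
    terms is an environment of the model.\<close>
  have truth: "neg B ==> eval (\<lambda>i. \<kappa> (\<sigma> i)) B \<longleftrightarrow> H |- psub \<sigma> B" for \<sigma> B
  proof (induction B arbitrary: \<sigma>)
    case (Forall B)
    have "(\<forall>x. eval (x ## (\<lambda>i. \<kappa> (\<sigma> i))) B) \<longleftrightarrow> (\<forall>t. eval (\<lambda>i. \<kappa> ((t ## \<sigma>) i)) B)"
      unfolding push_\<kappa> by (metis \<kappa>\<iota>)
    with Forall show ?case by (simp add: Forall_iff sub_up)
  qed (simp_all add: evt \<kappa>_eq cons Conj_iff Imp_iff)
  have env: "(\<lambda>i. \<kappa> (\<iota> (e i))) = e" for e by simp
  have "pa zero suc add mul"
  proof
    fix x y
    show "suc x \<noteq> zero" using cons nd_nz by (auto simp: suc_def zero_def \<kappa>_eq)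
    show "suc x = suc y ==> x = y" using nd_inj \<kappa>_eq by (metis suc_def \<kappa>\<iota>)
    show "add x zero = x" using add[of "\<iota> x" Zero] \<kappa>_eq[of "Add (\<iota> x) Zero" "\<iota> x"] nd_add0 by (simp add: zero_def)
    show "add x (suc y) = suc (add x y)"
      using nd_addS[of H "\<iota> x" "\<iota> y"] by (metis suc add \<kappa>\<iota> \<kappa>_eq)
    show "mul x zero = zero"
      using nd_HA[OF ha_mul0[of "\<iota> x"], of H] by (metis mul zero_def \<kappa>\<iota> \<kappa>_eq)
    show "mul x (suc y) = add (mul x y) x"
      using nd_HA[OF ha_mulS[of "\<iota> x" "\<iota> y"], of H] by (metis suc add mul \<kappa>\<iota> \<kappa>_eq)
  next
    fix e :: "nat => nat" and A x
    define \<sigma> where "\<sigma> = (\<lambda>i. \<iota> (e i))"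
    \<comment> \<open>Induction is required for every formula, but the truth lemma covers only
      negative ones; \<open>N A\<close> has the same truth value as \<open>A\<close>.\<close>
    let ?A = "psub (up \<sigma>) (N A)"
    have *: "eval (\<kappa> t ## e) A \<longleftrightarrow> H |- sub 0 t ?A" for t
      using truth[of "N A" "t ## \<sigma>"] by (simp add: sub_up push_\<kappa>) (simp add: \<sigma>_def)
    assume 0: "eval (zero ## e) A" and S: "!!x. eval (x ## e) A ==> eval (suc x ## e) A"
    have "H |- Forall (Imp ?A (sub 0 (Succ X0) (lift 1 ?A)))"
    proof (rule wit)
      fix t
      have "H |- sub 0 t ?A ==> H |- sub 0 (Succ t) ?A"
        using S[of "\<kappa> t"] by (simp add: * suc)
      moreover have "sub 0 t (sub 0 (Succ X0) (lift 1 B)) = sub 0 (Succ t) B" for B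
        unfolding sub_psub lift_psub psub_comp by (rule psub_eqI) auto
      ultimately show "H |- sub 0 t (Imp ?A (sub 0 (Succ X0) (lift 1 ?A)))"
        by (simp add: Imp_iff sub_psub[of 0 t ?A])
    qed (simp add: sub_psub lift_psub)
    moreover have "H |- sub 0 Zero ?A" using 0 *[of Zero] by (simp add: zero_def[symmetric])
    ultimately have "H |- Forall ?A" using ha_ind nd_HA nd_mp by blast
    then have "H |- sub 0 (\<iota> x) ?A" by (rule nd_allE)
    then show "eval (x ## e) A" by (simp flip: *)
  qed
  moreover have "neg A ==> eval (\<lambda>i. \<kappa> (Var i)) A \<longleftrightarrow> H |- A" for A
    by (simp add: truth)
  ultimately show ?thesis by blast
qed

end

text \<open>A chain of finite consistent contexts starts from \<open>Neg A\<close>, which is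
  consistent because \<open>A\<close> is stable. Step \<open>n\<close> decides the formula with
  number \<open>n\<close> if it is negative, and its union is a Henkin theory.\<close>

theorem completeness: assumes "valid A" "neg A" shows "HA \<turnstile> A"
proof (rule ccontr)
  assume A: "\<not> HA \<turnstile> A"
  have cons0: "\<not> {Neg A} |- Bot"
    using A nd_impI[of "Neg A" "{}" Bot] nd_stable[OF assms(2)] HA_nd by blast
  define P where "P \<Gamma> \<longleftrightarrow> finite \<Gamma> \<and> \<not> \<Gamma> |- Bot" for \<Gamma> :: "fm set"
  define Q where "Q n \<Gamma> \<Gamma>' \<longleftrightarrow> \<Gamma> \<subseteq> \<Gamma>' \<and> (let B = from_nat n in neg B \<longrightarrow>
    (B \<in> \<Gamma>' \<or> Neg B \<in> \<Gamma>' \<and> (\<forall>C. B = Forall C \<longrightarrow> (\<exists>t. Neg (sub 0 t C) \<in> \<Gamma>'))))" for n \<Gamma> \<Gamma>'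
  have step: "\<exists>\<Gamma>'. P \<Gamma>' \<and> Q n \<Gamma> \<Gamma>'" if "P \<Gamma>" for n \<Gamma>
  proof (cases "neg (from_nat n)")
    case True
    then show ?thesis using that henkin_step[of \<Gamma> "from_nat n"] unfolding P_def Q_def Let_def by blast
  next
    case False
    then show ?thesis using that unfolding Q_def by auto
  qed
  have "\<exists>G. (\<forall>n. (n = 0 \<longrightarrow> G n = {Neg A}) \<and> P (G n)) \<and> (\<forall>n. Q n (G n) (G (Suc n)))"
  proof -
    define G where "G = rec_nat {Neg A} (\<lambda>n \<Gamma>. SOME \<Gamma>'. P \<Gamma>' \<and> Q n \<Gamma> \<Gamma>')"
    have PG: "P (G n)" for n
    proof (induction n)
      case 0
      then show ?case using cons0 by (simp add: G_def P_def)
    next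
      case (Suc n)
      then show ?case using someI_ex[OF step[OF Suc, of n]] by (simp add: G_def)
    qed
    have "Q n (G n) (G (Suc n))" for n
      using someI_ex[OF step[OF PG, of n]] by (simp add: G_def)
    with PG show ?thesis by (intro exI[of _ G]) (simp add: G_def)
  qed
  then obtain G where G: "G 0 = {Neg A}" "!!n. P (G n)" "!!n. Q n (G n) (G (Suc n))" by blast
  define H where "H = (\<Union>n. G n)"
  have mono: "m \<le> n ==> G m \<subseteq> G n" for m n
    by (rule lift_Suc_mono_le) (use G(3) Q_def in auto)
  have ex: "\<exists>n. \<Delta> \<subseteq> G n" if "finite \<Delta>" "\<Delta> \<subseteq> H" for \<Delta>
    using that
  proof (induction \<Delta>)
    case (insert B \<Delta>)
    then obtain m n where "\<Delta> \<subseteq> G m" "B \<in> G n" by (auto simp: H_def)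
    then show ?case using mono[of m "max m n"] mono[of n "max m n"] by (intro exI[of _ "max m n"]) auto
  qed simp
  have cons: "\<not> H |- Bot"
  proof
    assume "H |- Bot"
    then obtain \<Delta> n where "\<Delta> |- Bot" "\<Delta> \<subseteq> G n" using nd_finite ex by metis
    then show False using G(2)[of n] nd_mono P_def by blast
  qed
  have dec: "B \<in> H \<or> Neg B \<in> H \<and> (\<forall>C. B = Forall C \<longrightarrow> (\<exists>t. Neg (sub 0 t C) \<in> H))" if "neg B" for B
  proof -
    have "from_nat (to_nat B) = B" by simp
    then show ?thesis using G(3)[of "to_nat B"] that unfolding Q_def H_def Let_def by auto
  qed
  have "henkin H"
  proof
    show "\<not> H |- Bot" by (rule cons)
    show "H |- B \<or> H |- Neg B" if "neg B" for B using dec[OF that] nd_assm by blast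
    show "H |- Forall C" if C: "neg C" "!!t. H |- sub 0 t C" for C
    proof (rule ccontr)
      assume "\<not> H |- Forall C"
      then have "Forall C \<notin> H" using nd_assm by blast
      then obtain t where "Neg (sub 0 t C) \<in> H" using dec[of "Forall C"] C(1) by auto
      then show False using C(2) cons nd_assm nd_mp by blast
    qed
  qed
  from henkin.model[OF this] obtain zero :: nat and suc add mul e where
    *: "pa zero suc add mul" "!!A. neg A ==> arith.eval zero suc add mul e A \<longleftrightarrow> H |- A" by blast
  then have "H |- A" using assms unfolding valid_def by blast
  moreover have "Neg A \<in> H" using G(1) by (auto simp: H_def)
  ultimately show False using cons nd_assm nd_mp by blast
qed

corollary valid_N: "valid A ==> HA \<turnstile> N A"
  by (rule completeness) (auto simp: valid_def arith.eval_N)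


section \<open>Arithmetic in a model\<close>

definition mix :: "(nat => 'a) => (nat => 'a) => nat => 'a" where
  "mix e c i = (if even i then e (i div 2) else c (i div 2))"

named_theorems dfn

context pa
begin

text \<open>A property of predicates on environments: even variables of the formula are arguments
  and odd ones are parameters. The rules \<open>dfn\<close> then replace the writing of formulas
  when induction is used inside a model.\<close>

definition definable :: "((nat => 'a) => bool) => bool" where
  "definable P \<longleftrightarrow> (\<exists>A c. \<forall>e. P e \<longleftrightarrow> eval (mix e c) A)"

definition dfun :: "((nat => 'a) => 'a) => bool" where
  "dfun f \<longleftrightarrow> definable (\<lambda>e. e 0 = f (\<lambda>n. e (Suc n)))"

lemma eval_ren: "eval e (psub (\<lambda>i. Var (f i)) A) \<longleftrightarrow> eval (\<lambda>i. e (f i)) A"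
  by (simp add: eval_psub)

text \<open>The two parameter lists are interleaved: parameter variable \<open>2 * k + 1\<close>
  becomes \<open>4 * k + 1\<close> in the first formula and \<open>4 * k + 3\<close> in the
  second.\<close>

lemma definable2:
  assumes "definable P" "definable Q"
  shows "\<exists>A B c. (\<forall>e. P e \<longleftrightarrow> eval (mix e c) A) \<and> (\<forall>e. Q e \<longleftrightarrow> eval (mix e c) B)"
proof -
  obtain A c B d where *: "!!e. P e \<longleftrightarrow> eval (mix e c) A" "!!e. Q e \<longleftrightarrow> eval (mix e d) B"
    using assms unfolding definable_def by metis
  let ?f = "\<lambda>i. if even i then i else 2 * i - 1"
  let ?g = "\<lambda>i. if even i then i else 2 * i + 1"
  have m: "mix e c i = mix e (mix c d) (?f i) \<and> mix e d i = mix e (mix c d) (?g i)" for e :: "nat => 'a" and i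
  proof (cases "even i")
    case False
    then obtain k where "i = Suc (2 * k)" by (metis oddE Suc_eq_plus1)
    moreover have "Suc (4 * k) div 2 = 2 * k" "Suc (Suc (Suc (4 * k))) div 2 = Suc (2 * k)" by simp_all
    ultimately show ?thesis by (simp add: mix_def)
  qed (simp add: mix_def)
  have mix: "(\<lambda>i. mix e (mix c d) (?f i)) = mix e c" "(\<lambda>i. mix e (mix c d) (?g i)) = mix e d" for e :: "nat => 'a"
    by (rule ext, rule m[THEN conjunct1, symmetric]) (rule ext, rule m[THEN conjunct2, symmetric])
  have "P e \<longleftrightarrow> eval (mix e (mix c d)) (psub (\<lambda>i. Var (?f i)) A)" for e
    unfolding eval_ren * mix ..
  moreover have "Q e \<longleftrightarrow> eval (mix e (mix c d)) (psub (\<lambda>i. Var (?g i)) B)" for e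
    unfolding eval_ren * mix ..
  ultimately show ?thesis by blast
qed

lemma definable_const [dfn]: "definable (\<lambda>e. b)"
  unfolding definable_def by (rule exI[of _ "if b then Imp Bot Bot else Bot"]) simp

lemma definable_imp [dfn]: assumes "definable P" "definable Q" shows "definable (\<lambda>e. P e \<longrightarrow> Q e)"
proof -
  obtain A B c where "!!e. P e \<longleftrightarrow> eval (mix e c) A" "!!e. Q e \<longleftrightarrow> eval (mix e c) B"
    using definable2[OF assms] by blast
  then show ?thesis unfolding definable_def by (intro exI[of _ "Imp A B"]) auto
qed

lemma definable_not [dfn]: "definable P ==> definable (\<lambda>e. \<not> P e)"
  using definable_imp[OF _ definable_const[of False]] by simp

lemma definable_conj [dfn]: "definable P ==> definable Q ==> definable (\<lambda>e. P e \<and> Q e)"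
  using definable_not[OF definable_imp[OF _ definable_not]] by auto

lemma definable_disj [dfn]: "definable P ==> definable Q ==> definable (\<lambda>e. P e \<or> Q e)"
  using definable_imp[OF definable_not] by (simp add: imp_conv_disj)

lemma definable_iff [dfn]: assumes "definable P" "definable Q" shows "definable (\<lambda>e. P e \<longleftrightarrow> Q e)"
proof -
  have "definable (\<lambda>e. (P e \<longrightarrow> Q e) \<and> (Q e \<longrightarrow> P e))" using assms by (intro dfn)
  then show ?thesis by (simp add: iff_conv_conj_imp)
qed

lemma definable_all [dfn]:
  assumes "definable (\<lambda>e. Q (\<lambda>n. e (Suc n)) (e 0))" shows "definable (\<lambda>e. \<forall>y. Q e y)"
proof -
  obtain A c where *: "!!e. Q (\<lambda>n. e (Suc n)) (e 0) \<longleftrightarrow> eval (mix e c) A"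
    using assms unfolding definable_def by blast
  \<comment> \<open>In front of \<open>mix e c\<close>, the value \<open>y\<close> occupies index 0.
    So argument \<open>k - 1\<close> of \<open>e\<close>, formerly at \<open>2 * k\<close>, sits at
    \<open>2 * k - 1\<close>, and a parameter moves up by one.\<close>
  let ?f = "\<lambda>i. if i = 0 then 0 else if even i then i - 1 else Suc i"
  have "Q e y \<longleftrightarrow> eval (y ## mix e c) (psub (\<lambda>i. Var (?f i)) A)" for e y
  proof -
    have "Q e y \<longleftrightarrow> eval (mix (y ## e) c) A" using *[of "y ## e"] by simp
    also have "\<dots> \<longleftrightarrow> eval (\<lambda>i. (y ## mix e c) (?f i)) A"
    proof (rule eval_cong)
      fix i show "mix (y ## e) c i = (y ## mix e c) (?f i)"
      proof (cases "even i")
        case True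
        then obtain k where "i = 2 * k" by blast
        then show ?thesis by (cases k) (simp_all add: mix_def)
      next
        case False
        then obtain k where "i = Suc (2 * k)" by (metis oddE Suc_eq_plus1)
        then show ?thesis by (simp add: mix_def)
      qed
    qed
    finally show ?thesis by (simp add: eval_ren)
  qed
  then show ?thesis unfolding definable_def
    by (intro exI[of _ "Forall (psub (\<lambda>i. Var (?f i)) A)"]) auto
qed

lemma definable_ex [dfn]:
  assumes "definable (\<lambda>e. Q (\<lambda>n. e (Suc n)) (e 0))" shows "definable (\<lambda>e. \<exists>y. Q e y)"
  using definable_not[OF definable_all[of "\<lambda>e y. \<not> Q e y", OF definable_not[OF assms]]] by simp

lemma definable_ren: assumes "definable P" shows "definable (\<lambda>e. P (\<lambda>i. e (f i)))"
proof -
  obtain A c where *: "!!e. P e \<longleftrightarrow> eval (mix e c) A"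
    using assms unfolding definable_def by blast
  let ?f = "\<lambda>i. if even i then 2 * f (i div 2) else i"
  have "P (\<lambda>i. e (f i)) \<longleftrightarrow> eval (mix e c) (psub (\<lambda>i. Var (?f i)) A)" for e
    unfolding eval_ren * by (rule eval_cong) (auto simp: mix_def)
  then show ?thesis unfolding definable_def by blast
qed

lemma dfun_const [dfn]: "dfun (\<lambda>e. c)"
  unfolding dfun_def definable_def
  by (intro exI[of _ "Eq (Var 0) (Var 1)"] exI[of _ "\<lambda>_. c"]) (simp add: mix_def)

lemma dfun_var [dfn]: "dfun (\<lambda>e. e n)"
  unfolding dfun_def definable_def
  by (intro exI[of _ "Eq (Var 0) (Var (2 * Suc n))"]) (simp add: mix_def)

lemma dfun_Suc: "dfun f ==> dfun (\<lambda>e. f (\<lambda>n. e (Suc n)))"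
proof -
  assume "dfun f"
  from definable_ren[OF this[unfolded dfun_def], of "\<lambda>i. if i = 0 then 0 else Suc i"]
  show ?thesis unfolding dfun_def by simp
qed

lemma definable_comp1: assumes "definable (\<lambda>e. R (e 0))" "dfun f" shows "definable (\<lambda>e. R (f e))"
proof -
  have "definable (\<lambda>e. \<exists>y. y = f e \<and> R y)"
    by (intro dfn) (use assms in \<open>simp_all add: dfun_def\<close>)
  then show ?thesis by simp
qed

lemma definable_comp2:
  assumes "definable (\<lambda>e. R (e 0) (e 1))" "dfun f" "dfun g" shows "definable (\<lambda>e. R (f e) (g e))"
proof -
  have "definable (\<lambda>e. R (e 1) (e 0))"
    using definable_ren[OF assms(1), of "\<lambda>i. 1 - i"] by simp
  moreover have "definable (\<lambda>e. e 1 = f (\<lambda>n. e (Suc (Suc n))))"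
    using definable_ren[OF assms(2)[unfolded dfun_def], of Suc] by simp
  moreover have "definable (\<lambda>e. e 0 = g (\<lambda>n. e (Suc (Suc n))))"
    using dfun_Suc[OF assms(3)] by (simp add: dfun_def)
  ultimately have "definable (\<lambda>e. \<exists>x y. x = f e \<and> y = g e \<and> R x y)"
    by (intro dfn) simp_all
  then show ?thesis by simp
qed

lemma definable_comp3:
  assumes "definable (\<lambda>e. R (e 0) (e 1) (e 2))" "dfun f" "dfun g" "dfun h"
  shows "definable (\<lambda>e. R (f e) (g e) (h e))"
proof -
  have R: "definable (\<lambda>e. R (e 2) (e 1) (e 0))"
    using definable_ren[OF assms(1), of "\<lambda>i. 2 - i"] by simp
  have 1: "definable (\<lambda>e. e 2 = f (\<lambda>n. e (Suc (Suc (Suc n)))))"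
    using definable_ren[OF assms(2)[unfolded dfun_def], of "\<lambda>n. Suc (Suc n)"] by (simp add: numeral_2_eq_2)
  have 2: "definable (\<lambda>e. e 1 = g (\<lambda>n. e (Suc (Suc (Suc n)))))"
    using definable_ren[OF dfun_Suc[OF assms(3), unfolded dfun_def], of Suc] by simp
  have 3: "definable (\<lambda>e. e 0 = h (\<lambda>n. e (Suc (Suc (Suc n)))))"
    using dfun_Suc[OF dfun_Suc[OF assms(4)]] by (simp add: dfun_def)
  have "definable (\<lambda>e. \<exists>x y z. x = f e \<and> y = g e \<and> z = h e \<and> R x y z)"
    by (intro definable_ex definable_conj) (use R 1 2 3 in \<open>simp_all add: numeral_2_eq_2\<close>)
  then show ?thesis by simp
qed

lemma definable_eq [dfn]: assumes "dfun f" "dfun g" shows "definable (\<lambda>e. f e = g e)"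
proof (rule definable_comp2[OF _ assms])
  show "definable (\<lambda>e. e 0 = e 1)" using dfun_var[of 0] by (simp add: dfun_def)
qed

lemma dfun_comp1: assumes "definable (\<lambda>e. e 0 = F (e 1))" "dfun f" shows "dfun (\<lambda>e. F (f e))"
  unfolding dfun_def
  by (rule definable_comp2[OF assms(1), of "\<lambda>e. e 0"]) (intro dfn dfun_Suc assms)+

lemma dfun_comp2: assumes "definable (\<lambda>e. e 0 = F (e 1) (e 2))" "dfun f" "dfun g" shows "dfun (\<lambda>e. F (f e) (g e))"
  unfolding dfun_def
  by (rule definable_comp3[OF assms(1), of "\<lambda>e. e 0"]) (intro dfn dfun_Suc assms)+

lemma dfun_suc [dfn]: "dfun f ==> dfun (\<lambda>e. suc (f e))"
  by (rule dfun_comp1) (auto simp: definable_def mix_def intro!: exI[of _ "Eq (Var 0) (Succ (Var 2))"])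

lemma dfun_add [dfn]: "dfun f ==> dfun g ==> dfun (\<lambda>e. f e \<oplus> g e)"
  by (rule dfun_comp2) (auto simp: definable_def mix_def intro!: exI[of _ "Eq (Var 0) (Add (Var 2) (Var 4))"])

lemma dfun_mul [dfn]: "dfun f ==> dfun g ==> dfun (\<lambda>e. f e \<otimes> g e)"
  by (rule dfun_comp2) (auto simp: definable_def mix_def intro!: exI[of _ "Eq (Var 0) (Mul (Var 2) (Var 4))"])

text \<open>The induction axiom in the form used from here on. Inside, \<open>?f\<close> sends all
  argument variables to index 0 and the parameters behind it.\<close>

lemma pa_induct [case_names definable zero suc]:
  assumes "definable (\<lambda>e. P (e 0))" "P zero" "!!x. P x ==> P (suc x)" shows "P x"
proof -
  obtain A c where *: "!!e. P (e 0) \<longleftrightarrow> eval (mix e c) A"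
    using assms(1) unfolding definable_def by blast
  let ?f = "\<lambda>i. if even i then 0 else Suc (i div 2)"
  have "P x \<longleftrightarrow> eval (x ## c) (psub (\<lambda>i. Var (?f i)) A)" for x
  proof -
    have "P x \<longleftrightarrow> eval (mix (\<lambda>_. x) c) A" using *[of "\<lambda>_. x"] by simp
    also have "\<dots> \<longleftrightarrow> eval (\<lambda>i. (x ## c) (?f i)) A"
      by (rule eval_cong) (auto simp: mix_def)
    finally show ?thesis by (simp add: eval_ren)
  qed
  then show ?thesis using assms(2,3) ind[of c "psub (\<lambda>i. Var (?f i)) A" x] by simp
qed

section \<open>Semiring laws and cancellation\<close>

lemma add_zero_left: "zero \<oplus> x = x"
  by (induct x rule: pa_induct) (intro dfn, simp_all add: add_zero add_suc)

lemma add_suc_left: "suc x \<oplus> y = suc (x \<oplus> y)"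
  by (induct y rule: pa_induct) (intro dfn, simp_all add: add_zero add_suc)

lemma add_assoc: "x \<oplus> y \<oplus> w = x \<oplus> (y \<oplus> w)"
  by (induct w rule: pa_induct) (intro dfn, simp_all add: add_zero add_suc)

lemma add_comm: "x \<oplus> y = y \<oplus> x"
  by (induct y rule: pa_induct) (intro dfn, simp_all add: add_zero add_suc add_zero_left add_suc_left)

lemma add_left_comm: "x \<oplus> (y \<oplus> w) = y \<oplus> (x \<oplus> w)"
  by (metis add_assoc add_comm)

lemma mul_zero_left: "zero \<otimes> x = zero"
  by (induct x rule: pa_induct) (intro dfn, simp_all add: mul_zero mul_suc add_zero)

lemma mul_suc_left: "suc x \<otimes> y = x \<otimes> y \<oplus> y"
  by (induct y rule: pa_induct)
    (intro dfn, simp_all add: mul_zero mul_suc add_zero add_suc add_assoc, simp add: add_comm)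

lemma mul_comm: "x \<otimes> y = y \<otimes> x"
  by (induct y rule: pa_induct) (intro dfn, simp_all add: mul_zero mul_suc mul_zero_left mul_suc_left)

lemma distrib: "x \<otimes> (y \<oplus> w) = x \<otimes> y \<oplus> x \<otimes> w"
  by (induct w rule: pa_induct)
    (intro dfn, simp_all add: mul_zero mul_suc add_zero add_suc add_assoc)

lemma distrib_left: "(y \<oplus> w) \<otimes> x = y \<otimes> x \<oplus> w \<otimes> x"
  by (metis distrib mul_comm)

lemma mul_assoc: "x \<otimes> y \<otimes> w = x \<otimes> (y \<otimes> w)"
  by (induct w rule: pa_induct) (intro dfn, simp_all add: mul_zero mul_suc distrib)

lemma mul_left_comm: "x \<otimes> (y \<otimes> w) = y \<otimes> (x \<otimes> w)"
  by (metis mul_assoc mul_comm)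

lemmas basic [simp] = add_zero add_suc mul_zero add_zero_left add_suc_left mul_zero_left suc_nz suc_nz[symmetric]

lemma suc_eq [simp]: "suc x = suc y \<longleftrightarrow> x = y"
  using suc_inj by blast

lemmas alg = add_assoc add_comm add_left_comm mul_assoc mul_comm mul_left_comm
  mul_suc mul_suc_left distrib distrib_left

lemma add_cancel [simp]: "x \<oplus> y = x \<oplus> w \<longleftrightarrow> y = w"
  by (induct x rule: pa_induct) (intro dfn, simp_all)

lemma add_cancel_right [simp]: "y \<oplus> x = w \<oplus> x \<longleftrightarrow> y = w"
  by (metis add_cancel add_comm)

lemma exhaust: "x = zero \<or> (\<exists>y. x = suc y)"
  by (induct x rule: pa_induct) (intro dfn, auto)

lemma add_eq_zero [simp]: "x \<oplus> y = zero \<longleftrightarrow> x = zero \<and> y = zero"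
  using exhaust[of y] by auto

section \<open>The linear order\<close>

definition le :: "'a => 'a => bool" (infix "\<preceq>" 50) where "x \<preceq> y \<longleftrightarrow> (\<exists>w. x \<oplus> w = y)"
definition lt :: "'a => 'a => bool" (infix "\<prec>" 50) where "x \<prec> y \<longleftrightarrow> suc x \<preceq> y"

lemma definable_le [dfn]: "dfun f ==> dfun g ==> definable (\<lambda>e. f e \<preceq> g e)"
  unfolding le_def by (intro dfn dfun_Suc)

lemma definable_lt [dfn]: "dfun f ==> dfun g ==> definable (\<lambda>e. f e \<prec> g e)"
  unfolding lt_def by (intro dfn)

lemma zero_le [simp]: "zero \<preceq> x" and le_refl [simp]: "x \<preceq> x" and le_add [simp]: "x \<preceq> x \<oplus> y" and le_add2 [simp]: "y \<preceq> x \<oplus> y"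
  and le_suc_self [simp]: "x \<preceq> suc x"
proof -
  show "x \<preceq> x \<oplus> y" for x y by (auto simp: le_def)
  from this[of zero x] this[of x zero] this[of y x] this[of x "suc zero"]
  show "zero \<preceq> x" "x \<preceq> x" "y \<preceq> x \<oplus> y" "x \<preceq> suc x" by (simp_all add: add_comm)
qed

lemma le_trans: "x \<preceq> y ==> y \<preceq> w ==> x \<preceq> w"
  by (auto simp: le_def add_assoc)

lemma le_antisym: "x \<preceq> y ==> y \<preceq> x ==> x = y"
proof -
  assume "x \<preceq> y" "y \<preceq> x"
  then obtain w w' where "x \<oplus> w = y" "y \<oplus> w' = x" by (auto simp: le_def)
  then have "x \<oplus> (w \<oplus> w') = x \<oplus> zero" by (simp add: add_assoc[symmetric])
  then have "w = zero" using add_cancel add_eq_zero by blast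
  with \<open>x \<oplus> w = y\<close> show ?thesis by simp
qed

lemma le_suc_suc [simp]: "suc x \<preceq> suc y \<longleftrightarrow> x \<preceq> y"
  by (simp add: le_def)

lemma not_suc_le_zero [simp]: "\<not> suc x \<preceq> zero"
  by (simp add: le_def)

lemma le_zero [simp]: "x \<preceq> zero \<longleftrightarrow> x = zero"
  by (auto simp: le_def)

lemma not_lt_zero [simp]: "\<not> x \<prec> zero" and lt_suc [simp]: "x \<prec> suc y \<longleftrightarrow> x \<preceq> y"
  by (simp_all add: lt_def)

lemma le_lt: "x \<preceq> y \<longleftrightarrow> x \<prec> y \<or> x = y"
proof
  assume "x \<preceq> y"
  then obtain w where "x \<oplus> w = y" by (auto simp: le_def)
  with exhaust[of w] show "x \<prec> y \<or> x = y" by (auto simp: lt_def)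
qed (auto simp: lt_def intro: le_trans le_suc_self)

lemma le_or_lt: "x \<preceq> y \<or> y \<prec> x"
proof (induct x rule: pa_induct)
  case (suc x)
  then show ?case using le_lt[of x y] by (auto simp: lt_def intro: le_trans le_suc_self)
qed (intro dfn, simp)

lemma lt_irrefl [simp]: "\<not> x \<prec> x"
proof
  assume "x \<prec> x"
  then obtain w where "x \<oplus> suc w = x \<oplus> zero" by (auto simp: lt_def le_def)
  then show False by (simp del: add_suc add_zero)
qed

sublocale linorder le lt
proof
  show "(x \<prec> y) = (x \<preceq> y \<and> \<not> y \<preceq> x)" for x y
    using le_or_lt[of y x] le_antisym le_lt lt_irrefl by metis
  show "x \<preceq> y \<or> y \<preceq> x" for x y using le_or_lt le_lt by blast
qed (auto intro: le_trans le_antisym)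

lemma lt_suc_cases: "x \<prec> suc y \<longleftrightarrow> x \<prec> y \<or> x = y"
  by (simp add: le_lt)

lemma add_mono: "x \<preceq> y ==> v \<preceq> w ==> x \<oplus> v \<preceq> y \<oplus> w"
proof -
  assume "x \<preceq> y" "v \<preceq> w"
  then obtain a b where "y = x \<oplus> a" "w = v \<oplus> b" by (auto simp: le_def)
  then have "y \<oplus> w = (x \<oplus> v) \<oplus> (a \<oplus> b)" by (simp add: alg)
  then show ?thesis by simp
qed

lemma mul_mono: "x \<preceq> y ==> v \<preceq> w ==> x \<otimes> v \<preceq> y \<otimes> w"
proof -
  assume "x \<preceq> y" "v \<preceq> w"
  then obtain a b where "y = x \<oplus> a" "w = v \<oplus> b" by (auto simp: le_def)
  then have "y \<otimes> w = (x \<otimes> v) \<oplus> (x \<otimes> b \<oplus> a \<otimes> v \<oplus> a \<otimes> b)" by (simp add: alg)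
  then show ?thesis by simp
qed

lemma le_mul_suc: "x \<preceq> suc y \<otimes> x"
  by (simp add: mul_suc_left)

lemma eval_le_fm [simp]: "eval e (le_fm s t) \<longleftrightarrow> evt e s \<preceq> evt e t"
  by (simp add: le_fm_eq le_def)

lemma least:
  assumes "definable (\<lambda>e. P (e 0))" "P x" shows "\<exists>y. P y \<and> (\<forall>w. w \<prec> y \<longrightarrow> \<not> P w)"
proof (rule ccontr)
  assume *: "\<nexists>y. P y \<and> (\<forall>w. w \<prec> y \<longrightarrow> \<not> P w)"
  have "\<forall>w. w \<prec> x \<longrightarrow> \<not> P w" for x
  proof (induct x rule: pa_induct)
    case (suc x)
    with * show ?case by (auto simp: le_lt)
  qed (intro dfn definable_comp1[OF assms(1)], simp)
  with assms(2) * show False by blast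
qed

section \<open>Pairing, numerals, and the beta function\<close>

definition pr :: "'a => 'a => 'a" where "pr x y = suc ((x \<oplus> y) \<otimes> (x \<oplus> y) \<oplus> x)"

lemma dfun_pr [dfn]: "dfun f ==> dfun g ==> dfun (\<lambda>e. pr (f e) (g e))"
  unfolding pr_def by (intro dfn)

lemma evt_qpair [simp]: "evt e (qpair s t) = pr (evt e s) (evt e t)"
  by (simp add: qpair_def pr_def)

text \<open>\<open>m * m + x\<close> with \<open>x \<le> m\<close> stays below the next square. So
  the pairing function determines the sum of its arguments, and then each of them.\<close>

lemma sq_lt: assumes "m \<prec> n" "x \<preceq> m" shows "m \<otimes> m \<oplus> x \<prec> n \<otimes> n \<oplus> y"
proof -
  have "suc m \<otimes> suc m \<preceq> n \<otimes> n" using assms(1) by (intro mul_mono) (simp_all add: lt_def)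
  moreover have "suc (m \<otimes> m \<oplus> x) \<preceq> suc m \<otimes> suc m"
    using assms(2) by (simp add: mul_suc mul_suc_left add_mono add_assoc) (metis le_add2 le_trans add_mono le_refl)
  ultimately show ?thesis unfolding lt_def by (meson le_add le_trans)
qed

lemma pr_inj [simp]: "pr x y = pr x' y' \<longleftrightarrow> x = x' \<and> y = y'"
proof
  assume *: "pr x y = pr x' y'"
  have "x \<oplus> y = x' \<oplus> y'"
    using sq_lt[of "x \<oplus> y" "x' \<oplus> y'" x x'] sq_lt[of "x' \<oplus> y'" "x \<oplus> y" x' x] *
    by (cases "x \<oplus> y" "x' \<oplus> y'" rule: linorder_cases) (auto simp: pr_def)
  with * show "x = x' \<and> y = y'" by (auto simp: pr_def)
qed simp

primrec nm :: "nat => 'a" where "nm 0 = zero" | "nm (Suc n) = suc (nm n)"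

lemma evt_num [simp]: "evt e (num n) = nm n"
  by (induction n) auto

lemma nm_add: "nm (m + n) = nm m \<oplus> nm n"
  by (induction m) auto

lemma nm_mult: "nm (m * n) = nm m \<otimes> nm n"
  by (induction m) (auto simp: nm_add mul_suc_left add_comm)

lemma nm_pair: "nm (pair m n) = pr (nm m) (nm n)"
  by (simp add: pair_def pr_def nm_add nm_mult)

lemma nm_inj [simp]: "nm m = nm n \<longleftrightarrow> m = n"
proof (induction m arbitrary: n)
  case 0 then show ?case by (cases n) auto
next
  case (Suc m) then show ?case by (cases n) auto
qed

definition bet :: "'a => 'a => 'a => 'a => bool" where
  "bet a b i y \<longleftrightarrow> y \<preceq> suc i \<otimes> b \<and> (\<exists>q. a = q \<otimes> suc (suc i \<otimes> b) \<oplus> y)"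

lemma eval_beta_fm [simp]: "eval e (beta_fm a b i y) \<longleftrightarrow> bet (evt e a) (evt e b) (evt e i) (evt e y)"
  by (simp add: beta_fm_def lifts_def bet_def)

lemma definable_bet [dfn]:
  "dfun f ==> dfun g ==> dfun h ==> dfun k ==> definable (\<lambda>e. bet (f e) (g e) (h e) (k e))"
  unfolding bet_def by (intro dfn dfun_Suc)

lemma rem_unique:
  assumes "q \<otimes> suc d \<oplus> y = q' \<otimes> suc d \<oplus> y'" "y \<preceq> d" "y' \<preceq> d" shows "y = y'"
proof -
  have F: False if "q \<prec> q'" "q \<otimes> suc d \<oplus> y = q' \<otimes> suc d \<oplus> y'" "y \<preceq> d" for q q' y y'
  proof -
    obtain w where w: "q' = q \<oplus> suc w" using \<open>q \<prec> q'\<close> by (auto simp: lt_def le_def)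
    have "q \<otimes> suc d \<oplus> y = q \<otimes> suc d \<oplus> (suc d \<oplus> (w \<otimes> suc d \<oplus> y'))"
      using that(2) unfolding w by (simp add: distrib_left mul_suc_left alg)
    then have "y = suc d \<oplus> (w \<otimes> suc d \<oplus> y')" by (simp only: add_cancel)
    then have "suc d \<preceq> y" by (simp only: le_add)
    with that(3) show False using le_trans not_le by (metis lt_suc le_lt less_irrefl lt_def)
  qed
  show ?thesis using F[of q q' y y'] F[of q' q y' y] assms by (cases q q' rule: linorder_cases) auto
qed

lemma bet_unique: "bet a b i y ==> bet a b i y' ==> y = y'"
  unfolding bet_def using rem_unique by blast

text \<open>The collection principle: in the induction, the bound for \<open>k\<close> is enlarged
  by one value that works at \<open>k\<close>.\<close>

lemma bounded_choice:
  assumes F: "definable (\<lambda>e. F (e 0) (e 1))" and "!!i. i \<prec> n ==> \<exists>y. F i y"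
  shows "\<exists>B. \<forall>i. i \<prec> n \<longrightarrow> (\<exists>y. y \<preceq> B \<and> F i y)"
proof -
  have "k \<preceq> n \<longrightarrow> (\<exists>B. \<forall>i. i \<prec> k \<longrightarrow> (\<exists>y. y \<preceq> B \<and> F i y))" for k
  proof (induct k rule: pa_induct)
    case (suc k)
    show ?case
    proof
      assume "suc k \<preceq> n"
      then have "k \<preceq> n" "k \<prec> n" by (auto simp: lt_def intro: le_trans le_suc_self)
      with suc obtain B where B: "!!i. i \<prec> k ==> \<exists>y. y \<preceq> B \<and> F i y" by blast
      obtain y where "F k y" using assms(2) \<open>k \<prec> n\<close> by blast
      then show "\<exists>B. \<forall>i. i \<prec> suc k \<longrightarrow> (\<exists>y. y \<preceq> B \<and> F i y)"
        using B by (intro exI[of _ "B \<oplus> y"]) (metis le_add le_add2 le_trans lt_suc_cases)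
    qed
  qed (intro dfn definable_comp2[OF F], simp)
  then show ?thesis by blast
qed

text \<open>Stands in for the factorial of \<open>n\<close>.\<close>

lemma common_multiple: "\<exists>b. b \<noteq> zero \<and> (\<forall>j. j \<prec> n \<longrightarrow> (\<exists>c. b = suc j \<otimes> c))"
proof (induct n rule: pa_induct)
  case zero
  show ?case by (intro exI[of _ "suc zero"]) simp
next
  case (suc n)
  then obtain b where b: "b \<noteq> zero" "!!j. j \<prec> n ==> \<exists>c. b = suc j \<otimes> c" by blast
  have "\<exists>c. suc n \<otimes> b = suc j \<otimes> c" if "j \<prec> suc n" for j
    using that b(2)[of j] unfolding lt_suc_cases by (metis mul_left_comm)
  moreover have "suc n \<otimes> b \<noteq> zero" using b(1) by (simp add: mul_suc_left)
  ultimately show ?case by blast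
qed (intro dfn)

text \<open>Invertibility of \<open>x\<close> modulo \<open>d\<close>, written without subtraction.
  It replaces coprimality: it passes to products directly and calls for neither gcds nor
  primes.\<close>

definition invertible :: "'a => 'a => bool" where
  "invertible x d \<longleftrightarrow> (\<exists>u v. x \<otimes> u = suc (d \<otimes> v))"

lemma definable_invertible [dfn]: "dfun f ==> dfun g ==> definable (\<lambda>e. invertible (f e) (g e))"
  unfolding invertible_def by (intro dfn dfun_Suc)

lemma invertible_mul: "invertible x d ==> invertible y d ==> invertible (x \<otimes> y) d"
proof -
  assume "invertible x d" "invertible y d"
  then obtain u v u' v' where *: "x \<otimes> u = suc (d \<otimes> v)" "y \<otimes> u' = suc (d \<otimes> v')"
    unfolding invertible_def by blast
  have "(x \<otimes> y) \<otimes> (u \<otimes> u') = (x \<otimes> u) \<otimes> (y \<otimes> u')" by (simp add: alg)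
  also have "\<dots> = suc (d \<otimes> (v \<oplus> v' \<oplus> d \<otimes> v \<otimes> v'))" unfolding * by (simp add: alg)
  finally show ?thesis unfolding invertible_def by blast
qed

text \<open>With \<open>b = (g + 1) c\<close> and \<open>k = j + g + 1\<close>, the product of \<open>1 + (j + 1) b\<close> and
  \<open>c (k + 1)\<^sup>2\<close> is congruent to \<open>-1\<close> modulo \<open>1 + (k + 1) b\<close>.\<close>

lemma beta_invertible:
  assumes "b \<noteq> zero" "b = suc g \<otimes> c"
  shows "invertible (suc (suc j \<otimes> b)) (suc (suc (j \<oplus> suc g) \<otimes> b))" (is "invertible ?x ?d")
proof -
  let ?K = "suc (j \<oplus> suc g)"
  obtain c' where c': "c = suc c'" using assms exhaust[of c] by auto
  define w where "w = ?x \<otimes> (c \<otimes> ?K \<otimes> ?K)"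
  have w: "suc w = ?d \<otimes> suc (c \<otimes> ?K \<otimes> suc j)"
    unfolding w_def assms(2) by (simp add: alg)
  have "w \<noteq> zero" unfolding w_def c' by (simp add: mul_suc_left mul_suc)
  then obtain w' where w': "w = suc w'" using exhaust by blast
  \<comment> \<open>Since \<open>w\<close> is -1 modulo \<open>?d\<close>, its square is 1, so one
    further factor \<open>w\<close> completes the inverse of \<open>?x\<close>.\<close>
  have "?x \<otimes> (c \<otimes> ?K \<otimes> ?K \<otimes> w) = w \<otimes> w" unfolding w_def by (simp only: mul_assoc)
  also have "\<dots> = suc (w' \<otimes> suc w)" unfolding w' by (simp add: alg)
  also have "\<dots> = suc (?d \<otimes> (w' \<otimes> suc (c \<otimes> ?K \<otimes> suc j)))" unfolding w by (simp only: mul_left_comm)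
  finally show ?thesis unfolding invertible_def by blast
qed

text \<open>One step of the Chinese remainder theorem: with \<open>L\<close> a multiple of the
  earlier moduli, adding \<open>L \<otimes> t\<close> changes no earlier remainder. In the choice of
  \<open>t\<close>, adding \<open>a \<otimes> d\<close> serves as subtracting \<open>a\<close>
  modulo \<open>suc d\<close>.\<close>

lemma crt_step:
  assumes "invertible L (suc d)" shows "\<exists>t q. a \<oplus> L \<otimes> t = q \<otimes> suc d \<oplus> y"
proof -
  obtain u v where uv: "L \<otimes> u = suc (suc d \<otimes> v)" using assms unfolding invertible_def by blast
  have "a \<oplus> L \<otimes> (u \<otimes> (y \<oplus> a \<otimes> d)) = a \<oplus> suc (suc d \<otimes> v) \<otimes> (y \<oplus> a \<otimes> d)"
    unfolding uv[symmetric] by (simp only: mul_assoc)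
  also have "\<dots> = (a \<oplus> v \<otimes> (y \<oplus> a \<otimes> d)) \<otimes> suc d \<oplus> y" by (simp add: alg)
  finally show ?thesis by blast
qed

text \<open>Goedel's beta lemma inside the model. \<open>F\<close> is a relation; the code picks
  some value below a common bound \<open>B\<close> at each index.\<close>

lemma beta_sequence:
  assumes F: "definable (\<lambda>e. F (e 0) (e 1))" and ex: "!!i. i \<prec> n ==> \<exists>y. F i y"
  shows "\<exists>a b. \<forall>i. i \<prec> n \<longrightarrow> (\<exists>y. bet a b i y \<and> F i y)"
proof -
  obtain B where B: "!!i. i \<prec> n ==> \<exists>y. y \<preceq> B \<and> F i y"
    using bounded_choice[OF F ex] by blast
  obtain b0 where b0: "b0 \<noteq> zero" "!!j. j \<prec> n ==> \<exists>c. b0 = suc j \<otimes> c"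
    using common_multiple by blast
  \<comment> \<open>The factor \<open>b0\<close> makes the moduli invertible modulo each other, and
    the factor \<open>suc B\<close> makes them large enough for all entries.\<close>
  define b where "b = b0 \<otimes> suc B"
  obtain b1 where b1: "b0 = suc b1" using b0(1) exhaust by blast
  have "b = suc (B \<oplus> (b1 \<otimes> B \<oplus> b1))" unfolding b_def b1 by (simp add: alg)
  then have b: "b \<noteq> zero" "B \<preceq> b" using le_trans[OF le_add le_suc_self] by simp_all
  have dvd: "\<exists>c. b = suc j \<otimes> c" if "j \<prec> n" for j
    using b0(2)[OF that] unfolding b_def by (metis mul_assoc)
  let ?d = "\<lambda>i. suc (suc i \<otimes> b)"
  have inv: "invertible (?d j) (?d k)" if "j \<prec> k" "k \<prec> n" for j k
  proof -
    obtain g where g: "k = j \<oplus> suc g" using \<open>j \<prec> k\<close> by (auto simp: lt_def le_def)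
    then have "g \<prec> n" using that(2) unfolding lt_def
      by (metis add_suc le_add2 le_suc_suc le_trans le_suc_self)
    then obtain c where "b = suc g \<otimes> c" using dvd by blast
    with b(1) show ?thesis unfolding g by (rule beta_invertible)
  qed
  \<comment> \<open>Instead of defining the product of the first \<open>j\<close> moduli, the
    induction provides some element divisible by all of them and invertible modulo the next
    one.\<close>
  have L: "j \<preceq> k \<longrightarrow> (\<exists>L. (\<forall>i. i \<prec> j \<longrightarrow> (\<exists>w. L = ?d i \<otimes> w)) \<and> invertible L (?d k))" if "k \<prec> n" for j k
  proof (induct j rule: pa_induct)
    case zero
    have "invertible (suc zero) (?d k)"
      unfolding invertible_def by (intro exI[of _ "suc zero"] exI[of _ zero]) (simp add: mul_suc)
    then show ?case by auto
  next
    case (suc j)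
    show ?case
    proof
      assume "suc j \<preceq> k"
      then have "j \<prec> k" "j \<preceq> k" by (auto simp: lt_def intro: le_trans le_suc_self)
      with suc obtain L where L: "!!i. i \<prec> j ==> \<exists>w. L = ?d i \<otimes> w" "invertible L (?d k)" by blast
      have "\<exists>w. L \<otimes> ?d j = ?d i \<otimes> w" if "i \<prec> suc j" for i
        using that L(1)[of i] unfolding lt_suc_cases by (metis mul_comm mul_assoc)
      moreover have "invertible (L \<otimes> ?d j) (?d k)"
        using L(2) inv[OF \<open>j \<prec> k\<close> \<open>k \<prec> n\<close>] by (rule invertible_mul)
      ultimately show "\<exists>L. (\<forall>i. i \<prec> suc j \<longrightarrow> (\<exists>w. L = ?d i \<otimes> w)) \<and> invertible L (?d k)" by blast
    qed
  qed (intro dfn)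
  have "k \<preceq> n \<longrightarrow> (\<exists>a. \<forall>i. i \<prec> k \<longrightarrow> (\<exists>y. bet a b i y \<and> F i y))" for k
  proof (induct k rule: pa_induct)
    case (suc k)
    show ?case
    proof
      assume "suc k \<preceq> n"
      then have k: "k \<prec> n" "k \<preceq> n" by (auto simp: lt_def intro: le_trans le_suc_self)
      with suc obtain a where a: "!!i. i \<prec> k ==> \<exists>y. bet a b i y \<and> F i y" by blast
      obtain L where L: "!!i. i \<prec> k ==> \<exists>w. L = ?d i \<otimes> w" "invertible L (?d k)"
        using L[OF k(1), of k] by auto
      obtain y where y: "y \<preceq> B" "F k y" using B k by blast
      obtain t q where tq: "a \<oplus> L \<otimes> t = q \<otimes> ?d k \<oplus> y" using crt_step[OF L(2)] by blast
      have "bet (a \<oplus> L \<otimes> t) b k y"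
        unfolding bet_def tq using y b(2) le_mul_suc[of b k] le_trans by blast
      moreover have "bet (a \<oplus> L \<otimes> t) b i y'" if i: "i \<prec> k" and "bet a b i y'" for i y'
      proof -
        obtain w q where w: "L = ?d i \<otimes> w" "a = q \<otimes> ?d i \<oplus> y'" and y': "y' \<preceq> suc i \<otimes> b"
          using L(1)[OF i] \<open>bet a b i y'\<close> unfolding bet_def by blast
        have "a \<oplus> L \<otimes> t = (q \<oplus> w \<otimes> t) \<otimes> ?d i \<oplus> y'" unfolding w
          by (simp only: distrib_left mul_assoc mul_comm mul_left_comm add_assoc add_comm add_left_comm)
        with y' show ?thesis unfolding bet_def by blast
      qed
      ultimately show "\<exists>a. \<forall>i. i \<prec> suc k \<longrightarrow> (\<exists>y. bet a b i y \<and> F i y)"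
        using a y(2) by (intro exI[of _ "a \<oplus> L \<otimes> t"]) (metis lt_suc_cases)
    qed
  qed (intro dfn definable_comp2[OF F], simp)
  then show ?thesis by blast
qed

end


section \<open>Derivations in a model\<close>

lemma rules_below: "(ps, c) \<in> set rules ==> vars_below_tm 6 c \<and> (\<forall>p\<in>set ps. vars_below_tm 6 p)"
proof -
  have num: "vars_below_tm n (num k)" for n k by (induction k) auto
  have qp: "vars_below_tm n (qpair s t) \<longleftrightarrow> vars_below_tm n s \<and> vars_below_tm n t" for n s t
    by (auto simp: qpair_def)
  have "\<forall>r\<in>set rules. vars_below_tm 6 (snd r) \<and> (\<forall>p\<in>set (fst r). vars_below_tm 6 p)"
    by (simp add: rules_def syntax_rules_def lift_rules_def sub_rules_def HA_rules_def qp num)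
  then show "(ps, c) \<in> set rules ==> ?thesis" by fastforce
qed

context pa
begin

text \<open>The environment \<open>\<sigma>\<close> ranges over the whole model, so nonstandard
  terms and formulas obey the same rules.\<close>

definition step :: "('a => bool) => 'a => bool" where
  "step P y \<longleftrightarrow> (\<exists>(ps, c)\<in>set rules. \<exists>\<sigma>. y = evt \<sigma> c \<and> (\<forall>p\<in>set ps. P (evt \<sigma> p)))"

definition entry :: "'a => 'a => 'a => 'a => bool" where
  "entry a b n p \<longleftrightarrow> (\<exists>j. j \<prec> n \<and> bet a b j p)"

definition derivation :: "'a => 'a => 'a => bool" where
  "derivation a b n \<longleftrightarrow> (\<forall>i. i \<prec> n \<longrightarrow> (\<exists>y. bet a b i y \<and> step (entry a b i) y))"

definition Der :: "'a => bool" where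
  "Der x \<longleftrightarrow> (\<exists>a b n. derivation a b n \<and> entry a b n x)"

lemma evt_lifts: "evt e (lifts k t) = evt (\<lambda>i. e (i + k)) t"
proof (induction k arbitrary: e)
  case (Suc k)
  have "evt e (lift_tm 0 s) = evt (\<lambda>i. e (Suc i)) s" for s by (induction s) auto
  with Suc show ?case by (simp add: lifts_def)
qed (simp add: lifts_def)

lemma eval_by_rule:
  assumes "(ps, c) \<in> set rules"
  shows "eval e (by_rule a b i (ps, c)) \<longleftrightarrow>
    (\<exists>\<sigma>. bet (evt e a) (evt e b) (evt e i) (evt \<sigma> c) \<and>
      (\<forall>p\<in>set ps. entry (evt e a) (evt e b) (evt e i) (evt \<sigma> p)))" (is "_ \<longleftrightarrow> (\<exists>\<sigma>. ?P \<sigma>)")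
proof -
  let ?E = "\<lambda>x5 x4 x3 x2 x1 x0. x0 ## x1 ## x2 ## x3 ## x4 ## x5 ## e"
  have *: "(Exists ^^ 6) A = Exists (Exists (Exists (Exists (Exists (Exists A)))))" for A
    by (simp add: numeral_eq_Suc)
  have tail: "(\<lambda>i. ?E x5 x4 x3 x2 x1 x0 (i + 6)) = e" "(\<lambda>i. (y ## ?E x5 x4 x3 x2 x1 x0) (i + 7)) = e"
    "(\<lambda>i. (y ## ?E x5 x4 x3 x2 x1 x0) (i + 1)) = ?E x5 x4 x3 x2 x1 x0" for x5 x4 x3 x2 x1 x0 y
    by (simp_all add: numeral_eq_Suc)
  have "eval e (by_rule a b i (ps, c)) \<longleftrightarrow> (\<exists>x5 x4 x3 x2 x1 x0. ?P (?E x5 x4 x3 x2 x1 x0))"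
    unfolding by_rule_def * case_prod_conv eval.simps eval_conjs set_map ball_simps eval_beta_fm
      eval_le_fm evt.simps evt_lifts tail entry_def lt_def push_0 ..
  also have "\<dots> \<longleftrightarrow> (\<exists>\<sigma>. ?P \<sigma>)"
  proof
    assume "\<exists>\<sigma>. ?P \<sigma>"
    then obtain \<sigma> where \<sigma>: "?P \<sigma>" by blast
    have "evt \<sigma> t = evt (?E (\<sigma> 5) (\<sigma> 4) (\<sigma> 3) (\<sigma> 2) (\<sigma> 1) (\<sigma> 0)) t" if "vars_below_tm 6 t" for t
      using that by (rule evt_below) (auto simp: numeral_eq_Suc less_Suc_eq)
    with \<sigma> rules_below[OF assms] have "?P (?E (\<sigma> 5) (\<sigma> 4) (\<sigma> 3) (\<sigma> 2) (\<sigma> 1) (\<sigma> 0))" by simp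
    then show "\<exists>x5 x4 x3 x2 x1 x0. ?P (?E x5 x4 x3 x2 x1 x0)" by blast
  qed blast
  finally show ?thesis .
qed

lemma eval_by_rules:
  "eval e (disjs (map (by_rule a b i) rules)) \<longleftrightarrow>
    (\<exists>y. bet (evt e a) (evt e b) (evt e i) y \<and> step (entry (evt e a) (evt e b) (evt e i)) y)" (is "?L \<longleftrightarrow> ?R")
proof -
  have "?L \<longleftrightarrow> (\<exists>r\<in>set rules. eval e (by_rule a b i r))" by (simp add: eval_disjs)
  also have "\<dots> \<longleftrightarrow> (\<exists>(ps, c)\<in>set rules. \<exists>\<sigma>. bet (evt e a) (evt e b) (evt e i) (evt \<sigma> c) \<and>
      (\<forall>p\<in>set ps. entry (evt e a) (evt e b) (evt e i) (evt \<sigma> p)))"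
    by (rule bex_cong[OF refl]) (auto simp: eval_by_rule split: prod.splits)
  also have "\<dots> \<longleftrightarrow> ?R" unfolding step_def by fastforce
  finally show ?thesis .
qed

lemma derivation_mono: "derivation a b n ==> m \<preceq> n ==> derivation a b m"
  unfolding derivation_def using less_le_trans by blast

text \<open>\<open>Prov\<close> puts the judgement at index \<open>n\<close> and checks all entries
  up to \<open>n\<close>, a derivation of length \<open>suc n\<close>. Conversely, a derivation may
  be cut off right after the judgement.\<close>

lemma eval_Prov [simp]: "eval e (Prov t) \<longleftrightarrow> Der (pr (nm 4) (evt e t))"
proof -
  have "(\<lambda>i. (n ## b ## a ## e) (i + 3)) = e" for n b a by (simp add: numeral_eq_Suc)
  then have "eval e (Prov t) \<longleftrightarrow> (\<exists>a b n. bet a b n (pr (nm 4) (evt e t)) \<and> derivation a b (suc n))"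
    unfolding Prov_def eval.simps eval_beta_fm eval_by_rules by (simp add: evt_lifts derivation_def)
  also have "\<dots> \<longleftrightarrow> Der (pr (nm 4) (evt e t))"
    unfolding Der_def entry_def using derivation_mono lt_def
    by (metis le_refl lt_suc)
  finally show ?thesis .
qed

text \<open>\<open>step\<close> ranges over the list of rules in the metalanguage; its definability
  is read off the formulas \<open>by_rule\<close> by means of \<open>eval_by_rules\<close>.\<close>

lemma definable_derivation [dfn]:
  assumes "dfun f" "dfun g" "dfun h" shows "definable (\<lambda>e. derivation (f e) (g e) (h e))"
proof -
  have "definable (\<lambda>e. eval e (disjs (map (by_rule X0 X1 X2) rules)))"
    unfolding definable_def
  proof (intro exI allI)
    fix e :: "nat => 'a"
    show "eval e (disjs (map (by_rule X0 X1 X2) rules)) \<longleftrightarrow>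
      eval (mix e (\<lambda>_. zero)) (psub (\<lambda>i. Var (2 * i)) (disjs (map (by_rule X0 X1 X2) rules)))"
      unfolding eval_ren by (rule eval_cong) (simp add: mix_def)
  qed
  from definable_comp3[OF this[unfolded eval_by_rules evt.simps]]
  have "dfun f ==> dfun g ==> dfun h ==> definable (\<lambda>e. \<exists>y. bet (f e) (g e) (h e) y \<and> step (entry (f e) (g e) (h e)) y)" for f g h .
  note * = this
  show ?thesis
    unfolding derivation_def by (intro definable_all definable_imp definable_lt * dfun_var dfun_Suc assms)
qed

lemma definable_Der [dfn]: "dfun f ==> definable (\<lambda>e. Der (f e))"
  unfolding Der_def entry_def by (intro dfn dfun_Suc)

section \<open>Assembling coded derivations\<close>

lemma step_mono: "step P y ==> (!!p. P p ==> Q p) ==> step Q y"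
  unfolding step_def by fast

lemma derivation_encode:
  assumes F: "definable (\<lambda>e. F (e 0) (e 1))" and uniq: "!!i y y'. F i y ==> F i y' ==> y = y'"
    and ok: "!!i. i \<prec> n ==> \<exists>y. F i y \<and> step (\<lambda>p. \<exists>j. j \<prec> i \<and> F j p) y"
  shows "\<exists>a b. derivation a b n \<and> (\<forall>i y. i \<prec> n \<longrightarrow> F i y \<longrightarrow> bet a b i y)"
proof -
  obtain a b where ab: "!!i. i \<prec> n ==> \<exists>y. bet a b i y \<and> F i y"
    using beta_sequence[OF F, of n] ok by blast
  then have *: "bet a b i y" if "i \<prec> n" "F i y" for i y using that uniq by blast
  moreover have "derivation a b n"
    unfolding derivation_def
  proof (intro allI impI)
    fix i assume i: "i \<prec> n"
    then obtain y where y: "F i y" "step (\<lambda>p. \<exists>j. j \<prec> i \<and> F j p) y" using ok by blast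
    have "step (entry a b i) y"
      by (rule step_mono[OF y(2)]) (use i in \<open>auto simp: entry_def intro: * less_trans\<close>)
    with * i y(1) show "\<exists>y. bet a b i y \<and> step (entry a b i) y" by blast
  qed
  ultimately show ?thesis by blast
qed

text \<open>The continuation \<open>F'\<close> may cite entries of the given derivation. Taking a
  second derivation for \<open>F'\<close> gives concatenation; a constant sequence of length one
  appends a single judgement.\<close>

lemma derivation_extend:
  assumes "derivation a b n" and F': "definable (\<lambda>e. F' (e 0) (e 1))"
    and uniq': "!!j y y'. F' j y ==> F' j y' ==> y = y'"
    and ok': "!!j. j \<prec> m ==> \<exists>y. F' j y \<and> step (\<lambda>p. entry a b n p \<or> (\<exists>i. i \<prec> j \<and> F' i p)) y"
  shows "\<exists>A B k. derivation A B k \<and> (\<forall>p. entry a b n p \<or> (\<exists>j. j \<prec> m \<and> F' j p) \<longrightarrow> entry A B k p)"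
proof -
  define F where "F i y \<longleftrightarrow> i \<prec> n \<and> bet a b i y \<or> (\<exists>j. i = n \<oplus> j \<and> F' j y)" for i y
  have F: "definable (\<lambda>e. F (e 0) (e 1))" unfolding F_def by (intro dfn definable_comp2[OF F'])
  have nlt: "\<not> n \<oplus> j \<prec> n" for j by (simp add: not_less)
  have uniq: "F i y ==> F i y' ==> y = y'" for i y y'
    unfolding F_def using nlt bet_unique uniq' by (metis add_cancel)
  have add_lt: "n \<oplus> j \<prec> n \<oplus> k \<longleftrightarrow> j \<prec> k" for j k
  proof -
    have "suc (n \<oplus> j) \<oplus> w = n \<oplus> k \<longleftrightarrow> suc j \<oplus> w = k" for w
      using add_cancel[of n "suc j \<oplus> w" k] by (simp add: add_assoc del: add_cancel)
    then show ?thesis by (simp only: lt_def le_def)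
  qed
  have lt_add: "j \<prec> n ==> j \<prec> n \<oplus> k" for j k using less_le_trans le_add by blast
  have ok: "\<exists>y. F i y \<and> step (\<lambda>p. \<exists>j. j \<prec> i \<and> F j p) y" if i: "i \<prec> n \<oplus> m" for i
  proof (cases "i \<prec> n")
    case True
    then obtain y where y: "bet a b i y" "step (entry a b i) y" using assms(1) by (auto simp: derivation_def)
    have "step (\<lambda>p. \<exists>j. j \<prec> i \<and> F j p) y"
      by (rule step_mono[OF y(2)]) (use True in \<open>auto simp: entry_def F_def intro: less_trans\<close>)
    with y(1) True show ?thesis unfolding F_def by blast
  next
    case False
    then obtain j where j: "i = n \<oplus> j" unfolding not_less le_def by blast
    with i have "j \<prec> m" by (simp add: add_lt)
    then obtain y where y: "F' j y" "step (\<lambda>p. entry a b n p \<or> (\<exists>i. i \<prec> j \<and> F' i p)) y" using ok' by blast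
    have "step (\<lambda>p. \<exists>j. j \<prec> i \<and> F j p) y"
      by (rule step_mono[OF y(2)]) (use add_lt lt_add j in \<open>unfold entry_def F_def, blast\<close>)
    with y(1) j show ?thesis unfolding F_def by blast
  qed
  obtain A B where AB: "derivation A B (n \<oplus> m)" "!!i y. i \<prec> n \<oplus> m ==> F i y ==> bet A B i y"
    using derivation_encode[of F "n \<oplus> m", OF F] uniq ok by blast
  then have "entry A B (n \<oplus> m) p" if "entry a b n p \<or> (\<exists>j. j \<prec> m \<and> F' j p)" for p
    using that lt_add add_lt unfolding F_def entry_def by blast
  with AB(1) show ?thesis by blast
qed

lemma derivation_concat:
  assumes "derivation a b n" "derivation a' b' n'"
  shows "\<exists>A B k. derivation A B k \<and> (\<forall>p. entry a b n p \<or> entry a' b' n' p \<longrightarrow> entry A B k p)"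
proof -
  have "definable (\<lambda>e. bet a' b' (e 0) (e 1))" by (intro dfn)
  moreover have "\<exists>y. bet a' b' j y \<and> step (\<lambda>p. entry a b n p \<or> (\<exists>i. i \<prec> j \<and> bet a' b' i p)) y" if j: "j \<prec> n'" for j
  proof -
    obtain y where y: "bet a' b' j y" "step (entry a' b' j) y" using assms(2) j unfolding derivation_def by blast
    have "step (\<lambda>p. entry a b n p \<or> (\<exists>i. i \<prec> j \<and> bet a' b' i p)) y"
      by (rule step_mono[OF y(2)]) (simp add: entry_def)
    with y(1) show ?thesis by blast
  qed
  ultimately show ?thesis
    using derivation_extend[OF assms(1), of "bet a' b'" n'] bet_unique unfolding entry_def by blast
qed

lemma derivation_append:
  assumes "derivation a b n" "step (entry a b n) c"
  shows "\<exists>A B k. derivation A B k \<and> entry A B k c"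
proof -
  have "definable (\<lambda>e. e 1 = c)" by (intro dfn)
  moreover have "step (\<lambda>p. entry a b n p \<or> (\<exists>i. i \<prec> j \<and> p = c)) c" for j
    by (rule step_mono[OF assms(2)]) simp
  ultimately have "\<exists>A B k. derivation A B k \<and> (\<forall>p. entry a b n p \<or> (\<exists>j. j \<prec> suc zero \<and> p = c) \<longrightarrow> entry A B k p)"
    using derivation_extend[OF assms(1), of "\<lambda>j y. y = c" "suc zero"] by blast
  then show ?thesis by auto
qed

lemma derivation_list: "(!!p. p \<in> set ps ==> Der p) ==> \<exists>a b n. derivation a b n \<and> (\<forall>p\<in>set ps. entry a b n p)"
proof (induction ps)
  case Nil
  have "derivation zero zero zero" by (simp add: derivation_def)
  then show ?case by auto
next
  case (Cons p ps)
  obtain a b n a' b' n' where "derivation a b n" "\<forall>p\<in>set ps. entry a b n p" "derivation a' b' n'" "entry a' b' n' p"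
    using Cons unfolding Der_def by (metis list.set_intros)
  then show ?case using derivation_concat by (metis set_ConsD)
qed

text \<open>The possibly nonstandard derivations of the premises, finitely many in the metalanguage,
  are concatenated, and the conclusion is appended.\<close>

lemma Der_rule:
  assumes "(ps, c) \<in> set rules" "list_all (\<lambda>p. Der (evt \<sigma> p)) ps" shows "Der (evt \<sigma> c)"
proof -
  obtain a b n where "derivation a b n" "\<forall>p\<in>set (map (evt \<sigma>) ps). entry a b n p"
    using derivation_list[of "map (evt \<sigma>) ps"] assms(2) by (auto simp: list_all_iff)
  moreover from this have "step (entry a b n) (evt \<sigma> c)" unfolding step_def using assms(1) by fastforce
  ultimately show ?thesis unfolding Der_def using derivation_append by blast
qed

text \<open>Allows a rule to be named by its position. Its instances are given below by environments
  \<open>(!) [x0, x1, ...]\<close> that look up the values of the schematic variables.\<close>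

lemma Der_nth: "set rs \<subseteq> set rules ==> i < length rs ==>
    list_all (\<lambda>p. Der (evt \<sigma> p)) (fst (rs ! i)) ==> Der (evt \<sigma> (snd (rs ! i)))"
  by (rule Der_rule[of "fst (rs ! i)"]) auto

lemmas Der_syntax = Der_nth[of syntax_rules, unfolded rules_def set_append, OF Un_upper1]

lemmas Der_HA = Der_nth[of HA_rules, unfolded rules_def set_append Un_assoc[symmetric], OF Un_upper2]

section \<open>Closure under the individual rules\<close>

abbreviation "DTm x \<equiv> Der (pr (nm 0) x)"
abbreviation "DFm x \<equiv> Der (pr (nm 1) x)"
abbreviation "DLift c x y \<equiv> Der (pr (nm 2) (pr c (pr x y)))"
abbreviation "DSub d u x y \<equiv> Der (pr (nm 3) (pr d (pr u (pr x y))))"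
abbreviation "DPrv x \<equiv> Der (pr (nm 4) x)"

lemma DLift_Var1: "DLift (suc (x0 \<oplus> x1)) (pr (nm 0) x0) (pr (nm 0) x0)"
  using Der_rule[of "[]" "jLift (Succ (Add X0 X1)) (q1 0 X0) (q1 0 X0)" "(!) [x0, x1]"]
  by (simp add: rules_def lift_rules_def)

lemma DLift_Var2: "DLift x0 (pr (nm 0) (x0 \<oplus> x1)) (pr (nm 0) (suc (x0 \<oplus> x1)))"
  using Der_rule[of "[]" "jLift X0 (q1 0 (Add X0 X1)) (q1 0 (Succ (Add X0 X1)))" "(!) [x0, x1]"]
  by (simp add: rules_def lift_rules_def)

lemma DLift_Zero: "DLift x0 (pr (nm 1) zero) (pr (nm 1) zero)"
  using Der_rule[of "[]" "jLift X0 (q1 1 Zero) (q1 1 Zero)" "(!) [x0]"]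
  by (simp add: rules_def lift_rules_def)

lemma DLift_Bot: "DLift x0 (pr (nm 6) zero) (pr (nm 6) zero)"
  using Der_rule[of "[]" "jLift X0 (q1 6 Zero) (q1 6 Zero)" "(!) [x0]"]
  by (simp add: rules_def lift_rules_def)

lemma DLift_Succ: "DLift x0 x1 x2 ==> DLift x0 (pr (nm 2) x1) (pr (nm 2) x2)"
  using Der_rule[of "[jLift X0 X1 X2]" "jLift X0 (q1 2 X1) (q1 2 X2)" "(!) [x0, x1, x2]"]
  by (simp add: rules_def lift_rules_def)

lemma DLift_binary: "k \<in> {3, 4, 5, 7, 8, 9} ==> DLift x0 x1 x2 ==> DLift x0 x3 x4 ==> DLift x0 (pr (nm k) (pr x1 x3)) (pr (nm k) (pr x2 x4))"
  using Der_rule[of "[jLift X0 X1 X2, jLift X0 X3 X4]" "jLift X0 (q2 k X1 X3) (q2 k X2 X4)" "(!) [x0, x1, x2, x3, x4]"]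
  by (auto simp: rules_def lift_rules_def)

lemma DLift_quant: "k \<in> {10, 11} ==> DLift (suc x0) x1 x2 ==> DLift x0 (pr (nm k) x1) (pr (nm k) x2)"
  using Der_rule[of "[jLift (Succ X0) X1 X2]" "jLift X0 (q1 k X1) (q1 k X2)" "(!) [x0, x1, x2]"]
  by (auto simp: rules_def lift_rules_def)

lemma DSub_Var1: "DSub (suc (x0 \<oplus> x1)) x2 (pr (nm 0) x0) (pr (nm 0) x0)"
  using Der_rule[of "[]" "jSub (Succ (Add X0 X1)) X2 (q1 0 X0) (q1 0 X0)" "(!) [x0, x1, x2]"]
  by (simp add: rules_def sub_rules_def)

lemma DSub_Var2: "DSub x0 x2 (pr (nm 0) x0) x2"
  using Der_rule[of "[]" "jSub X0 X2 (q1 0 X0) X2" "(!) [x0, zero, x2]"]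
  by (simp add: rules_def sub_rules_def)

lemma DSub_Var3: "DSub x0 x2 (pr (nm 0) (suc (x0 \<oplus> x1))) (pr (nm 0) (x0 \<oplus> x1))"
  using Der_rule[of "[]" "jSub X0 X2 (q1 0 (Succ (Add X0 X1))) (q1 0 (Add X0 X1))" "(!) [x0, x1, x2]"]
  by (simp add: rules_def sub_rules_def)

lemma DSub_Zero: "DSub x0 x1 (pr (nm 1) zero) (pr (nm 1) zero)"
  using Der_rule[of "[]" "jSub X0 X1 (q1 1 Zero) (q1 1 Zero)" "(!) [x0, x1]"]
  by (simp add: rules_def sub_rules_def)

lemma DSub_Bot: "DSub x0 x1 (pr (nm 6) zero) (pr (nm 6) zero)"
  using Der_rule[of "[]" "jSub X0 X1 (q1 6 Zero) (q1 6 Zero)" "(!) [x0, x1]"]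
  by (simp add: rules_def sub_rules_def)

lemma DSub_Succ: "DSub x0 x1 x2 x3 ==> DSub x0 x1 (pr (nm 2) x2) (pr (nm 2) x3)"
  using Der_rule[of "[jSub X0 X1 X2 X3]" "jSub X0 X1 (q1 2 X2) (q1 2 X3)" "(!) [x0, x1, x2, x3]"]
  by (simp add: rules_def sub_rules_def)

lemma DSub_binary: "k \<in> {3, 4, 5, 7, 8, 9} ==> DSub x0 x1 x2 x3 ==> DSub x0 x1 x4 x5 ==> DSub x0 x1 (pr (nm k) (pr x2 x4)) (pr (nm k) (pr x3 x5))"
  using Der_rule[of "[jSub X0 X1 X2 X3, jSub X0 X1 X4 X5]" "jSub X0 X1 (q2 k X2 X4) (q2 k X3 X5)" "(!) [x0, x1, x2, x3, x4, x5]"]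
  by (auto simp: rules_def sub_rules_def)

lemma DSub_quant: "k \<in> {10, 11} ==> DLift zero x1 x4 ==> DSub (suc x0) x4 x2 x3 ==> DSub x0 x1 (pr (nm k) x2) (pr (nm k) x3)"
  using Der_rule[of "[jLift Zero X1 X4, jSub (Succ X0) X4 X2 X3]" "jSub X0 X1 (q1 k X2) (q1 k X3)" "(!) [x0, x1, x2, x3, x4]"]
  by (auto simp: rules_def sub_rules_def)

lemma DPrv_all: "DFm x0 ==> DTm x1 ==> DSub zero x1 x0 x2 ==> DPrv (pr (nm 9) (pr (pr (nm 10) x0) x2))"
  using Der_HA[of 9 "(!) [x0, x1, x2]"] by (simp add: HA_rules_def)

lemma DPrv_ex: "DFm x0 ==> DTm x1 ==> DSub zero x1 x0 x2 ==> DPrv (pr (nm 9) (pr x2 (pr (nm 11) x0)))"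
  using Der_HA[of 10 "(!) [x0, x1, x2]"] by (simp add: HA_rules_def)

lemma DPrv_eq_subst: "DTm x0 ==> DTm x1 ==> DFm x2 ==> DSub zero x0 x2 x3 ==> DSub zero x1 x2 x4 ==> DPrv (pr (nm 9) (pr (pr (nm 5) (pr x0 x1)) (pr (nm 9) (pr x3 x4))))"
  using Der_HA[of 12 "(!) [x0, x1, x2, x3, x4]"] by (simp add: HA_rules_def)

lemma DPrv_ind: "DFm x0 ==> DSub zero (pr (nm 1) zero) x0 x1 ==> DLift (nm 1) x0 x2 ==> DSub zero (pr (nm 2) (pr (nm 0) zero)) x2 x3 ==> DPrv (pr (nm 9) (pr x1 (pr (nm 9) (pr (pr (nm 10) (pr (nm 9) (pr x0 x3))) (pr (nm 10) x0)))))"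
  using Der_HA[of 19 "(!) [x0, x1, x2, x3]"] by (simp add: HA_rules_def)

lemma DPrv_mp: "DPrv (pr (nm 9) (pr x0 x1)) ==> DPrv x0 ==> DPrv x1"
  using Der_HA[of 20 "(!) [x0, x1]"] by (simp add: HA_rules_def)

lemma DPrv_allI: "DFm x0 ==> DLift zero x0 x1 ==> DPrv (pr (nm 9) (pr x1 x2)) ==> DPrv (pr (nm 9) (pr x0 (pr (nm 10) x2)))"
  using Der_HA[of 21 "(!) [x0, x1, x2]"] by (simp add: HA_rules_def)

lemma DPrv_exE: "DFm x1 ==> DLift zero x1 x2 ==> DPrv (pr (nm 9) (pr x0 x2)) ==> DPrv (pr (nm 9) (pr (pr (nm 11) x0) x1))"
  using Der_HA[of 22 "(!) [x0, x1, x2]"] by (simp add: HA_rules_def)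

lemmas syntax_instances =
  Der_syntax[of 0 "(!) [x0]" for x0] Der_syntax[of 1 "(!) []"]
  Der_syntax[of 2 "(!) [x0]" for x0] Der_syntax[of 3 "(!) [x0, x1]" for x0 x1]
  Der_syntax[of 4 "(!) [x0, x1]" for x0 x1] Der_syntax[of 5 "(!) [x0, x1]" for x0 x1]
  Der_syntax[of 6 "(!) []"] Der_syntax[of 7 "(!) [x0, x1]" for x0 x1]
  Der_syntax[of 8 "(!) [x0, x1]" for x0 x1] Der_syntax[of 9 "(!) [x0, x1]" for x0 x1]
  Der_syntax[of 10 "(!) [x0]" for x0] Der_syntax[of 11 "(!) [x0]" for x0]

lemmas syntax_intros = syntax_instances[unfolded syntax_rules_def, simplified]

lemmas axiom_instances =
  Der_HA[of 0 "(!) [x0, x1]" for x0 x1] Der_HA[of 1 "(!) [x0, x1, x2]" for x0 x1 x2]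
  Der_HA[of 2 "(!) [x0, x1]" for x0 x1] Der_HA[of 3 "(!) [x0, x1]" for x0 x1]
  Der_HA[of 4 "(!) [x0, x1]" for x0 x1] Der_HA[of 5 "(!) [x0, x1]" for x0 x1]
  Der_HA[of 6 "(!) [x0, x1]" for x0 x1] Der_HA[of 7 "(!) [x0, x1, x2]" for x0 x1 x2]
  Der_HA[of 8 "(!) [x0]" for x0] Der_HA[of 11 "(!) [x0]" for x0]
  Der_HA[of 13 "(!) [x0]" for x0] Der_HA[of 14 "(!) [x0, x1]" for x0 x1]
  Der_HA[of 15 "(!) [x0]" for x0] Der_HA[of 16 "(!) [x0, x1]" for x0 x1]
  Der_HA[of 17 "(!) [x0]" for x0] Der_HA[of 18 "(!) [x0, x1]" for x0 x1]

lemmas axiom_intros = axiom_instances[unfolded HA_rules_def, simplified]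


section \<open>Judgements about standard formulas, and necessitation\<close>

lemma DTm_code: "DTm (nm (code_tm t))"
  by (induction t) (simp_all add: nm_pair syntax_intros)

lemma DFm_code: "DFm (nm (code A))"
  by (induction A) (simp_all add: nm_pair DTm_code[simplified] syntax_intros)

lemma DLift_code_tm: "DLift (nm c) (nm (code_tm t)) (nm (code_tm (lift_tm c t)))"
proof (induction t)
  case (Var i)
  show ?case
  proof (cases "i < c")
    case True
    then obtain k where "c = Suc (i + k)" using less_imp_Suc_add by blast
    then show ?thesis using DLift_Var1[of "nm i" "nm k"] by (simp add: nm_pair nm_add)
  next
    case False
    then obtain k where "i = c + k" using le_Suc_ex[of c i] by auto
    then show ?thesis using DLift_Var2[of "nm c" "nm k"] by (simp add: nm_pair nm_add)
  qed
qed (simp_all add: nm_pair DLift_Zero[simplified] DLift_Succ[simplified] DLift_binary)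

lemma DLift_code: "DLift (nm c) (nm (code A)) (nm (code (lift c A)))"
proof (induction A arbitrary: c)
  case (Forall A)
  then show ?case using DLift_quant[of 10] Forall[of "Suc c"] by (simp add: nm_pair)
next
  case (Exists A)
  then show ?case using DLift_quant[of 11] Exists[of "Suc c"] by (simp add: nm_pair)
qed (simp_all add: nm_pair DLift_code_tm DLift_Bot[simplified] DLift_binary)

lemma DSub_code_tm: "DSub (nm d) (nm (code_tm u)) (nm (code_tm t)) (nm (code_tm (sub_tm d u t)))"
proof (induction t)
  case (Var i)
  consider "i < d" | "i = d" | "d < i" by linarith
  then show ?case
  proof cases
    case 1
    then obtain k where "d = Suc (i + k)" using less_imp_Suc_add by blast
    then show ?thesis using DSub_Var1[of "nm i" "nm k"] by (simp add: nm_pair nm_add)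
  next
    case 2
    then show ?thesis using DSub_Var2[of "nm d"] by (simp add: nm_pair)
  next
    case 3
    then obtain k where "i = Suc (d + k)" using less_imp_Suc_add by blast
    then show ?thesis using DSub_Var3[of "nm d" _ "nm k"] by (simp add: nm_pair nm_add)
  qed
qed (simp_all add: nm_pair DSub_Zero[simplified] DSub_Succ[simplified] DSub_binary)

lemma DSub_code: "DSub (nm d) (nm (code_tm u)) (nm (code A)) (nm (code (sub d u A)))"
proof (induction A arbitrary: d u)
  case (Forall A)
  then show ?case using DSub_quant[of 10, OF _ _ Forall[of "Suc d" "lift_tm 0 u", unfolded nm.simps]] DLift_code_tm[of 0 u] by (simp add: nm_pair)
next
  case (Exists A)
  then show ?case using DSub_quant[of 11, OF _ _ Exists[of "Suc d" "lift_tm 0 u", unfolded nm.simps]] DLift_code_tm[of 0 u] by (simp add: nm_pair)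
qed (simp_all add: nm_pair DSub_code_tm DSub_Bot[simplified] DSub_binary)

lemma DSub_code_0: "DSub zero (nm (code_tm u)) (nm (code A)) (nm (code (sub 0 u A)))"
  using DSub_code[of 0] by simp

lemma DLift_code_0: "DLift zero (nm (code A)) (nm (code (lift 0 A)))"
  using DLift_code[of 0] by simp

text \<open>A derivation in \<open>HA\<close> is repeated rule by rule inside the model;
  \<open>DLift_code\<close> and \<open>DSub_code\<close> supply the premises about lifting and
  substitution.\<close>

theorem necessitation: "HA \<turnstile> A ==> DPrv (nm (code A))"
proof (induction rule: HA.induct)
  case (ha_all A t)
  show ?case using DPrv_all[OF DFm_code DTm_code DSub_code_0] by (simp add: nm_pair)
next
  case (ha_ex t A)
  show ?case using DPrv_ex[OF DFm_code DTm_code DSub_code_0] by (simp add: nm_pair)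
next
  case (ha_eq_subst s t A)
  show ?case using DPrv_eq_subst[OF DTm_code DTm_code DFm_code DSub_code_0 DSub_code_0] by (simp add: nm_pair)
next
  case (ha_ind A)
  have "DSub zero (pr (nm 1) zero) (nm (code A)) (nm (code (sub 0 Zero A)))"
    using DSub_code_0[of Zero] by (simp add: nm_pair)
  moreover have "DSub zero (pr (nm 2) (pr (nm 0) zero)) (nm (code (lift 1 A))) (nm (code (sub 0 (Succ X0) (lift 1 A))))"
    using DSub_code_0[of "Succ X0"] by (simp add: nm_pair)
  ultimately show ?case using DPrv_ind[OF DFm_code _ DLift_code] by (simp add: nm_pair)
next
  case (ha_mp A B)
  then show ?case using DPrv_mp by (simp add: nm_pair)
next
  case (ha_allI A B)
  then show ?case using DPrv_allI[OF DFm_code DLift_code_0] by (simp add: nm_pair)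
next
  case (ha_exE A B)
  then show ?case using DPrv_exE[OF DFm_code DLift_code_0] by (simp add: nm_pair)
qed (simp_all add: nm_pair DTm_code[simplified] DFm_code[simplified] axiom_intros)

end


section \<open>Provable Sigma completeness\<close>

lemma completeness_valid:
  assumes "neg A" "!!zero suc add mul e. pa (zero :: nat) suc add mul ==> arith.eval zero suc add mul e A"
  shows "HA \<turnstile> A"
  by (rule completeness) (use assms in \<open>auto simp: valid_def\<close>)

text \<open>One step of an induction inside the model, prepared as a theorem of HA; its variables
  will be replaced by numerals of arbitrary elements. As the implication is negative, checking it in
  models suffices.\<close>

lemma HA_add_step: "HA \<turnstile> Imp (Eq (Add X0 X1) X2) (Eq (Add X0 (Succ X1)) (Succ X2))"
proof (rule completeness_valid)
  fix zero :: nat and suc add mul e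
  assume "pa zero suc add mul"
  then interpret pa zero suc add mul .
  show "eval e (Imp (Eq (Add X0 X1) X2) (Eq (Add X0 (Succ X1)) (Succ X2)))" by simp
qed simp

lemma HA_mul_step: "HA \<turnstile> Imp (Eq (Mul X0 X1) X2) (Imp (Eq (Add X2 X0) X3) (Eq (Mul X0 (Succ X1)) X3))"
proof (rule completeness_valid)
  fix zero :: nat and suc add mul e
  assume "pa zero suc add mul"
  then interpret pa zero suc add mul .
  show "eval e (Imp (Eq (Mul X0 X1) X2) (Imp (Eq (Add X2 X0) X3) (Eq (Mul X0 (Succ X1)) X3)))"
    by (simp add: mul_suc)
qed simp

lemma HA_Succ_cong: "HA \<turnstile> Imp (Eq s t) (Eq (Succ s) (Succ t))"
  by (rule HA_nd) (rule nd_impI, rule nd_Succ, rule nd_0)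

lemma HA_Add_cong: "HA \<turnstile> Imp (Eq s t) (Imp (Eq s' t') (Imp (Eq (Add t t') u) (Eq (Add s s') u)))"
  by (rule HA_nd) (rule nd_impI, rule nd_impI, rule nd_impI, rule nd_trans[OF nd_Add nd_0], simp_all add: nd_assm)

lemma HA_Mul_cong: "HA \<turnstile> Imp (Eq s t) (Imp (Eq s' t') (Imp (Eq (Mul t t') u) (Eq (Mul s s') u)))"
  by (rule HA_nd) (rule nd_impI, rule nd_impI, rule nd_impI, rule nd_trans[OF nd_Mul nd_0], simp_all add: nd_assm)

lemma HA_Eq_join: "HA \<turnstile> Imp (Eq s u) (Imp (Eq t u) (Eq s t))"
  by (rule HA_nd) (rule nd_impI, rule nd_impI, rule nd_trans[OF nd_1 nd_sym[OF nd_0]])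

lemma HA_ball_0: "HA \<turnstile> Imp (sub 0 Zero A) (Forall (Imp (le_fm X0 Zero) A))"
  by (rule HA_nd) (rule nd_impI, rule nd_ball_0, rule nd_0)

lemma HA_ball_Succ: "HA \<turnstile> Imp (Forall (Imp (le_fm X0 (lift_tm 0 t)) A))
    (Imp (sub 0 (Succ t) A) (Forall (Imp (le_fm X0 (lift_tm 0 (Succ t))) A)))"
  using nd_ball_Succ[OF nd_1 nd_0] by (intro HA_nd nd_impI) simp

context pa
begin

text \<open>The condition at \<open>i = x\<close> also fixes entry \<open>suc x\<close>, one more
  than will be read. In return the quantifier is bounded by \<open>\<le>\<close>, as
  \<open>sigma\<close> demands of the formula \<open>nu_fm\<close>.\<close>

definition numseq :: "'a => 'a => 'a => bool" where
  "numseq a b x \<longleftrightarrow> bet a b zero (pr (nm 1) zero) \<and>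
    (\<forall>i. i \<preceq> x \<longrightarrow> (\<exists>u. bet a b i u \<and> bet a b (suc i) (pr (nm 2) u)))"

lemma definable_numseq [dfn]: "dfun f ==> dfun g ==> dfun h ==> definable (\<lambda>e. numseq (f e) (g e) (h e))"
  unfolding numseq_def by (intro dfn dfun_Suc)

lemma numseq_mono: "numseq a b x ==> y \<preceq> x ==> numseq a b y"
  unfolding numseq_def using le_trans by blast

lemma numseq_unique:
  assumes "numseq a b x" "numseq a' b' x"
  shows "i \<preceq> suc x \<longrightarrow> (\<forall>u. bet a b i u \<longrightarrow> bet a' b' i u)"
proof (induct i rule: pa_induct)
  case zero
  then show ?case using assms bet_unique unfolding numseq_def by blast
next
  case (suc i)
  show ?case
  proof (intro impI allI)
    fix v assume v: "suc i \<preceq> suc x" "bet a b (suc i) v"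
    then have i: "i \<preceq> x" "i \<preceq> suc x" by (auto intro: le_trans[OF _ le_suc_self])
    then obtain u u' where u: "bet a b i u" "bet a b (suc i) (pr (nm 2) u)" "bet a' b' i u'" "bet a' b' (suc i) (pr (nm 2) u')"
      using assms unfolding numseq_def by blast
    then have "u' = u" using suc i bet_unique by blast
    with u v show "bet a' b' (suc i) v" using bet_unique by blast
  qed
qed (intro dfn)

lemma numseq_ex: "\<exists>a b. numseq a b x"
proof (induct x rule: pa_induct)
  case zero
  define F where "F i y \<longleftrightarrow> i = zero \<and> y = pr (nm 1) zero \<or> i = suc zero \<and> y = pr (nm 2) (pr (nm 1) zero)" for i y
  have F: "definable (\<lambda>e. F (e 0) (e 1))" unfolding F_def by (intro dfn)
  have "\<exists>y. F i y" if "i \<prec> suc (suc zero)" for i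
    using that unfolding F_def by (auto simp: le_lt)
  from beta_sequence[OF F this] obtain a b where
    "!!i. i \<prec> suc (suc zero) ==> \<exists>y. bet a b i y \<and> F i y" by blast
  from this[of zero] this[of "suc zero"] have "numseq a b zero" by (auto simp: F_def numseq_def)
  then show ?case by blast
next
  case (suc x)
  then obtain a b where ab: "numseq a b x" by blast
  define F where "F i y \<longleftrightarrow> i \<preceq> suc x \<and> bet a b i y \<or> i = suc (suc x) \<and> (\<exists>u. bet a b (suc x) u \<and> y = pr (nm 2) u)" for i y
  have F: "definable (\<lambda>e. F (e 0) (e 1))" unfolding F_def by (intro dfn)
  have ex: "\<exists>y. bet a b i y" if "i \<preceq> suc x" for i
    using that ab exhaust[of i] unfolding numseq_def by (metis le_suc_suc)
  have "\<exists>y. F i y" if "i \<prec> suc (suc (suc x))" for i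
    using that ex[of i] ex[of "suc x"] unfolding F_def by (auto simp: le_lt)
  from beta_sequence[OF F this] obtain A B where
    AB: "!!i. i \<prec> suc (suc (suc x)) ==> \<exists>y. bet A B i y \<and> F i y" by blast
  have nle: "\<not> suc (suc x) \<preceq> suc x" by (simp add: not_le)
  have *: "bet A B i y" if "i \<preceq> suc x" "bet a b i y" for i y
  proof -
    have "i \<prec> suc (suc (suc x))" using that(1) by (auto intro: le_trans[OF _ le_suc_self])
    then obtain y' where "bet A B i y'" "F i y'" using AB by blast
    with that nle show ?thesis unfolding F_def using bet_unique by blast
  qed
  have "numseq A B (suc x)"
    unfolding numseq_def
  proof (intro conjI allI impI)
    show "bet A B zero (pr (nm 1) zero)" using ab * unfolding numseq_def by simp
    fix i assume "i \<preceq> suc x"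
    then consider "i \<preceq> x" | "i = suc x" using le_lt[of i "suc x"] by auto
    then show "\<exists>u. bet A B i u \<and> bet A B (suc i) (pr (nm 2) u)"
    proof cases
      case 1
      moreover from 1 obtain u where "bet a b i u" "bet a b (suc i) (pr (nm 2) u)"
        using ab unfolding numseq_def by blast
      moreover have "i \<preceq> suc x" by fact
      ultimately show ?thesis using *[of i u] *[of "suc i" "pr (nm 2) u"] by auto
    next
      case 2
      obtain y where y: "bet A B (suc (suc x)) y" "F (suc (suc x)) y" using AB[of "suc (suc x)"] by auto
      then obtain u where "bet a b (suc x) u" "y = pr (nm 2) u" using nle unfolding F_def by blast
      with y 2 * show ?thesis by auto
    qed
  qed
  then show ?case by blast
qed (intro dfn)

definition Nu :: "'a => 'a => bool" where
  "Nu x y \<longleftrightarrow> (\<exists>a b. numseq a b x \<and> bet a b x y)"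

lemma Nu_unique: "Nu x y ==> Nu x y' ==> y = y'"
  unfolding Nu_def using numseq_unique bet_unique le_suc_self by blast

lemma Nu_zero: "Nu zero (pr (nm 1) zero)"
  using numseq_ex[of zero] unfolding Nu_def numseq_def by blast

lemma Nu_suc: "Nu x y ==> Nu (suc x) (pr (nm 2) y)"
proof -
  assume y: "Nu x y"
  obtain a b where ab: "numseq a b (suc x)" using numseq_ex by blast
  then obtain u where u: "bet a b x u" "bet a b (suc x) (pr (nm 2) u)" using le_suc_self unfolding numseq_def by blast
  then have "Nu x u" using numseq_mono[OF ab le_suc_self] unfolding Nu_def by blast
  then show ?thesis using u ab y Nu_unique unfolding Nu_def by blast
qed

lemma Nu_ex: "\<exists>y. Nu x y"
proof (induct x rule: pa_induct)
  case definable
  show ?case unfolding Nu_def by (intro dfn)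
qed (use Nu_zero Nu_suc in blast)+

text \<open>The code of the numeral of \<open>x\<close>, for nonstandard \<open>x\<close> as well;
  by \<open>nu_nm\<close> it is the actual code on standard elements.\<close>

definition nu :: "'a => 'a" where "nu x = (THE y. Nu x y)"

lemma Nu_nu: "Nu x y \<longleftrightarrow> y = nu x"
  unfolding nu_def using Nu_ex[of x] Nu_unique by (metis the_equality)

lemma nu_zero [simp]: "nu zero = pr (nm 1) zero" and nu_suc [simp]: "nu (suc x) = pr (nm 2) (nu x)"
  using Nu_zero Nu_suc[of x "nu x"] by (simp_all add: Nu_nu)

lemma dfun_nu [dfn]: assumes "dfun f" shows "dfun (\<lambda>e. nu (f e))"
proof (rule dfun_comp1[OF _ assms])
  show "definable (\<lambda>e. e 0 = nu (e 1))" unfolding Nu_nu[symmetric] Nu_def by (intro dfn)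
qed

lemma nu_nm: "nu (nm n) = nm (code_tm (num n))"
  by (induction n) (simp_all add: nm_pair)

lemma DTm_nu: "DTm (nu x)"
  by (induct x rule: pa_induct) (intro dfn, simp_all add: syntax_intros)

lemma DLift_nu: "DLift c (nu x) (nu x)"
  by (induct x rule: pa_induct) (intro dfn, simp_all add: DLift_Zero[simplified] DLift_Succ[simplified])

lemma DSub_nu: "DSub d u (nu x) (nu x)"
  by (induct x rule: pa_induct) (intro dfn, simp_all add: DSub_Zero[simplified] DSub_Succ[simplified])

text \<open>\<open>mcf k e A\<close> is the code of the formula obtained from \<open>A\<close> by leaving the variables below
  \<open>k\<close> alone and replacing variable \<open>k + i\<close> by the (possibly nonstandard) numeral of \<open>e i\<close>.\<close>

primrec mct :: "nat => (nat => 'a) => tm => 'a" where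
  "mct k e (Var i) = (if i < k then pr zero (nm i) else nu (e (i - k)))"
| "mct k e Zero = pr (nm 1) zero"
| "mct k e (Succ t) = pr (nm 2) (mct k e t)"
| "mct k e (Add s t) = pr (nm 3) (pr (mct k e s) (mct k e t))"
| "mct k e (Mul s t) = pr (nm 4) (pr (mct k e s) (mct k e t))"

primrec mcf :: "nat => (nat => 'a) => fm => 'a" where
  "mcf k e (Eq s t) = pr (nm 5) (pr (mct k e s) (mct k e t))"
| "mcf k e Bot = pr (nm 6) zero"
| "mcf k e (Conj A B) = pr (nm 7) (pr (mcf k e A) (mcf k e B))"
| "mcf k e (Disj A B) = pr (nm 8) (pr (mcf k e A) (mcf k e B))"
| "mcf k e (Imp A B) = pr (nm 9) (pr (mcf k e A) (mcf k e B))"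
| "mcf k e (Forall A) = pr (nm 10) (mcf (Suc k) e A)"
| "mcf k e (Exists A) = pr (nm 11) (mcf (Suc k) e A)"

lemma mct_closed: "vars_below_tm k t ==> mct k e t = nm (code_tm t)"
  by (induction t) (auto simp: nm_pair)

lemma mcf_closed: "vars_below k A ==> mcf k e A = nm (code A)"
  by (induction A arbitrary: k) (auto simp: nm_pair mct_closed)

lemma DTm_mct: "DTm (mct k e t)"
  by (induction t) (simp_all add: DTm_nu[simplified] syntax_intros)

lemma DFm_mcf: "DFm (mcf k e A)"
  by (induction A arbitrary: k) (simp_all add: DTm_mct[simplified] syntax_intros)

lemma DSub_mct: "DSub (nm k) (nu x) (mct (Suc k) e t) (mct k (x ## e) t)"
proof (induction t)
  case (Var i)
  consider "i < k" | "i = k" | "k < i" by linarith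
  then show ?case
  proof cases
    case 1
    then obtain j where "k = Suc (i + j)" using less_imp_Suc_add by blast
    then show ?thesis using DSub_Var1[of "nm i" "nm j"] by (simp add: nm_add)
  next
    case 2
    then show ?thesis using DSub_Var2[of "nm k" "nu x"] by simp
  next
    case 3
    then obtain j where "i = Suc (k + j)" using less_imp_Suc_add by blast
    then show ?thesis using DSub_nu by (simp add: Suc_diff_le)
  qed
qed (simp_all add: DSub_Zero[simplified] DSub_Succ[simplified] DSub_binary)

lemma DSub_mcf: "DSub (nm k) (nu x) (mcf (Suc k) e A) (mcf k (x ## e) A)"
proof (induction A arbitrary: k)
  case (Forall A)
  then show ?case using DSub_quant[of 10, OF _ DLift_nu Forall[of "Suc k", unfolded nm.simps]] by simp
next
  case (Exists A)
  then show ?case using DSub_quant[of 11, OF _ DLift_nu Exists[of "Suc k", unfolded nm.simps]] by simp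
qed (simp_all add: DSub_mct DSub_Bot[simplified] DSub_binary)

lemma up_pow: "(up ^^ k) \<sigma> i = (if i < k then Var i else psub_tm (\<lambda>j. Var (j + k)) (\<sigma> (i - k)))"
proof (induction k arbitrary: i)
  case (Suc k)
  show ?case
    by (cases i) (simp_all add: Suc lift_tm_psub psub_tm_comp)
qed simp

lemma mct_shift: "mct k e (psub_tm (\<lambda>j. Var (j + k)) t) = mct 0 e t"
  by (induction t) auto

lemma mct_psub: "(!!i. mct 0 e (\<sigma> i) = nu (e' i)) ==> mct k e (psub_tm ((up ^^ k) \<sigma>) t) = mct k e' t"
  by (induction t) (simp_all add: up_pow mct_shift)

text \<open>The hypothesis says that each \<open>\<sigma> i\<close> itself becomes a numeral: this
  covers variables, \<open>Zero\<close> and successors of these. A sum becomes a term that is merely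
  provably equal to a numeral, whence \<open>prv_evt\<close>.\<close>

lemma mcf_psub: "(!!i. mct 0 e (\<sigma> i) = nu (e' i)) ==> mcf k e (psub ((up ^^ k) \<sigma>) A) = mcf k e' A"
proof (induction A arbitrary: k)
  case (Forall A)
  then show ?case using Forall.IH[of "Suc k"] by simp
next
  case (Exists A)
  then show ?case using Exists.IH[of "Suc k"] by simp
qed (simp_all add: mct_psub)

lemma mct_lift [simp]: "mct 0 (x ## e) (lift_tm 0 t) = mct 0 e t"
  using mct_psub[of "x ## e" "\<lambda>i. Var (Suc i)" e 0 t] by (simp add: lift_tm_psub)

lemma mcf_lift [simp]: "mcf 0 (x ## e) (lift 0 A) = mcf 0 e A"
  using mcf_psub[of "x ## e" "\<lambda>i. Var (Suc i)" e 0 A] by (simp add: lift_psub)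

lemma mcf_lift_1 [simp]: "mcf (Suc 0) (x ## e) (lift (Suc 0) A) = mcf (Suc 0) e A"
proof -
  have "lift (Suc 0) A = psub (up (\<lambda>i. Var (Suc i))) A"
    unfolding lift_psub by (rule psub_eqI) (auto simp: up_def split: nat.split)
  then show ?thesis using mcf_psub[of "x ## e" "\<lambda>i. Var (Suc i)" e 1 A] by simp
qed

lemma mcf_sub_Zero: "mcf 0 e (sub 0 Zero A) = mcf 0 (zero ## e) A"
  unfolding sub_psub
  using mcf_psub[of e "\<lambda>i. if i = 0 then Zero else Var (i - 1)" "zero ## e" 0 A]
  by (auto simp: push_def split: nat.split)

lemma mcf_sub_Succ: "mcf 0 (x ## e) (sub 0 (Succ X0) (lift (Suc 0) A)) = mcf 0 (suc x ## e) A"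
proof -
  have "sub 0 (Succ X0) (lift (Suc 0) A) = psub (\<lambda>i. if i = 0 then Succ X0 else Var i) A"
    unfolding sub_psub lift_psub psub_comp by (rule psub_eqI) auto
  then show ?thesis
    using mcf_psub[of "x ## e" "\<lambda>i. if i = 0 then Succ X0 else Var i" "suc x ## e" 0 A]
    by (auto simp: push_def split: nat.split)
qed

section \<open>Provability of true Sigma formulas\<close>

abbreviation prv :: "(nat => 'a) => fm => bool" where "prv e A \<equiv> DPrv (mcf 0 e A)"

lemma prv_mp: "prv e (Imp A B) ==> prv e A ==> prv e B"
  using DPrv_mp by simp

text \<open>The theorem is closed by universal quantifiers, internalized by
  \<open>necessitation\<close>, and then instantiated with numerals one variable at a time.\<close>

lemma prv_HA: assumes "HA \<turnstile> A" shows "prv e A"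
proof -
  have "vars_below n A ==> HA \<turnstile> A ==> prv e A" for n
  proof (induction n arbitrary: A e)
    case 0
    then show ?case using necessitation by (simp add: mcf_closed)
  next
    case (Suc n)
    let ?e = "\<lambda>i. e (Suc i)"
    have "prv ?e (Forall A)" using Suc.IH[of "Forall A" ?e] Suc.prems HA_gen by simp
    moreover have "DPrv (pr (nm 9) (pr (pr (nm 10) (mcf 1 ?e A)) (mcf 0 (e 0 ## ?e) A)))"
      using DPrv_all[OF DFm_mcf DTm_nu DSub_mcf[of 0, unfolded nm.simps]] by simp
    moreover have "e 0 ## ?e = e" by (rule ext) (auto simp: push_def split: nat.split)
    ultimately show ?case using DPrv_mp by simp
  qed
  then show ?thesis using assms vars_below_ex by blast
qed

lemma prv_add: "prv (x ## y ## (x \<oplus> y) ## e) (Eq (Add X0 X1) X2)"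
proof (induct y rule: pa_induct)
  case definable
  show ?case by (simp, intro dfn)
next
  case zero
  have "prv (x ## e) (Eq (Add X0 Zero) X0)" by (rule prv_HA[OF ha_add0])
  then show ?case by simp
next
  case (suc y)
  from prv_mp[OF prv_HA[OF HA_add_step] this] show ?case by simp
qed

lemma prv_mul: "prv (x ## y ## (x \<otimes> y) ## e) (Eq (Mul X0 X1) X2)"
proof (induct y rule: pa_induct)
  case definable
  show ?case by (simp, intro dfn)
next
  case zero
  have "prv (x ## e) (Eq (Mul X0 Zero) Zero)" by (rule prv_HA[OF ha_mul0])
  then show ?case by simp
next
  case (suc y)
  let ?e = "x ## y ## (x \<otimes> y) ## (x \<otimes> y \<oplus> x) ## e"
  have "prv ?e (Eq (Mul X0 X1) X2)" using suc by simp
  moreover have "prv ?e (Eq (Add X2 X0) X3)" using prv_add[of "x \<otimes> y" x] by simp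
  ultimately have "prv ?e (Eq (Mul X0 (Succ X1)) X3)" using prv_HA[OF HA_mul_step] prv_mp by blast
  then show ?case by (simp add: mul_suc)
qed

text \<open>A new variable 0 holds the value. In the cases of sum and product, three new variables
  hold the two arguments and the result, so that \<open>prv_add\<close> and \<open>prv_mul\<close>
  apply.\<close>

lemma prv_evt: "prv (evt e t ## e) (Eq (lift_tm 0 t) X0)"
proof (induction t)
  case (Var i)
  have "prv (evt e (Var i) ## e) (Eq X0 X0)" by (rule prv_HA[OF ha_eq_refl])
  then show ?case by simp
next
  case Zero
  have "prv (evt e Zero ## e) (Eq X0 X0)" by (rule prv_HA[OF ha_eq_refl])
  then show ?case by simp
next
  case (Succ t)
  from prv_mp[OF prv_HA[OF HA_Succ_cong] this] show ?case by simp
next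
  case (Add s t)
  let ?l = "\<lambda>t. lift_tm 0 (lift_tm 0 (lift_tm 0 t))"
  let ?e = "evt e s ## evt e t ## (evt e s \<oplus> evt e t) ## e"
  have "prv ?e (Eq (?l s) X0)" "prv ?e (Eq (?l t) X1)" using Add by simp_all
  then have "prv ?e (Eq (Add (?l s) (?l t)) X2)"
    using prv_HA[OF HA_Add_cong[of "?l s" X0 "?l t" X1 X2]] prv_mp prv_add by blast
  then show ?case by simp
next
  case (Mul s t)
  let ?l = "\<lambda>t. lift_tm 0 (lift_tm 0 (lift_tm 0 t))"
  let ?e = "evt e s ## evt e t ## (evt e s \<otimes> evt e t) ## e"
  have "prv ?e (Eq (?l s) X0)" "prv ?e (Eq (?l t) X1)" using Mul by simp_all
  then have "prv ?e (Eq (Mul (?l s) (?l t)) X2)"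
    using prv_HA[OF HA_Mul_cong[of "?l s" X0 "?l t" X1 X2]] prv_mp prv_mul by blast
  then show ?case by simp
qed

lemma definable_eval [dfn]: "definable (\<lambda>e. eval (e 0 ## c) A)"
  unfolding definable_def
proof (intro exI allI)
  fix e :: "nat => 'a"
  show "eval (e 0 ## c) A \<longleftrightarrow> eval (mix e c) (psub (\<lambda>i. Var (if i = 0 then 0 else 2 * (i - 1) + 1)) A)"
    unfolding eval_ren by (rule eval_cong) (auto simp: mix_def push_def split: nat.split)
qed

lemma dfun_mcf:
  assumes "!!i. dfun (\<lambda>e. f e i)" shows "dfun (\<lambda>e. mcf k (f e) A)"
proof -
  have "dfun (\<lambda>e. mct k (f e) t)" for k t
  proof (induction t)
    case (Var i)
    then show ?case using assms by (cases "i < k") (auto intro!: dfn)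
  qed (auto intro!: dfn)
  then show ?thesis by (induction A arbitrary: k) (auto intro!: dfn)
qed

text \<open>Induction inside the model on the bound, with the new endpoint added by
  \<open>HA_ball_Succ\<close>. The bound is a separate variable in front of \<open>e\<close>, past
  which \<open>A\<close> is lifted.\<close>

lemma prv_ball:
  assumes "!!x. eval (x ## e) A ==> prv (x ## e) A"
  shows "(\<forall>x. x \<preceq> n \<longrightarrow> eval (x ## e) A) \<longrightarrow> prv (n ## e) (Forall (Imp (le_fm X0 X1) (lift (Suc 0) A)))"
proof (induct n rule: pa_induct)
  case definable
  have "dfun (\<lambda>ea. (ea 0 ## e) i)" for i by (cases i) (auto intro!: dfn)
  then show ?case by (intro definable_imp definable_all dfn dfun_mcf definable_comp1[OF definable_eval])
next
  case zero
  show ?case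
  proof
    assume "\<forall>x. x \<preceq> zero \<longrightarrow> eval (x ## e) A"
    then have "prv e (sub 0 Zero A)" using assms by (simp add: mcf_sub_Zero)
    from prv_mp[OF prv_HA[OF HA_ball_0] this]
    have "prv e (Forall (Imp (le_fm X0 Zero) A))" .
    then show "prv (zero ## e) (Forall (Imp (le_fm X0 X1) (lift (Suc 0) A)))" by (simp add: le_fm_eq)
  qed
next
  case (suc n)
  show ?case
  proof
    assume *: "\<forall>x. x \<preceq> suc n \<longrightarrow> eval (x ## e) A"
    then have "prv (n ## e) (Forall (Imp (le_fm X0 X1) (lift (Suc 0) A)))"
      using suc le_trans le_suc_self by blast
    moreover have "prv (n ## e) (sub 0 (Succ X0) (lift (Suc 0) A))"
      using * assms by (simp add: mcf_sub_Succ)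
    moreover have "prv (n ## e) (Imp (Forall (Imp (le_fm X0 X1) (lift (Suc 0) A)))
       (Imp (sub 0 (Succ X0) (lift (Suc 0) A)) (Forall (Imp (le_fm X0 (Succ X1)) (lift (Suc 0) A)))))"
      using prv_HA[OF HA_ball_Succ[of X0 "lift (Suc 0) A"], of "n ## e"] by simp
    ultimately have "prv (n ## e) (Forall (Imp (le_fm X0 (Succ X1)) (lift (Suc 0) A)))"
      using prv_mp by blast
    then show "prv (suc n ## e) (Forall (Imp (le_fm X0 X1) (lift (Suc 0) A)))" by (simp add: le_fm_eq)
  qed
qed

text \<open>The environment is arbitrary because the existential case takes its witness from the
  model, where it may be nonstandard.\<close>

theorem sigma_complete: "sigma A ==> eval e A ==> prv e A"
proof (induction arbitrary: e rule: sigma.induct)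
  case (sg_eq s t)
  let ?e = "evt e s ## e"
  have "prv ?e (Eq (lift_tm 0 s) X0)" "prv ?e (Eq (lift_tm 0 t) X0)"
    using prv_evt[of e s] prv_evt[of e t] sg_eq by simp_all
  then have "prv ?e (Eq (lift_tm 0 s) (lift_tm 0 t))" using prv_HA[OF HA_Eq_join] prv_mp by blast
  then show ?case by simp
next
  case (sg_conj A B)
  then have "prv e A" "prv e B" by simp_all
  then show ?case using prv_HA[OF ha_conjI] prv_mp by blast
next
  case (sg_disj A B)
  then have "prv e A \<or> prv e B" by auto
  then show ?case using prv_HA[OF ha_disj1] prv_HA[OF ha_disj2] prv_mp by blast
next
  case (sg_ex A)
  then obtain x where "prv (x ## e) A" by auto
  moreover have "HA \<turnstile> Imp A (lift 0 (Exists A))"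
    using ha_ex[of X0 "lift (Suc 0) A"] by simp
  ultimately have "prv (x ## e) (lift 0 (Exists A))" using prv_HA prv_mp by blast
  then show ?case by (simp only: mcf_lift)
next
  case (sg_ball A j)
  then have "prv (e j ## e) (Forall (Imp (le_fm X0 X1) (lift (Suc 0) A)))"
    using prv_ball[of e A "e j"] by auto
  then show ?case by (simp add: le_fm_eq)
qed simp_all

corollary sigma_complete_sentence: "sigma A ==> sentence A ==> eval e A ==> DPrv (nm (code A))"
  using sigma_complete[of A e] by (simp add: sentence_def mcf_closed)

end


section \<open>Provability and arithmetical soundness\<close>

lemma sigma_funpow_Exists: "sigma A ==> sigma ((Exists ^^ k) A)"
  by (induction k) (auto intro: sg_ex)

lemma sigma_beta_fm: "sigma (beta_fm a b i y)"
  unfolding beta_fm_def by (intro sigma.intros sigma_le)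

lemma sigma_conjs: "(!!A. A \<in> set As ==> sigma A) ==> sigma (conjs As)"
  by (induction As) (auto intro: sigma.intros)

lemma sigma_disjs: "(!!A. A \<in> set As ==> sigma A) ==> sigma (disjs As)"
  by (induction As) (auto intro: sigma.intros)

lemma sigma_by_rule: "sigma (by_rule a b i r)"
  unfolding by_rule_def
  by (cases r) (auto intro!: sigma_funpow_Exists sg_conj sg_ex sigma_conjs sigma_beta_fm sigma_le)

lemma sigma_Prov: "sigma (Prov t)"
proof -
  have "sigma (disjs (map (by_rule X3 X2 X0) rules))"
    by (rule sigma_disjs) (auto intro: sigma_by_rule)
  from sg_ball[OF this, of 0] show ?thesis
    unfolding Prov_def by (intro sg_ex sg_conj sigma_beta_fm) simp
qed

lemma vars_below_lifts: "vars_below_tm (n + k) (lifts k t) \<longleftrightarrow> vars_below_tm n t"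
  by (induction k) (auto simp: lifts_def)

lemma vars_below_beta_fm: "vars_below_tm n a ==> vars_below_tm n b ==> vars_below_tm n i ==> vars_below_tm n y ==>
    vars_below n (beta_fm a b i y)"
  by (auto simp: beta_fm_def lifts_def)

lemma vars_below_conjs: "vars_below n (conjs As) \<longleftrightarrow> (\<forall>A\<in>set As. vars_below n A)"
  by (induction As) auto

lemma vars_below_disjs: "vars_below n (disjs As) \<longleftrightarrow> (\<forall>A\<in>set As. vars_below n A)"
  by (induction As) auto

lemma vars_below_funpow_Exists: "vars_below n ((Exists ^^ k) A) \<longleftrightarrow> vars_below (n + k) A"
  by (induction k arbitrary: n) auto

lemma vars_below_by_rule:
  assumes "r \<in> set rules" "vars_below_tm n a" "vars_below_tm n b" "vars_below_tm n i"
  shows "vars_below n (by_rule a b i r)"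
proof -
  obtain ps c where r: "r = (ps, c)" by (cases r)
  have l: "vars_below_tm (n + 6) (lifts 6 t)" "vars_below_tm (Suc (n + 6)) (lifts 7 t)" if "vars_below_tm n t" for t
    using that vars_below_lifts[of n 6 t] vars_below_lifts[of n 7 t] by (simp_all add: numeral_eq_Suc)
  have "vars_below_tm (n + 6) c" "!!p. p \<in> set ps ==> vars_below_tm (n + 6) p"
    using rules_below[of ps c] assms(1) r vars_below_tm_mono[of 6 _ "n + 6"] by auto
  moreover from this have "vars_below_tm (Suc (n + 6)) (lifts 1 p)" if "p \<in> set ps" for p
    using that vars_below_lifts[of "n + 6" 1 p] by simp
  ultimately show ?thesis using l assms
    by (auto simp: r by_rule_def vars_below_funpow_Exists vars_below_conjs intro!: vars_below_beta_fm)
qed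

lemma vars_below_qpair [simp]: "vars_below_tm n (qpair s t) \<longleftrightarrow> vars_below_tm n s \<and> vars_below_tm n t"
  by (auto simp: qpair_def)

lemma vars_below_num [simp]: "vars_below_tm n (num k)"
  by (induction k) auto

lemma vars_below_Prov: "vars_below_tm n t ==> vars_below n (Prov t)"
proof -
  assume "vars_below_tm n t"
  then have "vars_below_tm (Suc (Suc (Suc n))) (lifts 3 t)" using vars_below_lifts[of n 3 t] by (simp add: numeral_3_eq_3)
  then show ?thesis
    unfolding Prov_def
    by (auto simp: vars_below_disjs intro!: vars_below_beta_fm vars_below_by_rule)
qed

lemma sentence_BoxHA: "sentence (BoxHA A)"
  by (simp add: sentence_def BoxHA_def vars_below_Prov)

lemma sigma_BoxHA: "sigma (BoxHA A)"
  by (simp add: BoxHA_def sigma_Prov)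

section \<open>Derivability conditions, and transfer from models to HA\<close>

context pa
begin

lemma eval_BoxHA [simp]: "eval e (BoxHA A) \<longleftrightarrow> DPrv (nm (code A))"
  by (simp add: BoxHA_def)

lemma eval_DiaHA [simp]: "eval e (DiaHA A) \<longleftrightarrow> \<not> DPrv (nm (code (Neg A)))"
  by (simp add: DiaHA_def)

lemma box_mp: "DPrv (nm (code (Imp A B))) ==> DPrv (nm (code A)) ==> DPrv (nm (code B))"
  using DPrv_mp by (simp add: nm_pair)

lemma box_mono: "HA \<turnstile> Imp A B ==> DPrv (nm (code A)) ==> DPrv (nm (code B))"
  using box_mp necessitation by blast

lemma box_box: "DPrv (nm (code A)) ==> DPrv (nm (code (BoxHA A)))"
  by (rule sigma_complete_sentence) (simp_all add: sigma_BoxHA sentence_BoxHA)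

end

text \<open>Sigma formulas satisfy the condition on the premise \<open>A\<close>; negative formulas
  and negated Sigma formulas satisfy both conditions.\<close>

lemma HA_valid:
  assumes "!!\<Gamma>. \<Gamma> |- A ==> \<Gamma> |- N A" "!!\<Gamma>. \<Gamma> |- N B ==> \<Gamma> |- B"
    and "!!zero suc add mul e. pa (zero :: nat) suc add mul ==>
      arith.eval zero suc add mul e A ==> arith.eval zero suc add mul e B"
  shows "HA \<turnstile> Imp A B"
proof -
  have "valid (Imp A B)" unfolding valid_def using assms(3) by (simp add: arith.eval.simps)
  then have "HA \<turnstile> Imp (N A) (N B)" using valid_N by fastforce
  then have "{A} |- N B" using nd_HA_mp assms(1) nd_0 by blast
  then show ?thesis using assms(2) by (intro HA_nd nd_impI) simp
qed

lemma nd_N_sigma: "sigma A ==> \<Gamma> |- A ==> \<Gamma> |- N A"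
  using sigma_N by blast

lemma nd_N_neg_sigma: "sigma P ==> \<Gamma> |- Neg P ==> \<Gamma> |- N (Neg P)"
  and nd_neg_sigma_N: "sigma P ==> \<Gamma> |- N (Neg P) ==> \<Gamma> |- Neg P"
proof -
  assume P: "sigma P"
  show "\<Gamma> |- N (Neg P)" if "\<Gamma> |- Neg P"
  proof -
    have "insert (N P) \<Gamma> |- Neg (Neg P)" using sigma_N[OF P] nd_0 by blast
    then have "insert (N P) \<Gamma> |- Bot" using nd_weak[OF that] nd_mp by blast
    then show ?thesis by (simp add: nd_impI)
  qed
  show "\<Gamma> |- Neg P" if "\<Gamma> |- N (Neg P)"
    by (rule nd_neg_mono[of _ "N P"]) (use that sigma_N[OF P] in auto)
qed

lemma sigma_contrapos:
  assumes "sigma P" "sigma Q" "!!zero suc add mul e. pa (zero :: nat) suc add mul ==>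
    arith.eval zero suc add mul e P ==> arith.eval zero suc add mul e Q"
  shows "HA \<turnstile> Imp (Neg Q) (Neg P)"
  using nd_N_neg_sigma[OF assms(2)] nd_neg_sigma_N[OF assms(1)] assms(3)
  by (intro HA_valid) (auto simp only: arith.eval.simps)

lemma HA_contrapos: "HA \<turnstile> Imp A B ==> HA \<turnstile> Imp (Neg B) (Neg A)"
  by (rule HA_nd, rule nd_impI, rule nd_impI, rule nd_mp[OF nd_1]) (erule nd_HA_mp[OF _ nd_0])

text \<open>Only \<open>rc_nec\<close> and \<open>rc_trans\<close> concern provability. Both are
  contrapositives of facts about boxes: monotonicity, and \<open>box_box\<close> followed by a
  double negation under the box.\<close>

theorem RC1_sound: "\<phi> \<turnstile>\<^sub>R\<^sub>C \<psi> ==> HA \<turnstile> Imp (interp r \<phi>) (interp r \<psi>)"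
proof (induction rule: RC1.induct)
  case (rc_nec \<phi> \<psi>)
  then have c: "HA \<turnstile> Imp (Neg (interp r \<psi>)) (Neg (interp r \<phi>))" by (intro HA_contrapos)
  show ?case
    unfolding interp.simps DiaHA_def
  proof (rule sigma_contrapos[OF sigma_BoxHA sigma_BoxHA])
    fix zero :: nat and suc add mul e
    assume "pa zero suc add mul"
    then interpret pa zero suc add mul .
    show "eval e (BoxHA (Neg (interp r \<psi>))) ==> eval e (BoxHA (Neg (interp r \<phi>)))"
      using box_mono[OF c] by simp
  qed
next
  case (rc_trans \<phi>)
  let ?B = "BoxHA (Neg (interp r \<phi>))"
  show ?case
    unfolding interp.simps DiaHA_def
  proof (rule sigma_contrapos[OF sigma_BoxHA sigma_BoxHA])
    fix zero :: nat and suc add mul e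
    assume "pa zero suc add mul"
    then interpret pa zero suc add mul .
    assume "eval e ?B"
    then have "DPrv (nm (code ?B))" using box_box by simp
    moreover have "HA \<turnstile> Imp ?B (Neg (Neg ?B))" by (rule HA_nd) (rule nd_impI, rule nd_nnI, rule nd_0)
    ultimately have "DPrv (nm (code (Neg (Neg ?B))))" using box_mono by blast
    then show "eval e (BoxHA (Neg (Neg ?B)))" by (simp only: eval_BoxHA)
  qed
next
  case (rc_cut \<phi> \<psi> \<chi>)
  then show ?case using HA_trans by blast
qed (auto intro: HA_refl HA_weak ha_eq_refl ha_conj1 ha_conj2 HA_conj)


section \<open>Soundness of the coding in the standard model\<close>

interpretation std: pa "0 :: nat" Suc "(+)" "(*)"
proof
  fix e A and x :: nat
  assume "arith.eval 0 Suc (+) (*) (0 ## e) A"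
    "!!x. arith.eval 0 Suc (+) (*) (x ## e) A ==> arith.eval 0 Suc (+) (*) (Suc x ## e) A"
  then show "arith.eval 0 Suc (+) (*) (x ## e) A" by (induction x) auto
qed auto

lemma std_pr [simp]: "std.pr = pair"
  by (intro ext) (simp add: std.pr_def pair_def)

lemma std_nm [simp]: "std.nm n = n"
  by (induction n) auto

lemma std_lt [simp]: "std.lt m n \<longleftrightarrow> m < n"
  unfolding std.lt_def std.le_def by (auto simp: less_eq_Suc_le le_iff_add)

lemma pair_inj [simp]: "pair x y = pair x' y' \<longleftrightarrow> x = x' \<and> y = y'"
  using std.pr_inj by simp

lemma code_tm_inj [simp]: "code_tm s = code_tm t \<longleftrightarrow> s = t"
  by (induction s arbitrary: t; case_tac t; auto)

lemma code_inj [simp]: "code A = code B \<longleftrightarrow> A = B"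
  by (induction A arbitrary: B; case_tac B; auto)

lemma code_tm_cases:
  "pair 0 x = code_tm t \<longleftrightarrow> t = Var x"
  "pair (Suc 0) x = code_tm t \<longleftrightarrow> t = Zero \<and> x = 0"
  "pair 2 x = code_tm t \<longleftrightarrow> (\<exists>s. t = Succ s \<and> x = code_tm s)"
  "pair 3 (pair x y) = code_tm t \<longleftrightarrow> (\<exists>s s'. t = Add s s' \<and> x = code_tm s \<and> y = code_tm s')"
  "pair 4 (pair x y) = code_tm t \<longleftrightarrow> (\<exists>s s'. t = Mul s s' \<and> x = code_tm s \<and> y = code_tm s')"
  "pair 5 x \<noteq> code_tm t" "pair 6 x \<noteq> code_tm t" "pair 7 x \<noteq> code_tm t" "pair 8 x \<noteq> code_tm t" "pair 9 x \<noteq> code_tm t"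
  "pair 10 x \<noteq> code_tm t" "pair 11 x \<noteq> code_tm t"
  by (cases t; auto)+

lemma code_cases:
  "pair 5 (pair x y) = code A \<longleftrightarrow> (\<exists>s t. A = Eq s t \<and> x = code_tm s \<and> y = code_tm t)"
  "pair 6 x = code A \<longleftrightarrow> A = Bot \<and> x = 0"
  "pair 7 (pair x y) = code A \<longleftrightarrow> (\<exists>B C. A = Conj B C \<and> x = code B \<and> y = code C)"
  "pair 8 (pair x y) = code A \<longleftrightarrow> (\<exists>B C. A = Disj B C \<and> x = code B \<and> y = code C)"
  "pair 9 (pair x y) = code A \<longleftrightarrow> (\<exists>B C. A = Imp B C \<and> x = code B \<and> y = code C)"
  "pair 10 x = code A \<longleftrightarrow> (\<exists>B. A = Forall B \<and> x = code B)"
  "pair 11 x = code A \<longleftrightarrow> (\<exists>B. A = Exists B \<and> x = code B)"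
  "pair 0 x \<noteq> code A" "pair (Suc 0) x \<noteq> code A" "pair 2 x \<noteq> code A" "pair 3 x \<noteq> code A" "pair 4 x \<noteq> code A"
  by (cases A; auto)+

text \<open>Lifting and substitution judgements are constrained only when their arguments are codes.\<close>

definition sound :: "nat => bool" where
  "sound x \<longleftrightarrow>
    (\<forall>y. x = pair 0 y \<longrightarrow> (\<exists>t. y = code_tm t)) \<and>
    (\<forall>y. x = pair 1 y \<longrightarrow> (\<exists>A. y = code A)) \<and>
    (\<forall>c u v. x = pair 2 (pair c (pair u v)) \<longrightarrow>
      (\<forall>t. u = code_tm t \<longrightarrow> v = code_tm (lift_tm c t)) \<and> (\<forall>A. u = code A \<longrightarrow> v = code (lift c A))) \<and>
    (\<forall>d w u v. x = pair 3 (pair d (pair w (pair u v))) \<longrightarrow> (\<forall>s. w = code_tm s \<longrightarrow>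
      (\<forall>t. u = code_tm t \<longrightarrow> v = code_tm (sub_tm d s t)) \<and> (\<forall>A. u = code A \<longrightarrow> v = code (sub d s A)))) \<and>
    (\<forall>y. x = pair 4 y \<longrightarrow> (\<exists>A. y = code A \<and> HA \<turnstile> A))"

lemma sound_simps [simp]:
  "sound (pair 0 y) \<longleftrightarrow> (\<exists>t. y = code_tm t)"
  "sound (pair (Suc 0) y) \<longleftrightarrow> (\<exists>A. y = code A)"
  "sound (pair 2 (pair c (pair u v))) \<longleftrightarrow>
    (\<forall>t. u = code_tm t \<longrightarrow> v = code_tm (lift_tm c t)) \<and> (\<forall>A. u = code A \<longrightarrow> v = code (lift c A))"
  "sound (pair 3 (pair d (pair w (pair u v)))) \<longleftrightarrow> (\<forall>s. w = code_tm s \<longrightarrow>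
      (\<forall>t. u = code_tm t \<longrightarrow> v = code_tm (sub_tm d s t)) \<and> (\<forall>A. u = code A \<longrightarrow> v = code (sub d s A)))"
  "sound (pair 4 y) \<longleftrightarrow> (\<exists>A. y = code A \<and> HA \<turnstile> A)"
  by (auto simp: sound_def)

abbreviation preserves :: "rule => bool" where
  "preserves r \<equiv> \<forall>\<sigma>. (\<forall>p\<in>set (fst r). sound (std.evt \<sigma> p)) \<longrightarrow> sound (std.evt \<sigma> (snd r))"

lemma syntax_rules_sound: "\<forall>r\<in>set syntax_rules. preserves r"
  by (simp add: syntax_rules_def) (auto simp: code_tm_cases code_cases)

lemma lift_rules_sound: "\<forall>r\<in>set lift_rules. preserves r"
  by (simp add: lift_rules_def code_tm_cases code_cases) (auto)

lemma sub_rules_sound: "\<forall>r\<in>set sub_rules. preserves r"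
  by (simp add: sub_rules_def code_tm_cases code_cases) (auto)

text \<open>Folds pairs of codes back into codes, so that the conclusions of the coded rules become
  instances of the rules of \<open>HA\<close>.\<close>

lemma code_simps_sym:
  "pair 0 x = code_tm (Var x)" "pair (Suc 0) 0 = code_tm Zero" "pair 2 (code_tm t) = code_tm (Succ t)"
  "pair 3 (pair (code_tm s) (code_tm t)) = code_tm (Add s t)" "pair 4 (pair (code_tm s) (code_tm t)) = code_tm (Mul s t)"
  "pair 5 (pair (code_tm s) (code_tm t)) = code (Eq s t)" "pair 6 0 = code Bot"
  "pair 7 (pair (code A) (code B)) = code (Conj A B)" "pair 8 (pair (code A) (code B)) = code (Disj A B)"
  "pair 9 (pair (code A) (code B)) = code (Imp A B)" "pair 10 (code A) = code (Forall A)" "pair 11 (code A) = code (Exists A)"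
  by simp_all

lemma HA_rules_sound: "\<forall>r\<in>set HA_rules. preserves r"
  by (simp add: HA_rules_def del: code.simps code_tm.simps)
    (auto simp: code_simps_sym HA.intros HA.ha_ind[simplified] simp del: code.simps code_tm.simps,
     auto simp: code_cases simp del: code.simps code_tm.simps intro: ha_mp ha_allI ha_exE)

lemma rules_sound: "r \<in> set rules ==> preserves r"
  unfolding rules_def using syntax_rules_sound lift_rules_sound sub_rules_sound HA_rules_sound by auto

lemma std_Der_sound: assumes "std.Der x" shows "sound x"
proof -
  obtain a b n j where *: "std.derivation a b n" "j < n" "std.bet a b j x"
    using assms unfolding std.Der_def std.entry_def by auto
  have "i < n ==> std.bet a b i y ==> sound y" for i y
  proof (induction i arbitrary: y rule: less_induct)
    case (less i)
    obtain y' where y': "std.bet a b i y'" "std.step (std.entry a b i) y'"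
      using *(1) less.prems unfolding std.derivation_def by auto
    then obtain ps c \<sigma> where r: "(ps, c) \<in> set rules" "y' = std.evt \<sigma> c" "\<forall>p\<in>set ps. std.entry a b i (std.evt \<sigma> p)"
      unfolding std.step_def by auto
    have "\<forall>p\<in>set ps. sound (std.evt \<sigma> p)"
      using r(3) less unfolding std.entry_def std_lt by (meson less_trans)
    then have "sound y'" using rules_sound[OF r(1)] r(2) by auto
    with y' less.prems std.bet_unique show ?case by blast
  qed
  with *(2,3) show ?thesis by blast
qed

text \<open>Indices of coded derivations are genuine numbers here, so \<open>std_Der_sound\<close>
  could argue by induction along the derivation.\<close>

theorem reflection: "std.eval e (BoxHA A) ==> HA \<turnstile> A"
  using std_Der_sound by fastforce


section \<open>Stages of Sigma formulas\<close>

lemma sigma_ren: "sigma A ==> sigma (psub (\<lambda>i. Var (f i)) A)"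
proof (induction arbitrary: f rule: sigma.induct)
  case (sg_ex A)
  have "up (\<lambda>i. Var (f i)) = (\<lambda>i. Var (case_nat 0 (\<lambda>i. Suc (f i)) i))" for f
    by (rule ext) (auto simp: up_def split: nat.split)
  with sg_ex show ?case by (simp add: sigma.intros)
next
  case (sg_ball A j)
  have "up (\<lambda>i. Var (f i)) = (\<lambda>i. Var (case_nat 0 (\<lambda>i. Suc (f i)) i))" for f
    by (rule ext) (auto simp: up_def split: nat.split)
  with sg_ball show ?case by (simp add: sigma.intros)
qed (simp_all add: sigma.intros)

lemma sigma_lift: "sigma A ==> sigma (lift c A)"
  using sigma_ren[of A "\<lambda>i. if i < c then i else Suc i"] by (simp add: lift_psub if_distrib)

text \<open>For a formula below a quantifier, variable 0 of \<open>P\<close> is the stage and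
  variable 1 the quantified one; once the quantifier is restored inside the stage, the two have
  changed places.\<close>

definition swap_vars :: "fm => fm" where
  "swap_vars A = psub (\<lambda>i. Var (if i = 0 then 1 else if i = 1 then 0 else i)) A"

lemma (in arith) eval_swap_vars [simp]: "eval (x ## y ## e) (swap_vars A) \<longleftrightarrow> eval (y ## x ## e) A"
  unfolding swap_vars_def eval_psub by (rule eval_cong) (auto simp: push_def split: nat.split)

lemma sigma_swap_vars: "sigma A ==> sigma (swap_vars A)"
  unfolding swap_vars_def by (rule sigma_ren)

context pa
begin

text \<open>\<open>P\<close> says that \<open>A\<close> has been verified by stage \<^term>\<open>X0\<close>, and \<open>Q\<close> is equivalent to the
  negation of \<open>P\<close>.\<close>

definition stages :: "fm => fm => fm => bool" where
  "stages A P Q \<longleftrightarrow> (\<forall>e. (eval e A \<longleftrightarrow> (\<exists>b. eval (b ## e) P)) \<and>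
    (\<forall>b. eval (b ## e) Q \<longleftrightarrow> \<not> eval (b ## e) P) \<and>
    (\<forall>b b'. b \<preceq> b' \<longrightarrow> eval (b ## e) P \<longrightarrow> eval (b' ## e) P))"

text \<open>An equation is settled at every stage. Its negation becomes a disjunction of strict
  inequalities, since \<open>Q\<close> has to be Sigma.\<close>

lemma stages_Eq: "stages (Eq s t) (lift 0 (Eq s t)) (lift 0 (Disj (le_fm (Succ s) t) (le_fm (Succ t) s)))"
  unfolding stages_def by (auto simp: lt_def[symmetric])

lemma stages_Bot: "stages Bot Bot (Eq Zero Zero)"
  by (simp add: stages_def)

lemma stages_Conj: "stages A P Q ==> stages B P' Q' ==> stages (Conj A B) (Conj P P') (Disj Q Q')"
  unfolding stages_def by simp (metis linear)

lemma stages_Disj: "stages A P Q ==> stages B P' Q' ==> stages (Disj A B) (Disj P P') (Conj Q Q')"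
  unfolding stages_def by simp blast

lemma stages_Exists: "stages A P Q ==>
    stages (Exists A) (Exists (Conj (le_fm X0 X1) (swap_vars P))) (Forall (Imp (le_fm X0 X1) (swap_vars Q)))"
  unfolding stages_def by simp (metis le_trans linear)

lemma definable_eval2: "definable (\<lambda>e. eval (e 1 ## e 0 ## c) A)"
  unfolding definable_def
proof (intro exI allI)
  fix e :: "nat => 'a"
  show "eval (e 1 ## e 0 ## c) A \<longleftrightarrow>
    eval (mix e c) (psub (\<lambda>i. Var (if i = 0 then 2 else if i = 1 then 0 else 2 * (i - 2) + 1)) A)"
    unfolding eval_ren by (rule eval_cong) (auto simp: mix_def push_def split: nat.split)
qed

text \<open>Collection provides one stage by which all instances up to the bound are
  verified.\<close>

lemma stages_Ball: assumes "stages A P Q"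
  shows "stages (Forall (Imp (le_fm X0 (Var (Suc j))) A))
    (Forall (Imp (le_fm X0 (Var (Suc (Suc j)))) (swap_vars P))) (Exists (Conj (le_fm X0 (Var (Suc (Suc j)))) (swap_vars Q)))"
proof -
  have "\<exists>b. \<forall>x. x \<preceq> e j \<longrightarrow> eval (b ## x ## e) P" if "\<forall>x. x \<preceq> e j \<longrightarrow> eval (x ## e) A" for e
  proof -
    have "\<exists>b. eval (b ## x ## e) P" if "x \<prec> suc (e j)" for x
      using assms \<open>\<forall>x. x \<preceq> e j \<longrightarrow> eval (x ## e) A\<close> that unfolding stages_def by simp
    from bounded_choice[OF definable_eval2 this] obtain B where
      "\<forall>x. x \<prec> suc (e j) \<longrightarrow> (\<exists>b. b \<preceq> B \<and> eval (b ## x ## e) P)" by blast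
    then show ?thesis using assms unfolding stages_def lt_suc by blast
  qed
  then show ?thesis using assms unfolding stages_def by simp blast
qed

end

text \<open>The formulas \<open>P\<close> and \<open>Q\<close> must serve all models simultaneously,
  as they will be parts of a sentence.\<close>

definition sigma_stages :: "fm => fm => fm => bool" where
  "sigma_stages A P Q \<longleftrightarrow> sigma P \<and> sigma Q \<and>
    (\<forall>(zero :: nat) suc add mul. pa zero suc add mul \<longrightarrow> pa.stages zero suc add mul A P Q)"

lemma sigma_stages: "sigma A ==> \<exists>P Q. sigma_stages A P Q"
proof (induction rule: sigma.induct)
  case (sg_eq s t)
  have "sigma_stages (Eq s t) (lift 0 (Eq s t)) (lift 0 (Disj (le_fm (Succ s) t) (le_fm (Succ t) s)))"
    unfolding sigma_stages_def by (intro conjI allI impI sigma_lift sigma.intros sigma_le pa.stages_Eq)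
  then show ?case by blast
next
  case sg_bot
  have "sigma_stages Bot Bot (Eq Zero Zero)"
    unfolding sigma_stages_def by (intro conjI allI impI sigma.intros pa.stages_Bot)
  then show ?case by blast
next
  case (sg_conj A B)
  then obtain P Q P' Q' where *: "sigma_stages A P Q" "sigma_stages B P' Q'" by blast
  then have "sigma_stages (Conj A B) (Conj P P') (Disj Q Q')"
    unfolding sigma_stages_def by (auto intro: pa.stages_Conj sigma.intros)
  then show ?case by blast
next
  case (sg_disj A B)
  then obtain P Q P' Q' where *: "sigma_stages A P Q" "sigma_stages B P' Q'" by blast
  then have "sigma_stages (Disj A B) (Disj P P') (Conj Q Q')"
    unfolding sigma_stages_def by (auto intro: pa.stages_Disj sigma.intros)
  then show ?case by blast
next
  case (sg_ex A)
  then obtain P Q where *: "sigma_stages A P Q" by blast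
  then have "sigma_stages (Exists A) (Exists (Conj (le_fm X0 X1) (swap_vars P))) (Forall (Imp (le_fm X0 X1) (swap_vars Q)))"
    using sg_ball[OF sigma_swap_vars, of Q 0]
    by (simp add: sigma_stages_def pa.stages_Exists[simplified] sigma.intros sigma_swap_vars)
  then show ?case by blast
next
  case (sg_ball A j)
  then obtain P Q where *: "sigma_stages A P Q" by blast
  then have "sigma_stages (Forall (Imp (le_fm X0 (Var (Suc j))) A))
      (Forall (Imp (le_fm X0 (Var (Suc (Suc j)))) (swap_vars P))) (Exists (Conj (le_fm X0 (Var (Suc (Suc j)))) (swap_vars Q)))"
    by (simp add: sigma_stages_def pa.stages_Ball sigma.intros sigma_swap_vars)
  then show ?case by blast
qed


section \<open>Self-reference\<close>

text \<open>\<open>nu_fm\<close>: \<^term>\<open>X0\<close> is the code of the numeral of \<^term>\<open>X1\<close>.\<close>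

definition nu_fm :: fm where
  "nu_fm = Exists (Exists (Conj (Conj (beta_fm X1 X0 Zero (qpair (num 1) Zero))
     (Forall (Imp (le_fm X0 (Var 4)) (Exists (Conj (beta_fm X3 X2 X1 X0) (beta_fm X3 X2 (Succ X1) (qpair (num 2) X0)))))))
     (beta_fm X1 X0 X3 X2)))"

lemma sigma_nu_fm: "sigma nu_fm"
proof -
  have "sigma (Exists (Conj (beta_fm X3 X2 X1 X0) (beta_fm X3 X2 (Succ X1) (qpair (num 2) X0))))"
    by (intro sg_ex sg_conj sigma_beta_fm)
  from sg_ball[OF this, of 3] show ?thesis
    unfolding nu_fm_def by (intro sg_ex sg_conj sigma_beta_fm) (simp add: numeral_eq_Suc)
qed

lemma (in pa) eval_nu_fm: "eval e nu_fm \<longleftrightarrow> e 0 = nu (e 1)"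
  unfolding Nu_nu[symmetric] nu_fm_def Nu_def numseq_def by (simp add: numeral_eq_Suc)

text \<open>Diagonalization: \<open>A\<close> with its own code for \<open>X1\<close> and the index
  \<open>j\<close> for \<open>X0\<close>. With guarded quantifiers instead of \<open>sub\<close>,
  the code of the result is an explicit term in the code of \<open>A\<close> and the code of its
  numeral, so no substitution function is arithmetized.\<close>

definition sol :: "fm => nat => fm" where
  "sol A j = Forall (Imp (Eq X0 (num (code A))) (Forall (Imp (Eq X0 (num j)) A)))"

text \<open>The code of \<open>Neg (sol A j)\<close>, where \<open>c\<close> is the code of
  \<open>A\<close> and \<open>v\<close> the code of the numeral of \<open>c\<close>;
  \<open>qpair Zero Zero\<close> is the code of \<open>X0\<close>.\<close>

definition negcode :: "nat => tm => tm => tm" where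
  "negcode j v c = qImp (qForall (qImp (qEq (qpair Zero Zero) v) (qForall (qImp (num (code (Eq X0 (num j)))) c)))) (num (code Bot))"

definition Xf :: "nat => fm" where
  "Xf j = Exists (Conj nu_fm (Prov (negcode j X0 X1)))"

lemma sigma_Xf: "sigma (Xf j)"
  unfolding Xf_def by (intro sg_ex sg_conj sigma_nu_fm sigma_Prov)

lemma (in pa) eval_sol: "eval e (sol A j) \<longleftrightarrow> eval (nm j ## nm (code A) ## e) A"
  by (simp add: sol_def)

lemma (in pa) eval_Xf: "e 0 = nm (code A) ==> eval e (Xf j) \<longleftrightarrow> DPrv (nm (code (Neg (sol A j))))"
  by (simp add: Xf_def eval_nu_fm sol_def negcode_def nu_nm nm_pair)

definition stage_fms :: "nat => fm \<times> fm" where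
  "stage_fms j = (SOME (P, Q). sigma_stages (Xf j) P Q)"

definition "early j = fst (stage_fms j)"
definition "late j = snd (stage_fms j)"

lemma stage_fms: "sigma (early j)" "sigma (late j)"
  "pa (zero :: nat) suc add mul ==> pa.stages zero suc add mul (Xf j) (early j) (late j)"
proof -
  obtain P Q where "case (P, Q) of (P, Q) => sigma_stages (Xf j) P Q" using sigma_stages[OF sigma_Xf[of j]] by auto
  then have "case stage_fms j of (P, Q) => sigma_stages (Xf j) P Q" unfolding stage_fms_def by (rule someI)
  then show "sigma (early j)" "sigma (late j)"
    "pa (zero :: nat) suc add mul ==> pa.stages zero suc add mul (Xf j) (early j) (late j)"
    by (auto simp: sigma_stages_def early_def late_def split: prod.splits)
qed


section \<open>Solovay sentences for a finite tree\<close>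

text \<open>The nodes of the tree are the paths that start in \<open>root\<close>, listed in reverse order.\<close>

locale tree =
  fixes D :: "'v::countable => 'v list" and sz :: "'v => nat" and root :: 'v
  assumes sz: "v \<in> set (D w) ==> sz v < sz w"
begin

inductive reach :: "'v list => 'v list => bool" for p where
  reach_refl: "reach p p"
| reach_step: "reach p q ==> v \<in> set (D (hd q)) ==> reach p (v # q)"

definition nodes :: "'v list set" where "nodes = {p. reach [root] p}"

lemma reach_cases: "reach p q ==> q = p \<or> (\<exists>v\<in>set (D (hd p)). reach (v # p) q)"
  by (induction rule: reach.induct) (auto intro: reach.intros)

lemma finite_reach: "finite {q. reach p q}"
proof (induction "sz (hd p)" arbitrary: p rule: less_induct)
  case less
  have "{q. reach p q} \<subseteq> insert p (\<Union>v\<in>set (D (hd p)). {q. reach (v # p) q})"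
    using reach_cases by blast
  moreover have "finite (\<Union>v\<in>set (D (hd p)). {q. reach (v # p) q})" using less sz by auto
  ultimately show ?case using finite_subset by blast
qed

lemma nodes_root: "[root] \<in> nodes" and nodes_step: "p \<in> nodes ==> v \<in> set (D (hd p)) ==> v # p \<in> nodes"
  by (auto simp: nodes_def intro: reach.intros)

lemma reach_suffix: "reach p q ==> \<exists>u. q = u @ p"
  by (induction rule: reach.induct) auto

lemma nodes_suffix: "p \<in> nodes ==> \<exists>u. p = u @ [root]"
  unfolding nodes_def using reach_suffix by blast

lemma nodes_nonempty: "p \<in> nodes ==> p \<noteq> []"
  using nodes_suffix by blast

lemma nodes_Cons: "v # p \<in> nodes ==> p \<noteq> [] ==> p \<in> nodes \<and> v \<in> set (D (hd p))"
  unfolding nodes_def by (auto elim: reach.cases)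

lemma nodes_append: "u @ p \<in> nodes ==> p \<noteq> [] ==> p \<in> nodes"
  by (induction u) (use nodes_Cons in auto)

text \<open>A Rosser-style comparison at a stage \<open>b\<close> verifying \<open>v # p\<close>: no
  sibling is verified before \<open>b\<close>, and at \<open>b\<close> itself none with a smaller
  number, which breaks ties. Using \<open>late\<close> for the negation of \<open>early\<close>
  keeps the formula Sigma.\<close>

definition first :: "'v => 'v list => fm" where
  "first v p = Exists (Conj (early (to_nat (v # p)))
    (Conj (Forall (Imp (le_fm X0 X1) (Disj (Eq X0 X1)
        (conjs (map (\<lambda>u. lift 1 (late (to_nat (u # p)))) (filter (\<lambda>u. u \<noteq> v) (D (hd p))))))))
      (conjs (map (\<lambda>u. late (to_nat (u # p))) (filter (\<lambda>u. to_nat u < to_nat v) (D (hd p)))))))"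

primrec enter :: "'v list => fm" where
  "enter [] = Bot"
| "enter (v # p) = (if p = [] then Xf (to_nat [v]) else Conj (enter p) (first v p))"

definition stay :: "'v list => fm" where
  "stay p = Conj (enter p) (conjs (map (\<lambda>u. Neg (Xf (to_nat (u # p)))) (D (hd p))))"

text \<open>\<open>X0\<close> selects the node and \<open>X1\<close> is the code of the template
  itself. Substituting \<open>X1\<close> for all variables of \<open>stay p\<close> passes this code
  on and leaves no other variable free. \<open>N\<close> makes the solutions negative without
  changing their truth in models.\<close>

definition template :: fm where
  "template = N (conjs (map (\<lambda>p. Imp (Eq X0 (num (to_nat p))) (psub (\<lambda>_. X1) (stay p))) (SOME ps. set ps = nodes)))"

definition S :: "'v list => fm" where "S p = sol template (to_nat p)"

text \<open>The code of the template is supplied by an existential guard here, unlike in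
  \<open>sol\<close>, so that the sentence is Sigma.\<close>

definition entered :: "'v list => fm" where
  "entered p = Exists (Conj (Eq X0 (num (code template))) (psub (\<lambda>_. X0) (enter p)))"

lemma neg_S: "neg (S p)"
  by (simp add: S_def sol_def template_def)

lemma vars_below_closed_psub: "vars_below_tm n t ==> vars_below n (psub (\<lambda>_. t) A)"
proof -
  assume "vars_below_tm n t"
  moreover obtain k where "vars_below k A" using vars_below_ex by blast
  ultimately show ?thesis by (intro vars_below_psub[of k])
qed

lemma sentence_S: "sentence (S p)"
  by (simp add: S_def sol_def sentence_def template_def vars_below_conjs vars_below_closed_psub)

lemma sentence_entered: "sentence (entered p)"
  by (simp add: sentence_def entered_def vars_below_closed_psub)

lemma sigma_first: "sigma (first v p)"
proof -
  have "sigma (Disj (Eq X0 X1) (conjs (map (\<lambda>u. lift 1 (late (to_nat (u # p)))) (filter (\<lambda>u. u \<noteq> v) (D (hd p))))))"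
    by (auto intro!: sg_disj sg_eq sigma_conjs sigma_lift stage_fms)
  from sg_ball[OF this, of 0] show ?thesis
    unfolding first_def by (intro sg_ex sg_conj stage_fms sigma_conjs) (auto intro: stage_fms)
qed

lemma sigma_enter: "sigma (enter p)"
  by (induction p) (auto intro: sigma.intros sigma_Xf sigma_first)

lemma sigma_entered: "sigma (entered p)"
  unfolding entered_def using sigma_ren[OF sigma_enter, of "\<lambda>_. 0"] by (intro sigma.intros) simp

end

section \<open>The walk through the tree in a model of PA\<close>

locale tree_model = tree D sz root + pa zero suc add mul
  for D :: "'v::countable => 'v list" and sz root and zero :: nat and suc add mul
begin

abbreviation "cst \<equiv> (\<lambda>_ :: nat. nm (code template))"

definition X :: "'v list => bool" where "X p \<longleftrightarrow> DPrv (nm (code (Neg (S p))))"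
definition W :: "'v => 'v list => bool" where "W v p \<longleftrightarrow> eval cst (first v p)"
definition G :: "'v list => bool" where "G p \<longleftrightarrow> eval cst (enter p)"
definition T :: "'v list => bool" where "T p \<longleftrightarrow> (\<forall>e. eval e (S p))"
definition E :: "'v list => nat => bool" where "E p b \<longleftrightarrow> eval (b ## cst) (early (to_nat p))"

lemma eval_X: "eval cst (Xf (to_nat p)) \<longleftrightarrow> X p"
  unfolding X_def S_def by (rule eval_Xf) simp

lemma X_E: "X p \<longleftrightarrow> (\<exists>b. E p b)"
  using stage_fms(3)[OF pa_axioms, of "to_nat p"] unfolding stages_def E_def eval_X[symmetric] by blast

lemma not_E: "eval (b ## cst) (late (to_nat p)) \<longleftrightarrow> \<not> E p b"
  using stage_fms(3)[OF pa_axioms, of "to_nat p"] unfolding stages_def E_def by blast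

lemma W_iff: "W v p \<longleftrightarrow> (\<exists>b. E (v # p) b \<and> (\<forall>b'. b' \<preceq> b \<longrightarrow> b' = b \<or> (\<forall>u\<in>set (D (hd p)). u \<noteq> v \<longrightarrow> \<not> E (u # p) b')) \<and>
    (\<forall>u\<in>set (D (hd p)). to_nat u < to_nat v \<longrightarrow> \<not> E (u # p) b))"
  unfolding W_def first_def by (simp add: eval_conjs not_E) (simp add: E_def Ball_def imp_conjL)

lemma W_X: "W v p ==> X (v # p)"
  unfolding W_iff X_E by blast

text \<open>Of two winning stages the later one would have found the sibling already verified, so
  they are equal; then the smaller number decides.\<close>

lemma W_exclusive: assumes "W v p" "W u p" "u \<in> set (D (hd p))" "v \<in> set (D (hd p))" shows "u = v"
proof (rule ccontr)
  assume "u \<noteq> v"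
  obtain b where b: "E (v # p) b" "!!b' u. b' \<preceq> b ==> u \<in> set (D (hd p)) ==> u \<noteq> v ==> E (u # p) b' ==> b' = b"
     "!!u. u \<in> set (D (hd p)) ==> to_nat u < to_nat v ==> \<not> E (u # p) b"
    using assms(1) unfolding W_iff by blast
  obtain c where c: "E (u # p) c" "!!b' v. b' \<preceq> c ==> v \<in> set (D (hd p)) ==> v \<noteq> u ==> E (v # p) b' ==> b' = c"
     "!!v. v \<in> set (D (hd p)) ==> to_nat v < to_nat u ==> \<not> E (v # p) c"
    using assms(2) unfolding W_iff by blast
  have "b = c" using b c assms(3,4) \<open>u \<noteq> v\<close> linear[of b c] by metis
  moreover have "to_nat u < to_nat v \<or> to_nat v < to_nat u" using \<open>u \<noteq> v\<close> by (metis linorder_neqE_nat to_nat_split inj_to_nat injD)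
  ultimately show False using b c assms(3,4) by blast
qed

text \<open>The winner is the child with the least number among those verified at the first stage
  that verifies any child; it may differ from \<open>v\<close>. A least stage exists because
  \<open>R\<close> is a finite disjunction of definable predicates.\<close>

lemma X_W: assumes "X (v # p)" "v \<in> set (D (hd p))" shows "\<exists>u\<in>set (D (hd p)). W u p"
proof -
  define R where "R b \<longleftrightarrow> (\<exists>u\<in>set (D (hd p)). E (u # p) b)" for b
  have "definable (\<lambda>e. \<exists>u\<in>set us. E (u # p) (e 0))" for us
    by (induction us) (auto simp: E_def intro!: dfn)
  then have "definable (\<lambda>e. R (e 0))" unfolding R_def .
  moreover obtain b where "R b" using assms unfolding X_E R_def by blast
  ultimately obtain b where b: "R b" "!!b'. b' \<prec> b ==> \<not> R b'" using least[of R] by blast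
  define U where "U = {u \<in> set (D (hd p)). E (u # p) b}"
  have "U \<noteq> {}" using b(1) unfolding R_def U_def by blast
  then obtain u where u: "u \<in> U" "!!v. v \<in> U ==> to_nat u \<le> to_nat v"
    using ex_has_least_nat[of "\<lambda>u. u \<in> U" _ to_nat] by blast
  have "W u p" unfolding W_iff
  proof (intro exI[of _ b] conjI allI impI ballI)
    show "E (u # p) b" using u(1) by (simp add: U_def)
    show "b' = b \<or> (\<forall>v\<in>set (D (hd p)). v \<noteq> u \<longrightarrow> \<not> E (v # p) b')" if "b' \<preceq> b" for b'
      using b(2)[of b'] that le_lt[of b' b] unfolding R_def by blast
    show "\<not> E (v # p) b" if "v \<in> set (D (hd p))" "to_nat v < to_nat u" for v
      using u(2)[of v] that by (auto simp: U_def)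
  qed
  then show ?thesis using u(1) by (auto simp: U_def)
qed

lemma G_root: "G [v] \<longleftrightarrow> X [v]" and G_Cons: "p \<noteq> [] ==> G (v # p) \<longleftrightarrow> G p \<and> W v p"
  by (simp_all add: G_def W_def eval_X)

lemma G_X: "p \<noteq> [] ==> G p ==> X p"
  by (cases p; cases "tl p") (auto simp: G_root G_Cons W_X)

lemma G_append: "p \<noteq> [] ==> G (u @ p) ==> G p"
  by (induction u) (auto simp: G_Cons)

text \<open>The fixed point equation: the number of \<open>p\<close> selects one conjunct of
  \<open>template\<close>, and there \<open>X\<close> speaks of the sentences \<open>S\<close>
  themselves.\<close>

lemma T_iff: assumes "p \<in> nodes" shows "eval e (S p) \<longleftrightarrow> G p \<and> (\<forall>u\<in>set (D (hd p)). \<not> X (u # p))"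
proof -
  have "finite nodes" unfolding nodes_def by (rule finite_reach)
  then have nodes: "set (SOME ps. set ps = nodes) = nodes"
    by (rule someI_ex[OF finite_list])
  have "eval e (S p) \<longleftrightarrow> (\<forall>q\<in>nodes. to_nat p = to_nat q \<longrightarrow> eval cst (stay q))"
    unfolding S_def eval_sol by (subst (2) template_def) (simp add: eval_conjs nodes eval_psub)
  also have "\<dots> \<longleftrightarrow> eval cst (stay p)" using assms by auto
  also have "\<dots> \<longleftrightarrow> G p \<and> (\<forall>u\<in>set (D (hd p)). \<not> X (u # p))"
    unfolding stay_def by (simp add: eval_conjs eval_X G_def)
  finally show ?thesis .
qed

lemma eval_S: "eval e (S p) \<longleftrightarrow> T p"
  unfolding T_def using eval_sentence[OF sentence_S] by blast

lemma eval_entered: "eval e (entered p) \<longleftrightarrow> G p"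
  by (simp add: entered_def eval_psub G_def)

text \<open>At each node at most one child wins, so the entered nodes form a branch.\<close>

lemma G_comparable: "p \<in> nodes ==> q \<in> nodes ==> G p ==> G q ==> (\<exists>u. q = u @ p) \<or> (\<exists>u. p = u @ q)"
proof (induction p)
  case (Cons v p)
  show ?case
  proof (cases "p = []")
    case True
    then show ?thesis using Cons.prems nodes_suffix[of "v # p"] nodes_suffix[of q] by auto
  next
    case False
    then have p: "p \<in> nodes" "v \<in> set (D (hd p))" "G p" "W v p"
      using Cons.prems nodes_Cons G_Cons by auto
    from Cons.IH[OF p(1) Cons.prems(2) p(3) Cons.prems(4)] show ?thesis
    proof
      assume "\<exists>u. q = u @ p"
      then obtain u where u: "q = u @ p" by blast
      show ?thesis
      proof (cases u rule: rev_cases)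
        case Nil
        then show ?thesis using u by auto
      next
        case (snoc u' v')
        then have q: "q = u' @ v' # p" using u by simp
        then have "G (v' # p)" "v' # p \<in> nodes" using Cons.prems G_append nodes_append by blast+
        then have "W v' p" "v' \<in> set (D (hd p))" using False G_Cons nodes_Cons by blast+
        then have "v' = v" using W_exclusive p by blast
        then show ?thesis using q by blast
      qed
    next
      assume "\<exists>u. p = u @ q"
      then show ?thesis by (metis append_Cons)
    qed
  qed
qed (simp add: nodes_nonempty)

text \<open>True nodes are comparable. If one lay strictly above the other, the walk would have
  passed a child of the lower one, contrary to the condition that \<open>X\<close> fails for all its
  children.\<close>

lemma T_exclusive: assumes "p \<in> nodes" "q \<in> nodes" "T p" "T q" shows "p = q"
proof -
  have *: "u = []" if "u @ r \<in> nodes" "r \<in> nodes" "T r" "T (u @ r)" for u r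
  proof (cases u rule: rev_cases)
    case (snoc u' v)
    have r: "r \<noteq> []" using that nodes_nonempty by blast
    have "v # r \<in> nodes" "G (v # r)"
      using that snoc nodes_append[of u' "v # r"] G_append[of "v # r" u'] T_iff unfolding eval_S by auto
    then have "v \<in> set (D (hd r))" "X (v # r)" using r nodes_Cons G_X by blast+
    then show ?thesis using that T_iff unfolding eval_S by blast
  qed simp
  have "G p" "G q" using assms T_iff unfolding eval_S by blast+
  then show ?thesis using G_comparable[OF assms(1,2)] * assms by (metis append_Nil)
qed

text \<open>As long as \<open>X\<close> holds for some child, a winning child can be entered;
  \<open>sz\<close> decreases, so the walk stops.\<close>

lemma G_T: "p \<in> nodes ==> G p ==> \<exists>u. u @ p \<in> nodes \<and> T (u @ p)"
proof (induction "sz (hd p)" arbitrary: p rule: less_induct)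
  case less
  show ?case
  proof (cases "\<exists>v\<in>set (D (hd p)). X (v # p)")
    case True
    then obtain v where v: "v \<in> set (D (hd p))" "W v p" using X_W by blast
    then have "v # p \<in> nodes" "G (v # p)" using less.prems nodes_step G_Cons nodes_nonempty by auto
    then obtain u where "u @ v # p \<in> nodes" "T (u @ v # p)" using less.hyps[of "v # p"] sz[OF v(1)] by auto
    then show ?thesis by (intro exI[of _ "u @ [v]"]) simp
  next
    case False
    then have "T p" using less.prems T_iff unfolding eval_S by blast
    then show ?thesis using less.prems by (intro exI[of _ "[]"]) simp
  qed
qed

lemma T_child: "T p ==> p \<in> nodes ==> v \<in> set (D (hd p)) ==> \<not> DPrv (nm (code (Neg (S (v # p)))))"
  using T_iff unfolding eval_S X_def by blast

text \<open>Entering \<open>p\<close> required \<open>X p\<close>, and being entered is a true Sigma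
  sentence. So at a true node HA proves that the walk has reached \<open>p\<close> and does not stay
  there.\<close>

lemma T_refuted: "T p ==> p \<in> nodes ==> DPrv (nm (code (Neg (S p)))) \<and> DPrv (nm (code (entered p)))"
proof -
  assume "T p" "p \<in> nodes"
  then have "G p" "X p" using T_iff nodes_nonempty G_X unfolding eval_S by blast+
  then show ?thesis unfolding X_def using sigma_complete_sentence[OF sigma_entered sentence_entered] eval_entered by blast
qed

end


text \<open>Variables are negative by assumption and diamonds are negated Sigma sentences, so
  \<open>HA_valid\<close> applies to interpretations on either side.\<close>

lemma nd_interp_N:
  assumes "!!x. neg (r x)"
  shows "\<Gamma> |- interp r \<phi> \<longleftrightarrow> \<Gamma> |- N (interp r \<phi>)"
proof (induction \<phi> arbitrary: \<Gamma>)
  case (And \<phi> \<psi>)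
  have *: "\<Gamma> |- Conj A B \<longleftrightarrow> \<Gamma> |- A \<and> \<Gamma> |- B" for A B by (meson nd_conjI nd_conj1 nd_conj2)
  show ?case using And by (simp add: *)
next
  case (Dia \<phi>)
  show ?case using nd_N_neg_sigma nd_neg_sigma_N sigma_BoxHA by (simp only: interp.simps DiaHA_def) blast
qed (simp_all add: assms N_neg)

context tree
begin

lemma tree_model: "pa (zero :: nat) suc add mul ==> tree_model D sz zero suc add mul"
  by (intro tree_model.intro tree_axioms)

lemma HA_child: assumes "p \<in> nodes" "v \<in> set (D (hd p))"
  shows "HA \<turnstile> Imp (BoxHA (Neg (S (v # p)))) (Neg (S p))"
proof (rule HA_valid)
  fix zero :: nat and suc add mul e
  assume "pa zero suc add mul"
  then interpret tree_model D sz root zero suc add mul by (rule tree_model)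
  show "eval e (BoxHA (Neg (S (v # p)))) ==> eval e (Neg (S p))"
    using T_child[OF _ assms] by (auto simp: eval_S)
qed (use nd_N_sigma sigma_BoxHA in \<open>auto simp: N_neg neg_S\<close>)

lemma HA_descendant: "u \<noteq> [] ==> u @ p \<in> nodes ==> p \<noteq> [] ==> HA \<turnstile> Imp (BoxHA (Neg (S (u @ p)))) (Neg (S p))"
proof (induction u)
  case (Cons v u)
  let ?q = "u @ p"
  have q: "?q \<in> nodes" "v \<in> set (D (hd ?q))" using Cons.prems nodes_Cons[of v ?q] by auto
  note child = HA_child[OF q]
  show ?case
  proof (cases "u = []")
    case True
    then show ?thesis using child by simp
  next
    case False
    have IH: "HA \<turnstile> Imp (BoxHA (Neg (S ?q))) (Neg (S p))" using Cons q False by simp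
    have "HA \<turnstile> Imp (BoxHA (Neg (S (v # ?q)))) (Neg (S p))"
    proof (rule HA_valid)
      fix zero :: nat and suc add mul e
      assume "pa zero suc add mul"
      then interpret tree_model D sz root zero suc add mul by (rule tree_model)
      assume "eval e (BoxHA (Neg (S (v # ?q))))"
      \<comment> \<open>Transitivity: the box is boxed once more, and \<open>child\<close> turns the
        inner one into the negation of \<open>S ?q\<close>.\<close>
      then have "DPrv (nm (code (BoxHA (Neg (S (v # ?q))))))" using box_box by (simp only: eval_BoxHA)
      then have "eval e (BoxHA (Neg (S ?q)))" using box_mono[OF child] by (simp only: eval_BoxHA)
      then show "eval e (Neg (S p))" using HA_sound[OF IH] eval.simps(5) by blast
    qed (use nd_N_sigma sigma_BoxHA in \<open>auto simp: N_neg neg_S\<close>)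
    then show ?thesis by simp
  qed
qed simp

lemma neg_conjs: "(!!A. A \<in> set As ==> neg A) ==> neg (conjs As)"
  by (induction As) auto

text \<open>The negated conjunction of negations is a disjunction over the strict descendants in
  negative form. The lemma is applied under the box, to both facts of
  \<open>T_refuted\<close>.\<close>

lemma HA_move:
  assumes "p \<in> nodes" "set ds = {q \<in> nodes. \<exists>u. u \<noteq> [] \<and> q = u @ p}"
  shows "HA \<turnstile> Imp (entered p) (Imp (Neg (S p)) (Neg (conjs (map (\<lambda>q. Neg (S q)) ds))))"
proof (rule HA_valid)
  have "neg (conjs (map (\<lambda>q. Neg (S q)) ds))" by (rule neg_conjs) (auto simp: neg_S)
  then show "\<Gamma> |- Imp (Neg (S p)) (Neg (conjs (map (\<lambda>q. Neg (S q)) ds)))"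
    if "\<Gamma> |- N (Imp (Neg (S p)) (Neg (conjs (map (\<lambda>q. Neg (S q)) ds))))" for \<Gamma>
    using that by (simp add: N_neg neg_S)
  fix zero :: nat and suc add mul e
  assume "pa zero suc add mul"
  then interpret tree_model D sz root zero suc add mul by (rule tree_model)
  assume "eval e (entered p)"
  then obtain u where u: "u @ p \<in> nodes" "T (u @ p)" using G_T[OF assms(1)] by (auto simp: eval_entered)
  show "eval e (Imp (Neg (S p)) (Neg (conjs (map (\<lambda>q. Neg (S q)) ds))))"
  proof (cases "u = []")
    case True
    then show ?thesis using u by (simp add: eval_S)
  next
    case False
    then have "u @ p \<in> set ds" using u(1) assms(2) by blast
    then show ?thesis using u(2) by (auto simp: eval_conjs eval_S)
  qed
qed (use nd_N_sigma sigma_entered in auto)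

text \<open>A refutation would start the walk in the standard model, where it ends at a true node.
  The sentence of this node is refutable by \<open>T_refuted\<close>, really so by
  \<open>reflection\<close>, and hence false.\<close>

theorem not_HA_neg_root: "\<not> HA \<turnstile> Neg (S [root])"
proof
  assume *: "HA \<turnstile> Neg (S [root])"
  interpret tree_model D sz root "0 :: nat" Suc "(+)" "(*)" by (rule tree_model) unfold_locales
  have "G [root]" unfolding G_root X_def by (rule std.necessitation[OF *])
  then obtain u where u: "u @ [root] \<in> nodes" "T (u @ [root])" using G_T nodes_root by blast
  then have "HA \<turnstile> Neg (S (u @ [root]))"
    using T_refuted reflection[of undefined "Neg (S (u @ [root]))"] unfolding std.eval_BoxHA by blast
  then have "std.eval undefined (Neg (S (u @ [root])))" by (rule std.HA_sound)
  with u(2) show False by (simp add: eval_S)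
qed

end


section \<open>Arithmetical completeness\<close>

instance sp :: countable by countable_datatype

text \<open>A formula is a conjunction of variables and diamonds; \<open>atoms\<close> collects the
  variables and \<open>dias\<close> the bodies of the diamonds, which label the children in the
  tree.\<close>

primrec dias :: "sp => sp list" where
  "dias Top = []"
| "dias (PVar x) = []"
| "dias (And \<phi> \<psi>) = dias \<phi> @ dias \<psi>"
| "dias (Dia \<phi>) = [\<phi>]"

primrec atoms :: "sp => nat set" where
  "atoms Top = {}"
| "atoms (PVar x) = {x}"
| "atoms (And \<phi> \<psi>) = atoms \<phi> \<union> atoms \<psi>"
| "atoms (Dia \<phi>) = {}"

lemma size_dias: "\<chi> \<in> set (dias \<phi>) ==> size \<chi> < size \<phi>"
  by (induction \<phi>) auto

lemma RC1_dias: "\<chi> \<in> set (dias \<phi>) ==> \<phi> \<turnstile>\<^sub>R\<^sub>C Dia \<chi>"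
  by (induction \<phi>) (auto intro: rc_refl rc_cut[OF rc_conj1] rc_cut[OF rc_conj2])

lemma RC1_atoms: "x \<in> atoms \<phi> ==> \<phi> \<turnstile>\<^sub>R\<^sub>C PVar x"
  by (induction \<phi>) (auto intro: rc_refl rc_cut[OF rc_conj1] rc_cut[OF rc_conj2])

locale sp_tree = fixes root :: sp
begin

sublocale tree dias size root
  by unfold_locales (rule size_dias)

text \<open>Kripke semantics on the tree, whose accessibility relation is the strict descendant
  relation, as \<open>rc_trans\<close> demands.\<close>

primrec forces :: "sp list => sp => bool" where
  "forces p Top \<longleftrightarrow> True"
| "forces p (PVar x) \<longleftrightarrow> x \<in> atoms (hd p)"
| "forces p (And \<phi> \<psi>) \<longleftrightarrow> forces p \<phi> \<and> forces p \<psi>"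
| "forces p (Dia \<phi>) \<longleftrightarrow> (\<exists>u. u \<noteq> [] \<and> u @ p \<in> nodes \<and> forces (u @ p) \<phi>)"

lemma RC1_descendant: "u \<noteq> [] ==> u @ p \<in> nodes ==> p \<noteq> [] ==> hd p \<turnstile>\<^sub>R\<^sub>C Dia (hd (u @ p))"
proof (induction u)
  case (Cons v u)
  then have q: "u @ p \<in> nodes" "v \<in> set (dias (hd (u @ p)))" using nodes_Cons[of v "u @ p"] by auto
  then have v: "hd (u @ p) \<turnstile>\<^sub>R\<^sub>C Dia v" by (intro RC1_dias)
  show ?case
  proof (cases "u = []")
    case True
    then show ?thesis using v by simp
  next
    case False
    then have "hd p \<turnstile>\<^sub>R\<^sub>C Dia (hd (u @ p))" using Cons q by simp
    then show ?thesis using rc_cut[OF _ rc_cut[OF rc_nec[OF v] rc_trans]] by simp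
  qed
qed simp

lemma forces_RC1: "p \<in> nodes ==> forces p \<chi> ==> hd p \<turnstile>\<^sub>R\<^sub>C \<chi>"
proof (induction \<chi> arbitrary: p)
  case (Dia \<chi>)
  then obtain u where "u \<noteq> []" "u @ p \<in> nodes" "forces (u @ p) \<chi>" by auto
  then show ?case using Dia RC1_descendant nodes_nonempty rc_nec rc_cut by meson
qed (auto intro: rc_top RC1_atoms rc_conjI)

text \<open>A node forces its own label, each diamond at the child it created. Inclusion of atoms
  and diamonds is the form that passes to conjuncts.\<close>

lemma forces_self: "p \<in> nodes ==> atoms \<chi> \<subseteq> atoms (hd p) ==> set (dias \<chi>) \<subseteq> set (dias (hd p)) ==> forces p \<chi>"
proof (induction \<chi> arbitrary: p)
  case (Dia \<chi>)
  then have "\<chi> # p \<in> nodes" using nodes_step by simp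
  then show ?case using Dia.IH[of "\<chi> # p"] by (auto intro!: exI[of _ "[\<chi>]"])
qed auto

text \<open>The disjunction of \<open>S p\<close> over the nodes that force \<open>PVar x\<close>,
  in negative form.\<close>

definition canonical :: "nat => fm" where
  "canonical x = Neg (conjs (map (\<lambda>p. Neg (S p)) (SOME ps. set ps = {p \<in> nodes. x \<in> atoms (hd p)})))"

lemma set_some: "A \<subseteq> nodes ==> set (SOME ps. set ps = A) = A"
proof -
  assume "A \<subseteq> nodes"
  then have "finite A" using finite_reach[of "[root]"] finite_subset unfolding nodes_def by blast
  then show ?thesis by (rule someI_ex[OF finite_list])
qed

lemma neg_canonical: "neg (canonical x)"
  by (auto simp: canonical_def neg_S intro!: neg_conjs)

lemma realization_canonical: "realization canonical"
  using sentence_S by (auto simp: realization_def canonical_def sentence_def vars_below_conjs)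

lemma HA_forced: "p \<in> nodes ==> forces p \<chi> ==> HA \<turnstile> Imp (S p) (interp canonical \<chi>)"
proof (induction \<chi> arbitrary: p)
  case Top
  show ?case by (simp add: HA_weak ha_eq_refl)
next
  case (PVar x)
  let ?c = "conjs (map (\<lambda>p. Neg (S p)) (SOME ps. set ps = {p \<in> nodes. x \<in> atoms (hd p)}))"
  have "HA \<turnstile> Imp ?c (Neg (S p))"
    by (rule conjs_mem) (use PVar in \<open>auto simp: set_some\<close>)
  then have "HA \<turnstile> Imp (S p) (Neg ?c)" by (rule HA_flip)
  then show ?case by (simp add: canonical_def)
next
  case (And \<chi> \<chi>')
  then show ?case by (simp add: HA_conj)
next
  case (Dia \<chi>)
  then obtain u where u: "u \<noteq> []" "u @ p \<in> nodes" "forces (u @ p) \<chi>" by auto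
  have c: "HA \<turnstile> Imp (Neg (interp canonical \<chi>)) (Neg (S (u @ p)))" by (rule HA_contrapos[OF Dia.IH[OF u(2,3)]])
  have d: "HA \<turnstile> Imp (BoxHA (Neg (S (u @ p)))) (Neg (S p))"
    using HA_descendant u nodes_nonempty[OF Dia.prems(1)] by blast
  show ?case
  proof (rule HA_valid)
    fix zero :: nat and suc add mul e
    assume "pa zero suc add mul"
    then interpret pa zero suc add mul .
    show "eval e (S p) ==> eval e (interp canonical (Dia \<chi>))"
      using box_mono[OF c] HA_sound[OF d, of e] by auto
  qed (use nd_interp_N[of canonical, OF neg_canonical] in \<open>auto simp: N_neg neg_S simp del: interp.simps\<close>)
qed

text \<open>For a variable, two Solovay sentences cannot both be true. For a diamond, if
  \<open>S p\<close> held, HA would prove that the walk moves on to a strict descendant, all of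
  which refute \<open>\<chi>\<close>.\<close>

lemma HA_not_forced: "p \<in> nodes ==> \<not> forces p \<chi> ==> HA \<turnstile> Imp (interp canonical \<chi>) (Neg (S p))"
proof (induction \<chi> arbitrary: p)
  case (PVar x)
  show ?case
  proof (rule HA_valid)
    fix zero :: nat and suc add mul e
    assume "pa zero suc add mul"
    then interpret tree_model dias size root zero suc add mul by (rule tree_model)
    assume "eval e (interp canonical (PVar x))"
    then obtain q where "q \<in> nodes" "x \<in> atoms (hd q)" "T q"
      by (auto simp: canonical_def eval_conjs eval_S set_some)
    then show "eval e (Neg (S p))" using PVar T_exclusive[of p q] by (auto simp: eval_S)
  qed (auto simp: N_neg neg_S neg_canonical)
next
  case (And \<chi> \<chi>')
  then show ?case using HA_trans[OF ha_conj1] HA_trans[OF ha_conj2] by auto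
next
  case (Dia \<chi>)
  let ?Q = "{q \<in> nodes. \<exists>u. u \<noteq> [] \<and> q = u @ p}"
  define ds where "ds = (SOME ps. set ps = ?Q)"
  have ds: "set ds = ?Q" unfolding ds_def by (rule set_some) auto
  let ?c = "conjs (map (\<lambda>q. Neg (S q)) ds)"
  have "HA \<turnstile> Imp (interp canonical \<chi>) ?c"
    by (rule conjsI) (use Dia ds in auto)
  then have c: "HA \<turnstile> Imp (Neg ?c) (Neg (interp canonical \<chi>))" by (rule HA_contrapos)
  show ?case
  proof (rule HA_valid)
    fix zero :: nat and suc add mul e
    assume "pa zero suc add mul"
    then interpret tree_model dias size root zero suc add mul by (rule tree_model)
    assume d: "eval e (interp canonical (Dia \<chi>))"
    show "eval e (Neg (S p))"
    proof (rule ccontr)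
      assume "\<not> eval e (Neg (S p))"
      then have "DPrv (nm (code (Neg (S p))))" "DPrv (nm (code (entered p)))"
        using T_refuted Dia.prems(1) eval_S by auto
      then have "DPrv (nm (code (Neg ?c)))" using box_mono[OF HA_move[OF Dia.prems(1) ds]] box_mp by blast
      then have "DPrv (nm (code (Neg (interp canonical \<chi>))))" using box_mono[OF c] by blast
      with d show False unfolding interp.simps eval_DiaHA by blast
    qed
  qed (use nd_interp_N[of canonical, OF neg_canonical] in \<open>auto simp: N_neg neg_S simp del: interp.simps\<close>)
qed simp

text \<open>The root forces its label but not \<open>\<psi>\<close>, so the assumed implication
  would make \<open>S [root]\<close> refute itself.\<close>

lemma complete: assumes "HA \<turnstile> Imp (interp canonical root) (interp canonical \<psi>)" shows "root \<turnstile>\<^sub>R\<^sub>C \<psi>"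
proof (rule ccontr)
  assume "\<not> root \<turnstile>\<^sub>R\<^sub>C \<psi>"
  then have "\<not> forces [root] \<psi>" using forces_RC1[OF nodes_root] by auto
  then have "HA \<turnstile> Imp (interp canonical \<psi>) (Neg (S [root]))" by (rule HA_not_forced[OF nodes_root])
  moreover have "HA \<turnstile> Imp (S [root]) (interp canonical root)"
    by (intro HA_forced forces_self nodes_root) auto
  ultimately have "HA \<turnstile> Imp (S [root]) (Neg (S [root]))" using assms HA_trans by blast
  then have "HA \<turnstile> Neg (S [root])" using HA_mp2 HA_refl by blast
  then show False using not_HA_neg_root by blast
qed

end

theorem theorem6p1:
  fixes \<phi> \<psi> :: sp
  shows "\<phi> \<turnstile>\<^sub>R\<^sub>C \<psi> \<longleftrightarrow>
    (\<forall>r. realization r \<longrightarrow> HA \<turnstile> Imp (interp r \<phi>) (interp r \<psi>))"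
  using RC1_sound sp_tree.complete sp_tree.realization_canonical by blast

end
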